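(* Let $K$ be a field, let $L$ be a finite distributive lattice and let $P$ be the poset of join irreducible elements of $L$. Let $I_L\subset S=K[x_\alpha : \alpha\in L]$ be the ideal generated by the binomials $x_\alpha x_\beta - x_{\alpha\wedge\beta}x_{\alpha\vee\beta}$ with $\alpha,\beta\in L$ incomparable. Then \[ \operatorname{reg} I_L=|P|-\operatorname{rank} P . \]
   Context: An element $\alpha\in L$ is join irreducible if $\alpha\neq\min L$ and whenever $\alpha=\beta\vee\gamma$ with $\beta,\gamma\in L$, then $\alpha=\beta$ or $\alpha=\gamma$. The set $P$ of join irreducible elements carries the partial order induced from $L$. By Birkhoff's theorem, $L$ is isomorphic to the lattice $\mathcal{I}(P)$ of poset ideals (down-closed subsets) of $P$, ordered by inclusion. $S=K[x_\alpha:\alpha\in L]$ is the polynomial ring over $K$ with its standard grading ($\deg x_\alpha=1$). The Hibi ring of $L$ is $K[L]=S/I_L$. The rank of a finite poset is the maximal length of its chains, where a chain $p_0<p_1<\cdots<p_r$ (with $r+1$ elements) has length $r$; the empty poset has rank $-1$. For a finitely generated graded $S$-module $M$, $\operatorname{reg} M$ denotes its Castelnuovo–Mumford regularity, i.e. $\operatorname{reg} M=\max\{j-i : \operatorname{Tor}_i^S(M,K)_j\neq 0\}$. For the ideal $I_L$ one has $\operatorname{reg} I_L=\operatorname{reg}(S/I_L)+1$; this identity is taken as the convention defining $\operatorname{reg} I_L$ also in the degenerate case $I_L=0$ (i.e. when $L$ is a chain), where it gives $\operatorname{reg} I_L=1$. *)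

theory Defs
  imports "HOL-Library.Poly_Mapping" "Jordan_Normal_Form.Matrix"
begin

section \<open>The polynomial ring and the Hibi ideal\<close>

text \<open>The polynomial ring over \<open>'k\<close> in the variables indexed by \<open>'l\<close>.\<close>

type_synonym ('l, 'k) mpoly = "('l \<Rightarrow>\<^sub>0 nat) \<Rightarrow>\<^sub>0 'k"

definition Var :: "'l \<Rightarrow> ('l, 'k::comm_ring_1) mpoly" where
  "Var a = Poly_Mapping.single (Poly_Mapping.single a 1) 1"

definition monom_deg :: "('l \<Rightarrow>\<^sub>0 nat) \<Rightarrow> nat" where
  "monom_deg m = (\<Sum>a\<in>Poly_Mapping.keys m. Poly_Mapping.lookup m a)"

text \<open>The zero polynomial is homogeneous of every degree, and the only one of negative degree.\<close>

definition homogeneous :: "int \<Rightarrow> ('l, 'k::zero) mpoly \<Rightarrow> bool" where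
  "homogeneous d p \<longleftrightarrow> (\<forall>m\<in>Poly_Mapping.keys p. int (monom_deg m) = d)"

definition ideal_generated :: "'r::comm_ring_1 set \<Rightarrow> 'r set" where
  "ideal_generated B = Modules.module.span (*) B"

definition hibi_ideal :: "('l::{finite, distrib_lattice}, 'k::field) mpoly set" where
  "hibi_ideal = ideal_generated
     {Var a * Var b - Var (inf a b) * Var (sup a b) | a b. \<not> a \<le> b \<and> \<not> b \<le> a}"

section \<open>Join irreducible elements and rank\<close>

definition join_irreducibles :: "'l::{finite, distrib_lattice} set" where
  "join_irreducibles =
     {a. a \<noteq> Inf_fin UNIV \<and> (\<forall>b c. a = sup b c \<longrightarrow> a = b \<or> a = c)}"

text \<open>A chain with \<open>n\<close> elements has length \<open>n - 1\<close>. The empty chain is admitted, with length \<open>-1\<close>;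
  it only matters for the empty poset, whose rank is \<open>-1\<close>.\<close>

definition poset_rank :: "'l::order set \<Rightarrow> int" where
  "poset_rank P = Max {int (card C) - 1 | C. C \<subseteq> P \<and> Complete_Partial_Order.chain (\<le>) C}"

section \<open>Castelnuovo-Mumford regularity\<close>

text \<open>Graded modules are given as subquotients \<open>N / U\<close> of the polynomial ring \<open>S\<close>, for homogeneous
  ideals \<open>U \<subseteq> N\<close>. In particular \<open>S / I\<close> is \<open>UNIV / I\<close> and the ideal \<open>I\<close> is \<open>I / {0}\<close>.

  A resolution of \<open>N / U\<close> by finitely generated graded free modules \<open>F\<^sub>i\<close> is given by the
  degrees \<open>d i\<close> of a homogeneous basis of \<open>F\<^sub>i\<close>, i.e. \<open>F\<^sub>i\<close> is the direct sum of the
  \<open>S(- (d i ! k))\<close> for \<open>k < length (d i)\<close>, by the matrices \<open>D i\<close> of the differentials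
  \<open>F\<^sub>i\<^sub>+\<^sub>1 \<rightarrow> F\<^sub>i\<close> (note the index), and by homogeneous representatives \<open>g\<close> in \<open>N\<close> of the images of
  the basis of \<open>F\<^sub>0\<close> in \<open>N / U\<close>.\<close>

definition graded_free_resolution ::
  "('l, 'k::field) mpoly set \<Rightarrow> ('l, 'k) mpoly set \<Rightarrow>
   (nat \<Rightarrow> int list) \<Rightarrow> (nat \<Rightarrow> ('l, 'k) mpoly mat) \<Rightarrow> ('l, 'k) mpoly vec \<Rightarrow> bool" where
  "graded_free_resolution N U d D g \<longleftrightarrow>
     g \<in> carrier_vec (length (d 0)) \<and>
     (\<forall>k < length (d 0). g $ k \<in> N \<and> homogeneous (d 0 ! k) (g $ k)) \<and>
     (\<forall>i. D i \<in> carrier_mat (length (d i)) (length (d (Suc i)))) \<and>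
     (\<forall>i. \<forall>r < length (d i). \<forall>c < length (d (Suc i)).
        homogeneous (d (Suc i) ! c - d i ! r) (D i $$ (r, c))) \<and>
     (\<forall>f\<in>N. \<exists>v\<in>carrier_vec (length (d 0)). f - g \<bullet> v \<in> U) \<and>
     {v \<in> carrier_vec (length (d 0)). g \<bullet> v \<in> U}
       = (\<lambda>w. D 0 *\<^sub>v w) ` carrier_vec (length (d 1)) \<and>
     (\<forall>i. {v \<in> carrier_vec (length (d (Suc i))). D i *\<^sub>v v = 0\<^sub>v (length (d i))}
       = (\<lambda>w. D (Suc i) *\<^sub>v w) ` carrier_vec (length (d (Suc (Suc i)))))"

text \<open>Tensoring with \<open>K = S / (x\<^sub>a : a)\<close> replaces \<open>F\<^sub>i\<close> by the graded vector space with a basis in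
  degrees \<open>d i\<close>, and the entries of the matrices by their constant coefficients.\<close>

definition tensor_K :: "('l, 'k::field) mpoly mat \<Rightarrow> 'k mat" where
  "tensor_K A = map_mat (\<lambda>p. Poly_Mapping.lookup p 0) A"

definition graded_part :: "int list \<Rightarrow> int \<Rightarrow> 'k::field vec set" where
  "graded_part ds j = {v \<in> carrier_vec (length ds). \<forall>k < length ds. v $ k \<noteq> 0 \<longrightarrow> ds ! k = j}"

definition tor_cycles ::
  "(nat \<Rightarrow> int list) \<Rightarrow> (nat \<Rightarrow> ('l, 'k::field) mpoly mat) \<Rightarrow> nat \<Rightarrow> int \<Rightarrow> 'k vec set" where
  "tor_cycles d D i j = (case i of
       0 \<Rightarrow> graded_part (d 0) j
     | Suc h \<Rightarrow> {v \<in> graded_part (d i) j. tensor_K (D h) *\<^sub>v v = 0\<^sub>v (length (d h))})"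

definition tor_boundaries ::
  "(nat \<Rightarrow> int list) \<Rightarrow> (nat \<Rightarrow> ('l, 'k::field) mpoly mat) \<Rightarrow> nat \<Rightarrow> int \<Rightarrow> 'k vec set" where
  "tor_boundaries d D i j = (\<lambda>w. tensor_K (D i) *\<^sub>v w) ` graded_part (d (Suc i)) j"

text \<open>\<open>tor_nonzero N U i j\<close> says that the degree \<open>j\<close> component of \<open>Tor\<^sub>i (N / U, K)\<close>, that is cycles
  modulo boundaries, is nonzero. Up to isomorphism this component does not depend on the resolution
  that is used to compute it.\<close>

definition tor_nonzero ::
  "('l, 'k::field) mpoly set \<Rightarrow> ('l, 'k) mpoly set \<Rightarrow> nat \<Rightarrow> int \<Rightarrow> bool" where
  "tor_nonzero N U i j \<longleftrightarrow>
     (\<exists>d D g. graded_free_resolution N U d D g \<and> \<not> tor_cycles d D i j \<subseteq> tor_boundaries d D i j)"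

definition reg :: "('l, 'k::field) mpoly set \<Rightarrow> ('l, 'k) mpoly set \<Rightarrow> int" where
  "reg N U = Max {j - int i | i j. tor_nonzero N U i j}"

text \<open>For a nonzero proper homogeneous ideal the regularity of \<open>I\<close> is that of \<open>S / I\<close> plus one; for the
  zero ideal, which is the zero module, this identity is the convention.\<close>

definition reg_ideal :: "('l, 'k::field) mpoly set \<Rightarrow> int" where
  "reg_ideal I = (if I = {0} then reg UNIV I + 1 else reg I {0})"

end

(*
Let Q be the poset P of join irreducible elements with a bottom element added. The Hibi ring is the
semigroup ring of the order reversing functions on Q, and the sums theta_i of the variables of rank i form a
system of parameters. For an order reversing f and a natural labelling of Q, the product of theta_i and f has
a leading term raise_i f = f + indicator of the first i elements of Q, sorted by decreasing values of f with
ties broken by the labels. The maps raise_i are injective and behave like multiplication by independent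
variables, so the ring is free over the polynomial ring in the theta_i: they form a regular sequence, and the
quotient by them has a basis indexed by the f that are not in the image of any raise_i. The largest degree of
such an f is |P| - rank P - 1 (it is the maximal number of descents of a linear extension of P).

To compare this with Tor, take any graded free resolution F of S/I and kill the theta_i and then further linear
forms completing them to a basis of S_1, one at a time. The long exact sequences of
0 -> S/J(-1) -> S/J -> S/(J, l) -> 0 show that the homology of F modulo the theta_i is the Artinian quotient,
of top degree s, in homological degree 0, and that afterwards the bound j - i <= s persists while the top class
moves from (i, j) to (i + 1, j + 1). At the end one reads off Tor(S/I, K).
*)

theory Submission
  imports Defs "HOL-Library.Ramsey"
begin

text \<open>\<open>tor_nonzero\<close> accepts any graded free resolution, minimal or not. The bound
  on \<open>j - i\<close> therefore has to hold in every resolution, while the top class is needed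
  in only one, which is constructed. A lower bound on \<open>j - i\<close> is carried along because
  \<open>Max\<close> is meaningful only for a finite set of degrees. K may be finite, so general
  linear forms cannot be chosen and the parameters must be explicit. The raising maps behave like
  variables because raising an initial segment of the sorted poset leaves the sorting unchanged: the
  maps commute, and a coincidence of two raised functions comes from a common function below both.
  The added bottom element records the degree: the value of the exponent vector there is the degree
  of the monomial. It also makes the number of parameters |P| + 1. The remaining |L| - |P| - 1
  linear forms push the top class to homological degree |L| - |P| - 1. If I is nonzero, L is not a
  chain and this number is positive, so the class is also seen in a resolution of I, one step lower;
  this is the summand 1 between the two regularities.\<close>

abbreviation (input) "lookup \<equiv> Poly_Mapping.lookup"
abbreviation (input) "keys \<equiv> Poly_Mapping.keys"
abbreviation (input) "single \<equiv> Poly_Mapping.single"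

section \<open>Monomials and homogeneous components\<close>

lemma monom_deg_eq: "monom_deg (m :: 'l::finite \<Rightarrow>\<^sub>0 nat) = (\<Sum>a\<in>UNIV. lookup m a)"
  unfolding monom_deg_def by (rule sum.mono_neutral_left) (auto simp: in_keys_iff)

lemma monom_deg_zero [simp]: "monom_deg 0 = 0"
  by (simp add: monom_deg_def)

lemma monom_deg_add: "monom_deg (m + n :: 'l::finite \<Rightarrow>\<^sub>0 nat) = monom_deg m + monom_deg n"
  by (simp add: monom_deg_eq lookup_add sum.distrib)

lemma monom_deg_single [simp]: "monom_deg (single a n) = n"
  by (simp add: monom_deg_def)

lemma monom_deg_eq_0_iff: "monom_deg (m :: 'l::finite \<Rightarrow>\<^sub>0 nat) = 0 \<longleftrightarrow> m = 0"
  by (auto simp: monom_deg_eq intro: poly_mapping_eqI)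

lemma lookup_le_monom_deg: "lookup m a \<le> monom_deg (m :: 'l::finite \<Rightarrow>\<^sub>0 nat)"
  unfolding monom_deg_eq by (rule member_le_sum) auto

lemma finite_bounded_monoms: "finite {m :: 'l::finite \<Rightarrow>\<^sub>0 nat. monom_deg m \<le> n}"
proof -
  have "lookup ` {m :: 'l \<Rightarrow>\<^sub>0 nat. monom_deg m \<le> n} \<subseteq> PiE UNIV (\<lambda>_. {..n})"
    by (auto simp: PiE_UNIV_domain intro: order_trans[OF lookup_le_monom_deg])
  moreover have "finite (PiE (UNIV::'l set) (\<lambda>_. {..n}))"
    by (intro finite_PiE) auto
  ultimately have "finite (lookup ` {m :: 'l \<Rightarrow>\<^sub>0 nat. monom_deg m \<le> n})"
    by (rule finite_subset)
  then show ?thesis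
    by (rule finite_imageD) (auto intro!: inj_onI poly_mapping_eqI)
qed

lemma poly_mapping_sum_single: "(p :: 'm \<Rightarrow>\<^sub>0 'k::comm_monoid_add) = (\<Sum>m\<in>keys p. single m (lookup p m))"
proof (rule poly_mapping_eqI)
  fix k
  show "lookup p k = lookup (\<Sum>m\<in>keys p. single m (lookup p m)) k"
    by (simp add: lookup_sum lookup_single when_def in_keys_iff)
qed

text \<open>The condition \<open>m \<notin> keys p\<close> rules out cancellation, so that
  hypotheses about all keys of the sum pass to both \<open>m\<close> and \<open>p\<close>.\<close>

lemma poly_mapping_single_induct [case_names zero add]:
  fixes p :: "'m \<Rightarrow>\<^sub>0 'k::comm_monoid_add"
  assumes "P 0" and "\<And>m c p. c \<noteq> 0 \<Longrightarrow> m \<notin> keys p \<Longrightarrow> P p \<Longrightarrow> P (single m c + p)"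
  shows "P p"
proof -
  have "P (\<Sum>m\<in>A. single m (lookup p m))" if "finite A" "A \<subseteq> keys p" for A
    using that
  proof (induction A)
    case (insert x F)
    have "lookup (\<Sum>m\<in>F. single m (lookup p m)) x = 0"
      using insert by (simp add: lookup_sum lookup_single when_def)
    with insert show ?case by (auto simp: in_keys_iff intro!: assms(2))
  qed (simp add: assms)
  from this[of "keys p"] show ?thesis using poly_mapping_sum_single[of p] by simp
qed

lemma keys_single_add:
  "c \<noteq> 0 \<Longrightarrow> m \<notin> keys p \<Longrightarrow> keys (single m c + p) = insert m (keys (p :: 'm \<Rightarrow>\<^sub>0 'k::comm_monoid_add))"
  by (auto simp: in_keys_iff lookup_add lookup_single when_def split: if_splits)

lemma single_add_diff: "0 < lookup m a \<Longrightarrow> single a 1 + (m - single a 1) = (m :: 'l \<Rightarrow>\<^sub>0 nat)"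
  by (intro poly_mapping_eqI) (auto simp: lookup_add lookup_minus lookup_single when_def)

lemma homogeneous_zero [simp]: "homogeneous d 0"
  by (simp add: homogeneous_def)

lemma homogeneous_one [simp]: "homogeneous 0 1"
  by (simp add: homogeneous_def)

lemma homogeneous_single: "int (monom_deg m) = d \<Longrightarrow> homogeneous d (single m c)"
  by (auto simp: homogeneous_def)

lemma homogeneous_Var: "homogeneous 1 (Var a)"
  by (simp add: Var_def homogeneous_single)

lemma homogeneous_add: "homogeneous d p \<Longrightarrow> homogeneous d q \<Longrightarrow> homogeneous d (p + q)"
  using keys_add[of p q] by (auto simp: homogeneous_def)

lemma homogeneous_uminus: "homogeneous d (p :: ('l, 'k::ab_group_add) mpoly) \<Longrightarrow> homogeneous d (- p)"
  by (auto simp: homogeneous_def in_keys_iff)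

lemma homogeneous_diff:
  "homogeneous d p \<Longrightarrow> homogeneous d q \<Longrightarrow> homogeneous d (p - q :: ('l, 'k::ab_group_add) mpoly)"
  using homogeneous_add[of d p "- q"] homogeneous_uminus by auto

lemma homogeneous_sum: "(\<And>x. x \<in> A \<Longrightarrow> homogeneous d (f x)) \<Longrightarrow> homogeneous d (\<Sum>x\<in>A. f x)"
  by (induction A rule: infinite_finite_induct) (auto intro: homogeneous_add)

lemma homogeneous_mult:
  fixes p q :: "('l::finite, 'k::semiring_0) mpoly"
  assumes "homogeneous d p" "homogeneous e q" shows "homogeneous (d + e) (p * q)"
proof -
  have "int (monom_deg m) = d + e" if "m \<in> keys (p * q)" for m
  proof -
    from that keys_mult[of p q] obtain u v where "m = u + v" "u \<in> keys p" "v \<in> keys q" by blast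
    with assms show ?thesis by (auto simp: homogeneous_def monom_deg_add)
  qed
  then show ?thesis by (simp add: homogeneous_def)
qed

lemma homogeneous_negative: "homogeneous d p \<Longrightarrow> d < 0 \<Longrightarrow> p = 0"
  by (rule poly_mapping_eqI) (force simp: homogeneous_def in_keys_iff)

lemma lookup_zero_homogeneous: "homogeneous d p \<Longrightarrow> d \<noteq> 0 \<Longrightarrow> lookup p 0 = 0"
  by (metis homogeneous_def in_keys_iff monom_deg_zero of_nat_0)

definition hpart :: "int \<Rightarrow> ('l, 'k::zero) mpoly \<Rightarrow> ('l, 'k) mpoly" where
  "hpart e p = Abs_poly_mapping (\<lambda>m. if int (monom_deg m) = e then lookup p m else 0)"

lemma lookup_hpart: "lookup (hpart e p) m = (if int (monom_deg m) = e then lookup p m else 0)"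
proof -
  have "finite {m. (if int (monom_deg m) = e then lookup p m else 0) \<noteq> 0}"
    by (rule finite_subset[OF _ finite_keys[of p]]) (auto simp: in_keys_iff)
  then show ?thesis by (simp add: hpart_def)
qed

lemma keys_hpart: "keys (hpart e p) = {m \<in> keys p. int (monom_deg m) = e}"
  by (auto simp: in_keys_iff lookup_hpart split: if_splits)

lemma homogeneous_hpart: "homogeneous e (hpart e p)"
  by (simp add: homogeneous_def keys_hpart)

lemma hpart_homogeneous: "homogeneous e p \<Longrightarrow> hpart e p = p"
  by (rule poly_mapping_eqI) (auto simp: lookup_hpart homogeneous_def in_keys_iff)

lemma hpart_zero [simp]: "hpart e 0 = 0"
  by (simp add: hpart_homogeneous)

lemma hpart_add: "hpart e (p + q) = hpart e p + hpart e q"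
  by (rule poly_mapping_eqI) (auto simp: lookup_hpart lookup_add)

lemma hpart_diff: "hpart e (p - q) = hpart e p - hpart e (q :: ('l, 'k::ab_group_add) mpoly)"
  by (rule poly_mapping_eqI) (auto simp: lookup_hpart lookup_minus)

lemma hpart_sum: "hpart e (\<Sum>x\<in>A. f x) = (\<Sum>x\<in>A. hpart e (f x))"
  by (induction A rule: infinite_finite_induct) (auto simp: hpart_add)

text \<open>Split off the component of \<open>p\<close> of degree \<open>e - d\<close>. Multiplied
  by \<open>a\<close>, the rest has no monomial of degree \<open>e\<close>.\<close>

lemma hpart_mult:
  fixes a p :: "('l::finite, 'k::comm_ring_1) mpoly"
  assumes "homogeneous d a" shows "hpart e (a * p) = a * hpart (e - d) p"
proof -
  let ?h = "hpart (e - d) p"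
  have "homogeneous e (a * ?h)"
    using homogeneous_mult[OF assms homogeneous_hpart[of "e - d" p]] by simp
  moreover have "hpart e (a * (p - ?h)) = 0"
  proof (rule poly_mapping_eqI)
    fix m
    have "int (monom_deg m) \<noteq> e" if "m \<in> keys (a * (p - ?h))"
    proof -
      from that keys_mult[of a "p - ?h"] obtain u v where uv: "m = u + v" "u \<in> keys a" "v \<in> keys (p - ?h)"
        by blast
      then have "int (monom_deg v) \<noteq> e - d"
        by (auto simp: in_keys_iff lookup_minus lookup_hpart)
      with uv assms show ?thesis by (auto simp: monom_deg_add homogeneous_def)
    qed
    then show "lookup (hpart e (a * (p - ?h))) m = lookup 0 m"
      by (auto simp: lookup_hpart in_keys_iff)
  qed
  moreover have "a * p = a * ?h + a * (p - ?h)" by (simp add: algebra_simps)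
  ultimately show ?thesis by (simp add: hpart_add hpart_homogeneous)
qed

section \<open>Linear extensions\<close>

text \<open>Scalars enter as constant polynomials, so K-linear extension is written with ring
  operations. It serves for the toric map, for \<open>Psi\<close>, for \<open>Raise\<close> and for
  substitutions.\<close>

definition lin_ext :: "('m \<Rightarrow> ('n::comm_monoid_add \<Rightarrow>\<^sub>0 'k::comm_ring_1)) \<Rightarrow> ('m \<Rightarrow>\<^sub>0 'k) \<Rightarrow> ('n \<Rightarrow>\<^sub>0 'k)" where
  "lin_ext h p = (\<Sum>m\<in>keys p. single 0 (lookup p m) * h m)"

lemma lin_ext_superset:
  "finite A \<Longrightarrow> keys p \<subseteq> A \<Longrightarrow> lin_ext h p = (\<Sum>m\<in>A. single 0 (lookup p m) * h m)"
  unfolding lin_ext_def by (rule sum.mono_neutral_left) (auto simp: in_keys_iff)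

lemma lin_ext_zero [simp]: "lin_ext h 0 = 0"
  by (simp add: lin_ext_def)

lemma lin_ext_add: "lin_ext h (p + q) = lin_ext h p + lin_ext h q"
proof -
  let ?A = "keys p \<union> keys q"
  have *: "finite ?A" "keys p \<subseteq> ?A" "keys q \<subseteq> ?A" "keys (p + q) \<subseteq> ?A" 
    using keys_add[of p q] by auto
  show ?thesis
    using * by (simp add: lin_ext_superset[of ?A] lookup_add single_add algebra_simps sum.distrib)
qed

lemma lin_ext_single: "lin_ext h (single m c) = single 0 c * h m"
  by (cases "c = 0") (simp_all add: lin_ext_def)

lemma lin_ext_uminus: "lin_ext h (- p) = - lin_ext h p"
  using lin_ext_add[of h p "- p"] by (simp add: add_eq_0_iff)

lemma lin_ext_diff: "lin_ext h (p - q) = lin_ext h p - lin_ext h q"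
  using lin_ext_add[of h p "- q"] by (simp add: lin_ext_uminus)

lemma lin_ext_sum: "lin_ext h (\<Sum>x\<in>A. f x) = (\<Sum>x\<in>A. lin_ext h (f x))"
  by (induction A rule: infinite_finite_induct) (auto simp: lin_ext_add)

lemma lin_ext_mult:
  fixes p q :: "'m::comm_monoid_add \<Rightarrow>\<^sub>0 'k::comm_ring_1"
  assumes "\<And>m n. h (m + n) = h m * h n"
  shows "lin_ext h (p * q) = lin_ext h p * lin_ext h q"
proof (induction p rule: poly_mapping_single_induct)
  case (add m c p)
  have "lin_ext h (single m c * q) = single 0 c * h m * lin_ext h q"
  proof (induction q rule: poly_mapping_single_induct)
    case (add n d q)
    have "lin_ext h (single m c * single n d) = (single 0 c * single 0 d) * (h m * h n)"
      by (simp add: mult_single lin_ext_single assms)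
    with add show ?case
      by (simp add: algebra_simps lin_ext_add lin_ext_single)
  qed simp
  with add show ?case by (simp add: distrib_right lin_ext_add lin_ext_single)
qed simp

lemma keys_lin_ext: "keys (lin_ext h p) \<subseteq> (\<Union>m\<in>keys p. keys (h m))"
proof -
  have "keys (single 0 c * h m) \<subseteq> keys (h m)" for c m
    using keys_mult[of "single 0 c" "h m"] by (auto split: if_splits)
  then have "(\<Union>m\<in>keys p. keys (single 0 (lookup p m) * h m)) \<subseteq> (\<Union>m\<in>keys p. keys (h m))"
    by (intro UN_mono) auto
  then show ?thesis unfolding lin_ext_def
    by (rule order_trans[OF keys_sum])
qed

lemma lin_ext_const_mult: "lin_ext h (single 0 c * p) = single 0 c * lin_ext h (p :: 'm::comm_monoid_add \<Rightarrow>\<^sub>0 'k::comm_ring_1)"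
proof (induction p rule: poly_mapping_single_induct)
  case (add m d p)
  then show ?case 
    by (simp add: distrib_left lin_ext_add lin_ext_single mult_single flip: mult.assoc)
qed simp

section \<open>Complexes of graded free modules modulo linear forms\<close>

definition ideal_set :: "'r::comm_ring_1 set \<Rightarrow> bool" where
  "ideal_set J \<longleftrightarrow> 0 \<in> J \<and> (\<forall>p\<in>J. \<forall>q\<in>J. p + q \<in> J) \<and> (\<forall>p\<in>J. \<forall>a. a * p \<in> J)"

lemma ideal_set_zero: "ideal_set J \<Longrightarrow> 0 \<in> J"
  and ideal_set_add: "ideal_set J \<Longrightarrow> p \<in> J \<Longrightarrow> q \<in> J \<Longrightarrow> p + q \<in> J"
  and ideal_set_mult: "ideal_set J \<Longrightarrow> p \<in> J \<Longrightarrow> a * p \<in> J"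
  by (auto simp: ideal_set_def)

lemma ideal_set_mult2: "ideal_set J \<Longrightarrow> p \<in> J \<Longrightarrow> p * a \<in> J"
  using ideal_set_mult[of J p a] by (simp add: mult.commute)

lemma ideal_set_uminus: "ideal_set J \<Longrightarrow> p \<in> J \<Longrightarrow> - p \<in> J"
  using ideal_set_mult[of J p "-1"] by simp

lemma ideal_set_diff: "ideal_set J \<Longrightarrow> p \<in> J \<Longrightarrow> q \<in> J \<Longrightarrow> p - q \<in> J"
  using ideal_set_add[of J p "-q"] ideal_set_uminus[of J q] by simp

lemma ideal_set_sum: "ideal_set J \<Longrightarrow> (\<And>x. x \<in> A \<Longrightarrow> f x \<in> J) \<Longrightarrow> (\<Sum>x\<in>A. f x) \<in> J"
  by (induction A rule: infinite_finite_induct) (auto intro: ideal_set_add ideal_set_zero)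

definition graded_set :: "('l, 'k::zero) mpoly set \<Rightarrow> bool" where
  "graded_set J \<longleftrightarrow> (\<forall>p\<in>J. \<forall>e. hpart e p \<in> J)"

text \<open>For an ideal \<open>J\<close> this is the ideal \<open>J + (l)\<close>, in a form that
  hands out the cofactor of \<open>l\<close>.\<close>

definition adjoin :: "'r::comm_ring_1 \<Rightarrow> 'r set \<Rightarrow> 'r set" where
  "adjoin l J = {p. \<exists>q. p - l * q \<in> J}"

definition adjoin_list :: "'r::comm_ring_1 list \<Rightarrow> 'r set" where
  "adjoin_list ls = fold adjoin ls {0}"

lemma adjoin_list_Nil [simp]: "adjoin_list [] = {0}"
  and adjoin_list_snoc: "adjoin_list (ls @ [l]) = adjoin l (adjoin_list ls)"
  by (simp_all add: adjoin_list_def)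

lemma subset_adjoin: "J \<subseteq> adjoin l J"
proof
  fix p assume "p \<in> J"
  then have "p - l * 0 \<in> J" by simp
  then show "p \<in> adjoin l J" unfolding adjoin_def by blast
qed

lemma ideal_set_adjoin:
  assumes "ideal_set J" shows "ideal_set (adjoin l J)"
  unfolding ideal_set_def
proof (intro conjI ballI allI)
  show "0 \<in> adjoin l J" using subset_adjoin[of J l] ideal_set_zero[OF assms] by auto
next
  fix p q assume "p \<in> adjoin l J" "q \<in> adjoin l J"
  then obtain p' q' where "p - l * p' \<in> J" "q - l * q' \<in> J" by (auto simp: adjoin_def)
  from ideal_set_add[OF assms this] have "(p + q) - l * (p' + q') \<in> J" by (simp add: algebra_simps)
  then show "p + q \<in> adjoin l J" unfolding adjoin_def by blast
next
  fix p a assume "p \<in> adjoin l J"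
  then obtain p' where "p - l * p' \<in> J" by (auto simp: adjoin_def)
  from ideal_set_mult[OF assms this, of a] have "a * p - l * (a * p') \<in> J" by (simp add: algebra_simps)
  then show "a * p \<in> adjoin l J" unfolding adjoin_def by blast
qed

text \<open>Since \<open>l\<close> is homogeneous, the cofactor can be cut down to a single degree
  together with \<open>p\<close>.\<close>

lemma graded_adjoin_hpart:
  fixes J :: "('l::finite, 'k::comm_ring_1) mpoly set"
  assumes "graded_set J" "homogeneous 1 l" "p - l * q \<in> J"
  shows "hpart e p - l * hpart (e - 1) q \<in> J"
proof -
  have "hpart e (p - l * q) \<in> J" using assms by (auto simp: graded_set_def)
  then show ?thesis by (simp add: hpart_diff hpart_mult[OF assms(2)])
qed

lemma graded_set_adjoin:
  fixes J :: "('l::finite, 'k::comm_ring_1) mpoly set"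
  assumes "graded_set J" "homogeneous 1 l" shows "graded_set (adjoin l J)"
  unfolding graded_set_def
proof (intro ballI allI)
  fix p e assume "p \<in> adjoin l J"
  then obtain q where "p - l * q \<in> J" by (auto simp: adjoin_def)
  from graded_adjoin_hpart[OF assms this, of e] show "hpart e p \<in> adjoin l J"
    unfolding adjoin_def by blast
qed

lemma ideal_set_adjoin_list: "ideal_set (adjoin_list ls)"
  by (induction ls rule: rev_induct) (auto simp: adjoin_list_snoc intro: ideal_set_adjoin, simp add: ideal_set_def)

lemma graded_set_adjoin_list:
  fixes ls :: "('l::finite, 'k::comm_ring_1) mpoly list"
  assumes "\<And>l. l \<in> set ls \<Longrightarrow> homogeneous 1 l"
  shows "graded_set (adjoin_list ls)"
  using assms
  by (induction ls rule: rev_induct) (auto simp: adjoin_list_snoc intro!: graded_set_adjoin, simp add: graded_set_def)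

text \<open>The degree \<open>j\<close> component of the graded free module whose basis has the
  degrees \<open>ds\<close>.\<close>

definition hom_vecs :: "int list \<Rightarrow> int \<Rightarrow> ('l, 'k::zero) mpoly vec set" where
  "hom_vecs ds j = {v \<in> carrier_vec (length ds). \<forall>k<length ds. homogeneous (j - ds ! k) (v $ k)}"

text \<open>For an ideal \<open>J\<close> this is the submodule \<open>J F\<close> of the free
  module \<open>F\<close> of rank \<open>n\<close>.\<close>

definition vecs_in :: "'r set \<Rightarrow> nat \<Rightarrow> 'r vec set" where
  "vecs_in J n = {u \<in> carrier_vec n. \<forall>k<n. u $ k \<in> J}"

lemma hom_vecs_carrier: "v \<in> hom_vecs ds j \<Longrightarrow> v \<in> carrier_vec (length ds)"
  by (simp add: hom_vecs_def)

lemma vecs_in_carrier: "v \<in> vecs_in J n \<Longrightarrow> v \<in> carrier_vec n"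
  by (simp add: vecs_in_def)

lemma hom_vecs_diff:
  "v \<in> hom_vecs ds j \<Longrightarrow> w \<in> hom_vecs ds j \<Longrightarrow> v - w \<in> hom_vecs ds (j::int)"
  for v :: "('l, 'k::ab_group_add) mpoly vec"
  by (auto simp: hom_vecs_def homogeneous_diff)

lemma hom_vecs_smult:
  fixes v :: "('l::finite, 'k::comm_ring_1) mpoly vec"
  assumes "homogeneous e l" "v \<in> hom_vecs ds j"
  shows "l \<cdot>\<^sub>v v \<in> hom_vecs ds (j + e)"
proof -
  have "homogeneous (j + e - ds ! k) (l * v $ k)" if "k < length ds" for k
    using homogeneous_mult[OF assms(1), of "j - ds ! k" "v $ k"] assms(2) that
    by (simp add: hom_vecs_def algebra_simps)
  then show ?thesis using assms(2) by (auto simp: hom_vecs_def)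
qed

lemma vecs_in_add: "ideal_set J \<Longrightarrow> v \<in> vecs_in J n \<Longrightarrow> w \<in> vecs_in J n \<Longrightarrow> v + w \<in> vecs_in J n"
  by (auto simp: vecs_in_def ideal_set_add)

lemma vecs_in_uminus: "ideal_set J \<Longrightarrow> v \<in> vecs_in J n \<Longrightarrow> - v \<in> vecs_in J n"
  by (auto simp: vecs_in_def ideal_set_uminus)

lemma vecs_in_smult: "ideal_set J \<Longrightarrow> v \<in> vecs_in J n \<Longrightarrow> a \<cdot>\<^sub>v v \<in> vecs_in J n"
  by (auto simp: vecs_in_def ideal_set_mult)

lemma vecs_in_mult_mat_vec:
  assumes "ideal_set J" "A \<in> carrier_mat m n" "v \<in> vecs_in J n"
  shows "A *\<^sub>v v \<in> vecs_in J m"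
  using assms by (auto simp: index_mult_mat_vec vecs_in_def scalar_prod_def intro!: ideal_set_sum ideal_set_mult)

lemma vecs_in_mono: "J \<subseteq> J' \<Longrightarrow> v \<in> vecs_in J n \<Longrightarrow> v \<in> vecs_in J' n"
  by (auto simp: vecs_in_def)

lemma vecs_in_adjoin_smult: 
  fixes l :: "'r::comm_ring_1"
  assumes "ideal_set J" "q \<in> carrier_vec n" shows "l \<cdot>\<^sub>v q \<in> vecs_in (adjoin l J) n"
proof -
  have "l * (q $ k) \<in> adjoin l J" for k
    unfolding adjoin_def using ideal_set_zero[OF assms(1)] by (auto intro!: exI[of _ "q $ k"])
  then show ?thesis using assms by (auto simp: vecs_in_def)
qed

text \<open>Supplies the homogeneous element from which connecting homomorphisms are built.\<close>

lemma vecs_in_adjoin_split: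
  fixes v :: "('l::finite, 'k::comm_ring_1) mpoly vec"
  assumes "graded_set J" "homogeneous 1 l" "v \<in> hom_vecs ds j" "v \<in> vecs_in (adjoin l J) (length ds)"
  obtains q where "q \<in> hom_vecs ds (j - 1)" "v - l \<cdot>\<^sub>v q \<in> vecs_in J (length ds)"
proof -
  have "\<exists>q. homogeneous (j - 1 - ds ! k) q \<and> v $ k - l * q \<in> J" if k: "k < length ds" for k
  proof -
    from assms(4) k obtain q where "v $ k - l * q \<in> J" by (auto simp: vecs_in_def adjoin_def)
    from graded_adjoin_hpart[OF assms(1,2) this, of "j - ds ! k"]
    have "v $ k - l * hpart (j - 1 - ds ! k) q \<in> J"
      using assms(3) k by (simp add: hom_vecs_def hpart_homogeneous algebra_simps)
    then show ?thesis using homogeneous_hpart by blast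
  qed
  then obtain q where q: "\<And>k. k < length ds \<Longrightarrow> homogeneous (j - 1 - ds ! k) (q k) \<and> v $ k - l * q k \<in> J"
    by metis
  show ?thesis
    by (rule that[of "vec (length ds) q"]) (use q assms in \<open>auto simp: hom_vecs_def vecs_in_def\<close>)
qed

declare index_mult_mat_vec [simp del]

locale graded_complex =
  fixes d :: "nat \<Rightarrow> int list" and D :: "nat \<Rightarrow> ('l::finite, 'k::field) mpoly mat"
  assumes D_carrier: "D i \<in> carrier_mat (length (d i)) (length (d (Suc i)))"
    and D_homogeneous: "r < length (d i) \<Longrightarrow> c < length (d (Suc i)) \<Longrightarrow>
      homogeneous (d (Suc i) ! c - d i ! r) (D i $$ (r, c))"
    and D_D: "w \<in> carrier_vec (length (d (Suc (Suc i)))) \<Longrightarrow> D i *\<^sub>v (D (Suc i) *\<^sub>v w) = 0\<^sub>v (length (d i))"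
begin

text \<open>Elements of degree \<open>j\<close> of the i-th free module that represent cycles of F /
  J F. In homological degree 0 every element is a cycle.\<close>

definition cyc :: "('l, 'k) mpoly set \<Rightarrow> nat \<Rightarrow> int \<Rightarrow> ('l, 'k) mpoly vec set" where
  "cyc J i j = {v \<in> hom_vecs (d i) j. \<forall>h. i = Suc h \<longrightarrow> D h *\<^sub>v v \<in> vecs_in J (length (d h))}"

definition bnd :: "('l, 'k) mpoly set \<Rightarrow> nat \<Rightarrow> int \<Rightarrow> ('l, 'k) mpoly vec set" where
  "bnd J i j = {v \<in> hom_vecs (d i) j. \<exists>w\<in>hom_vecs (d (Suc i)) j. v - D i *\<^sub>v w \<in> vecs_in J (length (d i))}"

text \<open>For an ideal \<open>J\<close>: the degree \<open>j\<close> component of the i-th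
  homology of F / J F vanishes.\<close>

definition exact_at :: "('l, 'k) mpoly set \<Rightarrow> nat \<Rightarrow> int \<Rightarrow> bool" where
  "exact_at J i j \<longleftrightarrow> cyc J i j \<subseteq> bnd J i j"

lemma dim_row_D [simp]: "dim_row (D i) = length (d i)"
  using D_carrier[of i] by simp

lemma D_hom_vecs:
  assumes "w \<in> hom_vecs (d (Suc i)) j" shows "D i *\<^sub>v w \<in> hom_vecs (d i) j"
proof -
  have "homogeneous (j - d i ! r) ((D i *\<^sub>v w) $ r)" if r: "r < length (d i)" for r
  proof -
    have "homogeneous (j - d i ! r) (D i $$ (r, c) * w $ c)" if "c < length (d (Suc i))" for c
      using homogeneous_mult[OF D_homogeneous[OF r that], of "j - d (Suc i) ! c" "w $ c"] assms that
      by (simp add: hom_vecs_def)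
    then show ?thesis
      using r assms D_carrier[of i] by (auto simp: index_mult_mat_vec scalar_prod_def hom_vecs_def intro!: homogeneous_sum)
  qed
  moreover have "D i *\<^sub>v w \<in> carrier_vec (length (d i))" by (rule carrier_vecI) simp
  ultimately show ?thesis by (auto simp: hom_vecs_def)
qed

lemma D_smult:
  "w \<in> carrier_vec (length (d (Suc i))) \<Longrightarrow> D i *\<^sub>v (a \<cdot>\<^sub>v w) = a \<cdot>\<^sub>v (D i *\<^sub>v w)"
  using D_carrier[of i] by (intro eq_vecI) (auto simp: index_mult_mat_vec)

lemma D_diff:
  "v \<in> carrier_vec (length (d (Suc i))) \<Longrightarrow> w \<in> carrier_vec (length (d (Suc i))) \<Longrightarrow>
    D i *\<^sub>v (v - w) = D i *\<^sub>v v - D i *\<^sub>v w"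
  by (rule mult_minus_distrib_mat_vec[OF D_carrier])

lemma D_vecs_carrier: "D i *\<^sub>v w \<in> carrier_vec (length (d i))"
  by (rule carrier_vecI) simp

lemma bnd_mono: "J \<subseteq> J' \<Longrightarrow> bnd J i j \<subseteq> bnd J' i j"
  by (auto simp: bnd_def intro: vecs_in_mono)

text \<open>This is the part H_i(F/JF)_j -> H_i(F/(J,l)F)_j -> H_{i-1}(F/JF)_{j-1} ->
  H_{i-1}(F/JF)_j of the long exact sequence. The first term vanishes by \<open>ex\<close>, and
  \<open>step\<close> makes the last map, multiplication by \<open>l\<close>, injective. Condition
  \<open>nzd\<close> gives the underlying short exact sequence because F is free.\<close>

lemma exact_at_adjoin:
  assumes J: "ideal_set J" "graded_set J" and l: "homogeneous 1 l"
    and nzd: "\<And>q. l * q \<in> J \<Longrightarrow> q \<in> J"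
    and ex: "exact_at J i j"
    and step: "\<And>h q. i = Suc h \<Longrightarrow> q \<in> cyc J h (j - 1) \<Longrightarrow> l \<cdot>\<^sub>v q \<in> bnd J h j \<Longrightarrow> q \<in> bnd J h (j - 1)"
  shows "exact_at (adjoin l J) i j"
  unfolding exact_at_def
proof
  fix v assume v: "v \<in> cyc (adjoin l J) i j"
  then have vh: "v \<in> hom_vecs (d i) j" by (simp add: cyc_def)
  show "v \<in> bnd (adjoin l J) i j"
  proof (cases i)
    case 0
    then have "v \<in> cyc J i j" using vh by (simp add: cyc_def)
    then show ?thesis using ex bnd_mono[OF subset_adjoin] unfolding exact_at_def by blast
  next
    case (Suc h)
    note c = hom_vecs_carrier vecs_in_carrier D_vecs_carrier
    have vc: "v \<in> carrier_vec (length (d (Suc h)))" using vh Suc c by auto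
    have "D h *\<^sub>v v \<in> vecs_in (adjoin l J) (length (d h))" using v Suc by (simp add: cyc_def)
    \<comment> \<open>The class of \<open>q\<close> is the image of the class of \<open>v\<close>
      under the connecting homomorphism.\<close>
    then obtain q where q: "q \<in> hom_vecs (d h) (j - 1)" "D h *\<^sub>v v - l \<cdot>\<^sub>v q \<in> vecs_in J (length (d h))"
      using vecs_in_adjoin_split[OF J(2) l] D_hom_vecs[of v h j] vh Suc by blast
    have qc: "q \<in> carrier_vec (length (d h))" using q c by auto
    \<comment> \<open>Applying the differential twice gives zero, so \<open>l\<close> times the
      image of \<open>q\<close> lies in \<open>J\<close>, and \<open>l\<close> can be
      cancelled.\<close>
    have "q \<in> cyc J h (j - 1)"
      unfolding cyc_def
    proof (intro CollectI conjI allI impI q)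
      fix h' assume h': "h = Suc h'"
      let ?n = "length (d h')"
      have "D h' *\<^sub>v (D h *\<^sub>v v - l \<cdot>\<^sub>v q) = 0\<^sub>v ?n - l \<cdot>\<^sub>v (D h' *\<^sub>v q)"
        using vc qc h' by (simp add: D_diff D_smult D_D D_vecs_carrier)
      moreover have "D h' *\<^sub>v (D h *\<^sub>v v - l \<cdot>\<^sub>v q) \<in> vecs_in J ?n"
        using vecs_in_mult_mat_vec[OF J(1) D_carrier] q h' by simp
      ultimately have *: "0\<^sub>v ?n - l \<cdot>\<^sub>v (D h' *\<^sub>v q) \<in> vecs_in J ?n" by simp
      have "(D h' *\<^sub>v q) $ k \<in> J" if k: "k < ?n" for k
      proof -
        have "- (l * (D h' *\<^sub>v q) $ k) \<in> J" using * k D_vecs_carrier[of h' q] by (auto simp: vecs_in_def)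
        then have "l * (D h' *\<^sub>v q) $ k \<in> J" using ideal_set_uminus[OF J(1)] by fastforce
        then show ?thesis by (rule nzd)
      qed
      then show "D h' *\<^sub>v q \<in> vecs_in J ?n" using D_vecs_carrier by (auto simp: vecs_in_def)
    qed
    moreover have "l \<cdot>\<^sub>v q \<in> bnd J h j"
      unfolding bnd_def
    proof (intro CollectI conjI bexI)
      show "l \<cdot>\<^sub>v q \<in> hom_vecs (d h) j" using hom_vecs_smult[OF l q(1)] by simp
      have "l \<cdot>\<^sub>v q - D h *\<^sub>v v = - (D h *\<^sub>v v - l \<cdot>\<^sub>v q)"
        using qc D_vecs_carrier[of h v] by (intro eq_vecI) auto
      then show "l \<cdot>\<^sub>v q - D h *\<^sub>v v \<in> vecs_in J (length (d h))"
        using vecs_in_uminus[OF J(1) q(2)] by simp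
      show "v \<in> hom_vecs (d (Suc h)) j" using vh Suc by simp
    qed
    ultimately have "q \<in> bnd J h (j - 1)" using step[OF Suc] by blast
    then obtain w where w: "w \<in> hom_vecs (d (Suc h)) (j - 1)" "q - D h *\<^sub>v w \<in> vecs_in J (length (d h))"
      by (auto simp: bnd_def)
    have wc: "w \<in> carrier_vec (length (d (Suc h)))" using w c by auto
    \<comment> \<open>As \<open>q\<close> is the boundary of \<open>w\<close> modulo
      \<open>J\<close>, this correction turns \<open>v\<close> into a cycle modulo \<open>J\<close>
      without changing it modulo \<open>l\<close>.\<close>
    let ?v = "v - l \<cdot>\<^sub>v w"
    have v': "?v \<in> hom_vecs (d (Suc h)) j" 
      using hom_vecs_diff vh Suc hom_vecs_smult[OF l w(1)] by fastforce
    have "D h *\<^sub>v ?v = D h *\<^sub>v v - l \<cdot>\<^sub>v (D h *\<^sub>v w)" using vc wc by (simp add: D_diff D_smult)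
    also have "\<dots> = (D h *\<^sub>v v - l \<cdot>\<^sub>v q) + l \<cdot>\<^sub>v (q - D h *\<^sub>v w)"
      using D_vecs_carrier[of h v] D_vecs_carrier[of h w] qc 
      by (intro eq_vecI) (auto simp: algebra_simps)
    finally have "D h *\<^sub>v ?v \<in> vecs_in J (length (d h))"
      using vecs_in_add[OF J(1) q(2) vecs_in_smult[OF J(1) w(2), of l]] by simp
    then have "?v \<in> cyc J i j" using v' Suc by (simp add: cyc_def)
    with ex obtain w2 where w2: "w2 \<in> hom_vecs (d (Suc i)) j" "?v - D i *\<^sub>v w2 \<in> vecs_in J (length (d i))"
      by (auto simp: exact_at_def bnd_def)
    have "v - D i *\<^sub>v w2 = (?v - D i *\<^sub>v w2) + l \<cdot>\<^sub>v w"
      using vc wc D_vecs_carrier[of i w2] Suc by (intro eq_vecI) auto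
    moreover have "(?v - D i *\<^sub>v w2) + l \<cdot>\<^sub>v w \<in> vecs_in (adjoin l J) (length (d i))"
      using vecs_in_add[OF ideal_set_adjoin[OF J(1)] vecs_in_mono[OF subset_adjoin w2(2)] 
          vecs_in_adjoin_smult[OF J(1), of w "length (d i)" l]] wc Suc by simp
    ultimately have "v - D i *\<^sub>v w2 \<in> vecs_in (adjoin l J) (length (d i))" by (rule ssubst)
    then show ?thesis using vh w2(1) unfolding bnd_def by blast
  qed
qed

text \<open>The sequence H_{i+1}(F/(J,l)F)_{j+1} -> H_i(F/JF)_j -> H_i(F/JF)_{j+1} has last term
  zero by \<open>ex\<close>, so the first map is onto a nonzero space.\<close>

lemma not_exact_at_adjoin:
  assumes J: "ideal_set J" "graded_set J" and l: "homogeneous 1 l"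
    and nzd: "\<And>q. l * q \<in> J \<Longrightarrow> q \<in> J"
    and ex: "exact_at J i (j + 1)" and nex: "\<not> exact_at J i j"
  shows "\<not> exact_at (adjoin l J) (Suc i) (j + 1)"
proof
  assume ex': "exact_at (adjoin l J) (Suc i) (j + 1)"
  note c = hom_vecs_carrier vecs_in_carrier D_vecs_carrier
  let ?n = "length (d i)"
  from nex obtain v where v: "v \<in> cyc J i j" "v \<notin> bnd J i j" by (auto simp: exact_at_def)
  then have vh: "v \<in> hom_vecs (d i) j" by (simp add: cyc_def)
  then have vc: "v \<in> carrier_vec ?n" by (rule c)
  have "l \<cdot>\<^sub>v v \<in> cyc J i (j + 1)"
    unfolding cyc_def
  proof (intro CollectI conjI allI impI hom_vecs_smult l vh)
    fix h assume h: "i = Suc h"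
    then have "D h *\<^sub>v v \<in> vecs_in J (length (d h))" using v by (simp add: cyc_def)
    then show "D h *\<^sub>v (l \<cdot>\<^sub>v v) \<in> vecs_in J (length (d h))"
      using vc h vecs_in_smult[OF J(1)] by (simp add: D_smult)
  qed
  \<comment> \<open>This \<open>w\<close> is the class sought: its boundary is \<open>l\<close>
    times \<open>v\<close> modulo \<open>J\<close>, hence it is a cycle once \<open>l\<close> is
    killed.\<close>
  with ex obtain w where w: "w \<in> hom_vecs (d (Suc i)) (j + 1)" "l \<cdot>\<^sub>v v - D i *\<^sub>v w \<in> vecs_in J ?n"
    by (auto simp: exact_at_def bnd_def)
  have wc: "w \<in> carrier_vec (length (d (Suc i)))" using w c by auto
  have "D i *\<^sub>v w = l \<cdot>\<^sub>v v + - (l \<cdot>\<^sub>v v - D i *\<^sub>v w)"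
    using vc D_vecs_carrier[of i w] by (intro eq_vecI) auto
  moreover have "l \<cdot>\<^sub>v v + - (l \<cdot>\<^sub>v v - D i *\<^sub>v w) \<in> vecs_in (adjoin l J) ?n"
    by (intro vecs_in_add[OF ideal_set_adjoin] vecs_in_adjoin_smult J vc vecs_in_mono[OF subset_adjoin]
        vecs_in_uminus w)
  ultimately have "w \<in> cyc (adjoin l J) (Suc i) (j + 1)" using w by (simp add: cyc_def)
  with ex' obtain w' where w': "w' \<in> hom_vecs (d (Suc (Suc i))) (j + 1)"
    "w - D (Suc i) *\<^sub>v w' \<in> vecs_in (adjoin l J) (length (d (Suc i)))"
    by (auto simp: exact_at_def bnd_def)
  have wc': "w' \<in> carrier_vec (length (d (Suc (Suc i))))" using w' c by auto
  have "w - D (Suc i) *\<^sub>v w' \<in> hom_vecs (d (Suc i)) (j + 1)"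
    using hom_vecs_diff w D_hom_vecs w' by blast
  from vecs_in_adjoin_split[OF J(2) l this w'(2)] obtain q where
    q: "q \<in> hom_vecs (d (Suc i)) j" 
    "w - D (Suc i) *\<^sub>v w' - l \<cdot>\<^sub>v q \<in> vecs_in J (length (d (Suc i)))" by auto
  have qc: "q \<in> carrier_vec (length (d (Suc i)))" using q c by auto
  have "D i *\<^sub>v (w - D (Suc i) *\<^sub>v w' - l \<cdot>\<^sub>v q) = (D i *\<^sub>v w - 0\<^sub>v ?n) - l \<cdot>\<^sub>v (D i *\<^sub>v q)"
    using wc wc' qc D_vecs_carrier[of "Suc i" w'] by (simp add: D_diff D_smult D_D)
  then have "(D i *\<^sub>v w - 0\<^sub>v ?n) - l \<cdot>\<^sub>v (D i *\<^sub>v q) \<in> vecs_in J ?n"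
    using vecs_in_mult_mat_vec[OF J(1) D_carrier q(2)] by simp
  from vecs_in_add[OF J(1) w(2) this]
  have *: "(l \<cdot>\<^sub>v v - D i *\<^sub>v w) + ((D i *\<^sub>v w - 0\<^sub>v ?n) - l \<cdot>\<^sub>v (D i *\<^sub>v q)) \<in> vecs_in J ?n" .
  \<comment> \<open>If \<open>w\<close> were a boundary modulo \<open>J\<close> and
    \<open>l\<close>, with remainder \<open>l\<close> times \<open>q\<close>, then \<open>l\<close>
    times this vector would lie in \<open>J\<close>. Cancelling \<open>l\<close> makes
    \<open>v\<close> a boundary.\<close>
  have "v - D i *\<^sub>v q \<in> vecs_in J ?n"
    unfolding vecs_in_def
  proof (intro CollectI conjI allI impI)
    show "v - D i *\<^sub>v q \<in> carrier_vec ?n" using vc D_vecs_carrier[of i q] by auto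
    fix k assume k: "k < ?n"
    have "l * (v - D i *\<^sub>v q) $ k = ((l \<cdot>\<^sub>v v - D i *\<^sub>v w) + ((D i *\<^sub>v w - 0\<^sub>v ?n) - l \<cdot>\<^sub>v (D i *\<^sub>v q))) $ k"
      using k vc D_vecs_carrier[of i q] D_vecs_carrier[of i w] by (auto simp: algebra_simps)
    then have "l * (v - D i *\<^sub>v q) $ k \<in> J" using * k by (auto simp: vecs_in_def)
    then show "(v - D i *\<^sub>v q) $ k \<in> J" by (rule nzd)
  qed
  then have "v \<in> bnd J i j" using vh q by (auto simp: bnd_def)
  with v show False by simp
qed


end

section \<open>Reduction modulo the maximal ideal\<close>

definition max_ideal :: "('l, 'k::zero) mpoly set" where
  "max_ideal = {p. lookup p 0 = 0}"

lemma lookup_mult_0: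
  fixes p q :: "('l::finite, 'k::comm_ring_1) mpoly"
  shows "lookup (p * q) 0 = lookup p 0 * lookup q 0"
proof (induction p rule: poly_mapping_single_induct)
  case (add m c p)
  have "lookup (single m c * q) 0 = lookup (single m c) 0 * lookup q 0"
  proof (induction q rule: poly_mapping_single_induct)
    case (add n d q)
    \<comment> \<open>Degrees are nonnegative, so a sum of exponent vectors vanishes only if both
      summands do.\<close>
    have "m + n = 0 \<longleftrightarrow> m = 0 \<and> n = 0"
      using monom_deg_add[of m n] by (auto simp flip: monom_deg_eq_0_iff)
    then have "lookup (single m c * single n d) 0 = lookup (single m c) 0 * lookup (single n d) 0"
      by (auto simp: mult_single lookup_single when_def)
    with add show ?case by (simp add: distrib_left lookup_add)
  qed simp
  with add show ?case by (simp add: distrib_right lookup_add)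
qed simp

context graded_complex
begin

abbreviation (input) const_part :: "('l, 'k) mpoly vec \<Rightarrow> 'k vec" where
  "const_part v \<equiv> map_vec (\<lambda>p. lookup p 0) v"

abbreviation (input) const_vec :: "'k vec \<Rightarrow> ('l, 'k) mpoly vec" where
  "const_vec x \<equiv> map_vec (single 0) x"

lemma const_part_D:
  assumes "w \<in> carrier_vec (length (d (Suc i)))"
  shows "const_part (D i *\<^sub>v w) = tensor_K (D i) *\<^sub>v const_part w"
proof (rule eq_vecI)
  fix r assume "r < dim_vec (tensor_K (D i) *\<^sub>v const_part w)"
  then show "const_part (D i *\<^sub>v w) $ r = (tensor_K (D i) *\<^sub>v const_part w) $ r"
    using assms D_carrier[of i]
    by (auto simp: tensor_K_def index_mult_mat_vec scalar_prod_def lookup_sum lookup_mult_0)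
qed (simp add: tensor_K_def)

lemma const_part_hom_vecs: "v \<in> hom_vecs ds j \<Longrightarrow> const_part v \<in> graded_part ds j"
  using lookup_zero_homogeneous by (fastforce simp: hom_vecs_def graded_part_def)

lemma const_vec_hom_vecs:
  assumes "x \<in> graded_part ds j" shows "const_vec x \<in> hom_vecs ds j"
proof -
  have "homogeneous (j - ds ! k) (single 0 (x $ k))" if "k < length ds" for k
    using assms that by (cases "x $ k = 0") (auto simp: graded_part_def intro: homogeneous_single)
  then show ?thesis using assms by (auto simp: hom_vecs_def graded_part_def)
qed

lemma vecs_in_max_ideal: 
  "v \<in> vecs_in max_ideal n \<longleftrightarrow> v \<in> carrier_vec n \<and> const_part v = 0\<^sub>v n"
  by (auto simp: vecs_in_def max_ideal_def vec_eq_iff)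

lemma const_part_const_vec: "const_part (const_vec x) = x"
  by (auto simp: vec_eq_iff)

text \<open>Modulo the maximal ideal F becomes its tensor product with K. Vectors over K lift to
  constant polynomials, which have the right degree because a vector in \<open>graded_part\<close>
  is supported on basis elements of degree \<open>j\<close>.\<close>

lemma exact_at_max_ideal:
  "exact_at max_ideal i j \<longleftrightarrow> tor_cycles d D i j \<subseteq> tor_boundaries d D i j"
proof
  assume ex: "exact_at max_ideal i j"
  show "tor_cycles d D i j \<subseteq> tor_boundaries d D i j"
  proof
    fix x assume x: "x \<in> tor_cycles d D i j"
    then have xg: "x \<in> graded_part (d i) j" by (auto simp: tor_cycles_def split: nat.splits)
    let ?v = "const_vec x"
    have vh: "?v \<in> hom_vecs (d i) j" using const_vec_hom_vecs[OF xg] .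
    have "D h *\<^sub>v ?v \<in> vecs_in max_ideal (length (d h))" if "i = Suc h" for h
    proof -
      have "const_part (D h *\<^sub>v ?v) = tensor_K (D h) *\<^sub>v x"
        using const_part_D[of ?v h] hom_vecs_carrier[OF vh] that const_part_const_vec by simp
      also have "\<dots> = 0\<^sub>v (length (d h))" using x that by (simp add: tor_cycles_def)
      finally show ?thesis using D_vecs_carrier vecs_in_max_ideal by blast
    qed
    then have "?v \<in> cyc max_ideal i j" using vh by (simp add: cyc_def)
    with ex obtain w where w: "w \<in> hom_vecs (d (Suc i)) j" "?v - D i *\<^sub>v w \<in> vecs_in max_ideal (length (d i))"
      by (auto simp: exact_at_def bnd_def)
    have "const_part (?v - D i *\<^sub>v w) = 0\<^sub>v (length (d i))" using w vecs_in_max_ideal by blast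
    then have "const_part ?v = const_part (D i *\<^sub>v w)"
      using hom_vecs_carrier[OF vh] by (auto simp: vec_eq_iff lookup_minus)
    then have "x = tensor_K (D i) *\<^sub>v const_part w"
      using const_part_D[OF hom_vecs_carrier[OF w(1)]] const_part_const_vec by simp
    then show "x \<in> tor_boundaries d D i j"
      unfolding tor_boundaries_def using const_part_hom_vecs[OF w(1)] by blast
  qed
next
  assume sub: "tor_cycles d D i j \<subseteq> tor_boundaries d D i j"
  show "exact_at max_ideal i j"
    unfolding exact_at_def
  proof
    fix v assume v: "v \<in> cyc max_ideal i j"
    then have vh: "v \<in> hom_vecs (d i) j" by (simp add: cyc_def)
    let ?x = "const_part v"
    have xg: "?x \<in> graded_part (d i) j" using const_part_hom_vecs[OF vh] .
    have "tensor_K (D h) *\<^sub>v ?x = 0\<^sub>v (length (d h))" if "i = Suc h" for h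
    proof -
      have "const_part (D h *\<^sub>v v) = 0\<^sub>v (length (d h))" 
        using v that vecs_in_max_ideal by (auto simp: cyc_def)
      then show ?thesis using const_part_D[of v h] hom_vecs_carrier[OF vh] that by simp
    qed
    then have "?x \<in> tor_cycles d D i j" using xg by (auto simp: tor_cycles_def split: nat.splits)
    with sub obtain y where y: "y \<in> graded_part (d (Suc i)) j" "?x = tensor_K (D i) *\<^sub>v y"
      by (auto simp: tor_boundaries_def)
    let ?w = "const_vec y"
    have w: "?w \<in> hom_vecs (d (Suc i)) j" using const_vec_hom_vecs[OF y(1)] .
    have "const_part (D i *\<^sub>v ?w) = ?x"
      using const_part_D[OF hom_vecs_carrier[OF w]] const_part_const_vec y(2) by simp
    then have "const_part (v - D i *\<^sub>v ?w) = 0\<^sub>v (length (d i))"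
      using hom_vecs_carrier[OF vh] by (auto simp: vec_eq_iff lookup_minus)
    moreover have "v - D i *\<^sub>v ?w \<in> carrier_vec (length (d i))"
      using hom_vecs_carrier[OF vh] D_vecs_carrier by auto
    ultimately have "v - D i *\<^sub>v ?w \<in> vecs_in max_ideal (length (d i))" using vecs_in_max_ideal by blast
    then show "v \<in> bnd max_ideal i j" using vh w unfolding bnd_def by blast
  qed
qed

end

section \<open>The regularity of a cyclic module\<close>

definition ideal_sum :: "'r::comm_ring_1 set \<Rightarrow> 'r set \<Rightarrow> 'r set" where
  "ideal_sum I J = {p. \<exists>b\<in>J. p - b \<in> I}"

lemma ideal_sum_add_left:
  assumes "ideal_set I" "p \<in> ideal_sum I J" "q - p \<in> I" shows "q \<in> ideal_sum I J"
proof -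
  from assms obtain b where b: "b \<in> J" "p - b \<in> I" by (auto simp: ideal_sum_def)
  have "q - b = (q - p) + (p - b)" by simp
  then have "q - b \<in> I" using ideal_set_add[OF assms(1,3) b(2)] by (rule ssubst)
  with b show ?thesis by (auto simp: ideal_sum_def)
qed

definition hproj :: "int list \<Rightarrow> int \<Rightarrow> ('l, 'k::zero) mpoly vec \<Rightarrow> ('l, 'k) mpoly vec" where
  "hproj ds j v = vec (length ds) (\<lambda>k. hpart (j - ds ! k) (v $ k))"

lemma hproj_hom_vecs: "hproj ds j v \<in> hom_vecs ds j"
  by (simp add: hproj_def hom_vecs_def homogeneous_hpart)

lemma hproj_carrier: "hproj ds j v \<in> carrier_vec (length ds)"
  by (simp add: hproj_def)

lemma hproj_id: "v \<in> hom_vecs ds j \<Longrightarrow> hproj ds j v = v"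
  by (auto simp: hproj_def hom_vecs_def hpart_homogeneous)

definition graded_matrix :: "int list \<Rightarrow> int list \<Rightarrow> ('l, 'k::field) mpoly mat \<Rightarrow> bool" where
  "graded_matrix ds ds' G \<longleftrightarrow> G \<in> carrier_mat (length ds) (length ds') \<and>
    (\<forall>r < length ds. \<forall>c < length ds'. homogeneous (ds' ! c - ds ! r) (G $$ (r, c)))"

text \<open>Maps of degree zero commute with taking components, so preimages of homogeneous vectors
  can be chosen homogeneous.\<close>

lemma graded_matrix_hproj:
  fixes G :: "('l::finite, 'k::field) mpoly mat"
  assumes G: "graded_matrix ds ds' G" and w: "w \<in> carrier_vec (length ds')"
  shows "G *\<^sub>v hproj ds' j w = hproj ds j (G *\<^sub>v w)"
proof (rule eq_vecI)
  fix r assume "r < dim_vec (hproj ds j (G *\<^sub>v w))"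
  then have r: "r < length ds" by (simp add: hproj_def)
  have "hpart (j - ds ! r) (G $$ (r, c) * w $ c) = G $$ (r, c) * hpart (j - ds' ! c) (w $ c)"
    if "c < length ds'" for c
    using hpart_mult[of "ds' ! c - ds ! r" "G $$ (r, c)" "j - ds ! r" "w $ c"] G r that
    by (simp add: graded_matrix_def)
  then show "(G *\<^sub>v hproj ds' j w) $ r = hproj ds j (G *\<^sub>v w) $ r"
    using r w G by (auto simp: graded_matrix_def hproj_def index_mult_mat_vec scalar_prod_def hpart_sum)
qed (use G in \<open>auto simp: graded_matrix_def hproj_def\<close>)

lemma (in graded_complex) D_hproj:
  assumes "w \<in> carrier_vec (length (d (Suc i)))"
  shows "D i *\<^sub>v hproj (d (Suc i)) j w = hproj (d i) j (D i *\<^sub>v w)"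
  by (rule graded_matrix_hproj) (simp_all add: graded_matrix_def D_carrier D_homogeneous assms)

locale cyclic_resolution =
  fixes I :: "('l::finite, 'k::field) mpoly set" and d D g
  assumes resolution: "graded_free_resolution UNIV I d D g"
    and I_ideal: "ideal_set I" and I_graded: "graded_set I"
begin

sublocale graded_complex d D
proof
  fix i
  show "D i \<in> carrier_mat (length (d i)) (length (d (Suc i)))"
    using resolution by (simp add: graded_free_resolution_def)
  show "r < length (d i) \<Longrightarrow> c < length (d (Suc i)) \<Longrightarrow>
      homogeneous (d (Suc i) ! c - d i ! r) (D i $$ (r, c))" for r c
    using resolution by (simp add: graded_free_resolution_def)
  fix w :: "('l, 'k) mpoly vec" assume w: "w \<in> carrier_vec (length (d (Suc (Suc i))))"
  have "{v \<in> carrier_vec (length (d (Suc i))). D i *\<^sub>v v = 0\<^sub>v (length (d i))}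
       = (\<lambda>w. D (Suc i) *\<^sub>v w) ` carrier_vec (length (d (Suc (Suc i))))"
    using resolution unfolding graded_free_resolution_def by blast
  with w show "D i *\<^sub>v (D (Suc i) *\<^sub>v w) = 0\<^sub>v (length (d i))" by blast
qed

lemma g_carrier: "g \<in> carrier_vec (length (d 0))"
  using resolution unfolding graded_free_resolution_def by (elim conjE)

lemma g_homogeneous: "k < length (d 0) \<Longrightarrow> homogeneous (d 0 ! k) (g $ k)"
  using resolution unfolding graded_free_resolution_def by (elim conjE) blast

lemma g_surj: "\<exists>v\<in>carrier_vec (length (d 0)). f - g \<bullet> v \<in> I"
  using resolution unfolding graded_free_resolution_def by (elim conjE) (erule bspec, simp)

lemma g_kernel: "{v \<in> carrier_vec (length (d 0)). g \<bullet> v \<in> I} = (\<lambda>w. D 0 *\<^sub>v w) ` carrier_vec (length (d 1))"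
  using resolution unfolding graded_free_resolution_def by (elim conjE)

lemma D_kernel: "{v \<in> carrier_vec (length (d (Suc i))). D i *\<^sub>v v = 0\<^sub>v (length (d i))}
       = (\<lambda>w. D (Suc i) *\<^sub>v w) ` carrier_vec (length (d (Suc (Suc i))))"
  using resolution unfolding graded_free_resolution_def by (elim conjE) (erule spec)

lemma exact_at_zero: "exact_at {0} (Suc i) j"
  unfolding exact_at_def
proof
  fix v assume v: "v \<in> cyc {0} (Suc i) j"
  then have vh: "v \<in> hom_vecs (d (Suc i)) j" and "D i *\<^sub>v v \<in> vecs_in {0} (length (d i))"
    by (auto simp: cyc_def)
  then have "D i *\<^sub>v v = 0\<^sub>v (length (d i))" by (auto simp: vecs_in_def)
  then obtain w where w: "w \<in> carrier_vec (length (d (Suc (Suc i))))" "v = D (Suc i) *\<^sub>v w"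
    using D_kernel[of i] hom_vecs_carrier[OF vh] by blast
  \<comment> \<open>Exactness yields a preimage of mixed degrees; its component of degree
    \<open>j\<close> is a preimage too.\<close>
  let ?w = "hproj (d (Suc (Suc i))) j w"
  have "D (Suc i) *\<^sub>v ?w = v" using D_hproj[OF w(1), of j] w(2) hproj_id[OF vh] by simp
  then have "v - D (Suc i) *\<^sub>v ?w \<in> vecs_in {0} (length (d (Suc i)))"
    using hom_vecs_carrier[OF vh] by (auto simp: vecs_in_def)
  then show "v \<in> bnd {0} (Suc i) j" using vh hproj_hom_vecs unfolding bnd_def by blast
qed

lemma g_scalar_diff:
  "v \<in> carrier_vec (length (d 0)) \<Longrightarrow> w \<in> carrier_vec (length (d 0)) \<Longrightarrow> g \<bullet> (v - w) = g \<bullet> v - g \<bullet> w"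
  using g_carrier by (simp add: scalar_prod_minus_distrib)

lemma g_scalar_smult: "v \<in> carrier_vec (length (d 0)) \<Longrightarrow> g \<bullet> (a \<cdot>\<^sub>v v) = a * (g \<bullet> v)"
  using g_carrier by (auto simp: scalar_prod_def sum_distrib_left algebra_simps)

lemma g_hproj:
  assumes "v \<in> carrier_vec (length (d 0))" shows "g \<bullet> hproj (d 0) j v = hpart j (g \<bullet> v)"
proof -
  have "hpart j (g $ k * v $ k) = g $ k * hpart (j - d 0 ! k) (v $ k)" if "k < length (d 0)" for k
    using hpart_mult[OF g_homogeneous[OF that]] .
  then show ?thesis using assms by (auto simp: scalar_prod_def hproj_def hpart_sum)
qed

lemma g_homogeneous_scalar:
  assumes "v \<in> hom_vecs (d 0) j" shows "homogeneous j (g \<bullet> v)"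
  using g_hproj[OF hom_vecs_carrier[OF assms], of j] hproj_id[OF assms] homogeneous_hpart by metis

lemma hpart_diff_in_I: "homogeneous j p \<Longrightarrow> p - q \<in> I \<Longrightarrow> p - hpart j q \<in> I"
  using I_graded hpart_diff[of j p q] hpart_homogeneous[of j p] unfolding graded_set_def by metis

lemma g_lift:
  assumes "homogeneous j p" obtains v where "v \<in> hom_vecs (d 0) j" "p - g \<bullet> v \<in> I"
proof -
  obtain v where v: "v \<in> carrier_vec (length (d 0))" "p - g \<bullet> v \<in> I" using g_surj by blast
  then show ?thesis using hpart_diff_in_I[OF assms v(2)] g_hproj[OF v(1)] hproj_hom_vecs that by metis
qed

text \<open>The homology of F / J F in homological degree 0 is S / (I + J), by way of the
  augmentation \<open>g\<close>.\<close>

lemma bnd_0_iff: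
  assumes J: "ideal_set J" "graded_set J" and v: "v \<in> hom_vecs (d 0) j"
  shows "v \<in> bnd J 0 j \<longleftrightarrow> g \<bullet> v \<in> ideal_sum I J"
proof
  note vc = hom_vecs_carrier[OF v]
  assume "v \<in> bnd J 0 j"
  then obtain w where w: "w \<in> hom_vecs (d 1) j" "v - D 0 *\<^sub>v w \<in> vecs_in J (length (d 0))"
    by (auto simp: bnd_def)
  have "D 0 *\<^sub>v w \<in> {v \<in> carrier_vec (length (d 0)). g \<bullet> v \<in> I}"
    unfolding g_kernel using hom_vecs_carrier[OF w(1)] by blast
  then have "g \<bullet> (D 0 *\<^sub>v w) \<in> I" by simp
  moreover have "g \<bullet> (v - D 0 *\<^sub>v w) \<in> J"
    using w(2) unfolding scalar_prod_def
    by (intro ideal_set_sum ideal_set_mult J) (auto simp: vecs_in_def)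
  moreover have "g \<bullet> v - g \<bullet> (v - D 0 *\<^sub>v w) = g \<bullet> (D 0 *\<^sub>v w)"
    using g_scalar_diff[OF vc D_vecs_carrier] by simp
  ultimately show "g \<bullet> v \<in> ideal_sum I J" unfolding ideal_sum_def by (metis (mono_tags) mem_Collect_eq)
next
  note vc = hom_vecs_carrier[OF v]
  assume "g \<bullet> v \<in> ideal_sum I J"
  then obtain b0 where b0: "b0 \<in> J" "g \<bullet> v - b0 \<in> I" by (auto simp: ideal_sum_def)
  define b where "b = hpart j b0"
  have b: "b \<in> J" "g \<bullet> v - b \<in> I" "homogeneous j b"
    using b0 J(2) hpart_diff_in_I[OF g_homogeneous_scalar[OF v]] homogeneous_hpart
    by (auto simp: b_def graded_set_def)
  \<comment> \<open>The first free module of an arbitrary resolution need not be S, so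
    \<open>1\<close> is lifted to a vector \<open>e\<close> of degree 0. Its multiple by
    \<open>b\<close> is an element of J F with the same image as \<open>b\<close> modulo
    \<open>I\<close>.\<close>
  obtain e where e: "e \<in> hom_vecs (d 0) 0" "1 - g \<bullet> e \<in> I" using g_lift[of 0 1] by auto
  note ec = hom_vecs_carrier[OF e(1)]
  have u: "b \<cdot>\<^sub>v e \<in> hom_vecs (d 0) j" using hom_vecs_smult[OF b(3) e(1)] by simp
  have "g \<bullet> (v - b \<cdot>\<^sub>v e) = (g \<bullet> v - b) + b * (1 - g \<bullet> e)"
    using g_scalar_diff[OF vc hom_vecs_carrier[OF u]] g_scalar_smult[OF ec] by (simp add: algebra_simps)
  then have "g \<bullet> (v - b \<cdot>\<^sub>v e) \<in> I"
    using ideal_set_add[OF I_ideal b(2) ideal_set_mult[OF I_ideal e(2), of b]] by simp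
  moreover have vu: "v - b \<cdot>\<^sub>v e \<in> hom_vecs (d 0) j" using hom_vecs_diff[OF v u] .
  ultimately obtain w where w: "w \<in> carrier_vec (length (d 1))" "v - b \<cdot>\<^sub>v e = D 0 *\<^sub>v w"
    using g_kernel hom_vecs_carrier[OF vu] by blast
  let ?w = "hproj (d 1) j w"
  have "D 0 *\<^sub>v ?w = v - b \<cdot>\<^sub>v e" using D_hproj[of w 0 j] w hproj_id[OF vu] by simp
  then have "v - D 0 *\<^sub>v ?w = b \<cdot>\<^sub>v e" using vc ec by (auto simp: vec_eq_iff)
  moreover have "b \<cdot>\<^sub>v e \<in> vecs_in J (length (d 0))"
    using ec b(1) by (auto simp: vecs_in_def intro: ideal_set_mult2[OF J(1)])
  ultimately have "v - D 0 *\<^sub>v ?w \<in> vecs_in J (length (d 0))" by (rule ssubst)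
  then show "v \<in> bnd J 0 j" using v hproj_hom_vecs[of "d 1" j w] unfolding bnd_def One_nat_def by blast
qed

lemma exact_at_0_iff:
  assumes J: "ideal_set J" "graded_set J"
  shows "exact_at J 0 j \<longleftrightarrow> (\<forall>p. homogeneous j p \<longrightarrow> p \<in> ideal_sum I J)"
proof
  assume ex: "exact_at J 0 j"
  show "\<forall>p. homogeneous j p \<longrightarrow> p \<in> ideal_sum I J"
  proof (intro allI impI)
    fix p :: "('l, 'k) mpoly" assume "homogeneous j p"
    then obtain v where v: "v \<in> hom_vecs (d 0) j" "p - g \<bullet> v \<in> I" by (rule g_lift)
    then have "v \<in> bnd J 0 j" using ex by (auto simp: exact_at_def cyc_def)
    then show "p \<in> ideal_sum I J" using bnd_0_iff[OF J v(1)] ideal_sum_add_left[OF I_ideal _ v(2)] by simp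
  qed
next
  assume "\<forall>p. homogeneous j p \<longrightarrow> p \<in> ideal_sum I J"
  then show "exact_at J 0 j"
    using bnd_0_iff[OF J] g_homogeneous_scalar by (auto simp: exact_at_def cyc_def)
qed

text \<open>If the forms are regular both on S and on S / I, killing them keeps F acyclic: F modulo
  the forms resolves the quotient of S / I by them.\<close>

lemma exact_at_regular:
  assumes "\<And>l. l \<in> set ls \<Longrightarrow> homogeneous 1 l"
    and "\<And>xs l ys q. ls = xs @ l # ys \<Longrightarrow> l * q \<in> adjoin_list xs \<Longrightarrow> q \<in> adjoin_list xs"
    and "\<And>xs l ys p. ls = xs @ l # ys \<Longrightarrow> l * p \<in> ideal_sum I (adjoin_list xs) \<Longrightarrow>
      p \<in> ideal_sum I (adjoin_list xs)"
  shows "exact_at (adjoin_list ls) (Suc i) j"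
  using assms
proof (induction ls arbitrary: i j rule: rev_induct)
  case Nil
  then show ?case using exact_at_zero by simp
next
  case (snoc l ls i j)
  let ?J = "adjoin_list ls"
  have IH: "exact_at ?J (Suc i) j" for i j
  proof (rule snoc.IH)
    show "homogeneous 1 l'" if "l' \<in> set ls" for l' using that snoc.prems(1) by simp
    show "q \<in> adjoin_list xs" if "ls = xs @ l' # ys" "l' * q \<in> adjoin_list xs" for xs l' ys q
      using that snoc.prems(2)[of xs l' "ys @ [l]" q] by simp
    show "p \<in> ideal_sum I (adjoin_list xs)" if "ls = xs @ l' # ys" "l' * p \<in> ideal_sum I (adjoin_list xs)" for xs l' ys p
      using that snoc.prems(3)[of xs l' "ys @ [l]" p] by simp
  qed
  have J: "ideal_set ?J" "graded_set ?J"
    using snoc.prems(1) by (auto intro: ideal_set_adjoin_list graded_set_adjoin_list)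
  have l: "homogeneous 1 l" using snoc.prems(1) by simp
  \<comment> \<open>Injectivity of multiplication by \<open>l\<close> on the homology one step
    below: in homological degree 0 it is regularity on S / I, above that the homology is zero by
    induction.\<close>
  have step: "q \<in> bnd ?J h (j - 1)" if q: "q \<in> cyc ?J h (j - 1)" and lq: "l \<cdot>\<^sub>v q \<in> bnd ?J h j" for h q
  proof (cases h)
      case 0
      then have qh: "q \<in> hom_vecs (d 0) (j - 1)" using q by (simp add: cyc_def)
      have "l \<cdot>\<^sub>v q \<in> hom_vecs (d 0) j" using hom_vecs_smult[OF l qh] by simp
      then have "l * (g \<bullet> q) \<in> ideal_sum I ?J"
        using bnd_0_iff[OF J] lq 0 g_scalar_smult[OF hom_vecs_carrier[OF qh]] by simp
      then have "g \<bullet> q \<in> ideal_sum I ?J" using snoc.prems(3)[of ls l "[]"] by simp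
      then show ?thesis using bnd_0_iff[OF J qh] 0 by simp
    next
      case (Suc h')
      then show ?thesis using IH[of h' "j - 1"] q by (auto simp: exact_at_def)
  qed
  have nz: "q \<in> ?J" if "l * q \<in> ?J" for q using snoc.prems(2)[of ls l "[]"] that by simp
  show ?case
    unfolding adjoin_list_snoc by (rule exact_at_adjoin[OF J l nz IH step])
qed

text \<open>\<open>ls\<close> is the regular part, after which only the quotient of top degree
  \<open>s\<close> in homological degree 0 is left; \<open>ms\<close> completes it to generators of
  the maximal ideal, where the homology is Tor.\<close>

theorem tor_cyclic:
  assumes hom: "\<And>l. l \<in> set (ls @ ms) \<Longrightarrow> homogeneous 1 l"
    and nzd: "\<And>xs l ys q. ls @ ms = xs @ l # ys \<Longrightarrow> l * q \<in> adjoin_list xs \<Longrightarrow> q \<in> adjoin_list xs"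
    and reg: "\<And>xs l ys p. ls = xs @ l # ys \<Longrightarrow> l * p \<in> ideal_sum I (adjoin_list xs) \<Longrightarrow>
      p \<in> ideal_sum I (adjoin_list xs)"
    and max: "adjoin_list (ls @ ms) = max_ideal"
    and s: "0 \<le> s"
    and above: "\<And>j p. s < j \<Longrightarrow> homogeneous j p \<Longrightarrow> p \<in> ideal_sum I (adjoin_list ls)"
    and top: "homogeneous s p0" "p0 \<notin> ideal_sum I (adjoin_list ls)"
  shows "\<not> tor_cycles d D i j \<subseteq> tor_boundaries d D i j \<Longrightarrow> 0 \<le> j - int i \<and> j - int i \<le> s"
    and "\<not> tor_cycles d D (length ms) (int (length ms) + s) \<subseteq> tor_boundaries d D (length ms) (int (length ms) + s)"
proof -
  have J: "ideal_set (adjoin_list (ls @ xs))" "graded_set (adjoin_list (ls @ xs))" if "set xs \<subseteq> set ms" for xs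
  proof -
    have "homogeneous 1 l" if "l \<in> set (ls @ xs)" for l using that \<open>set xs \<subseteq> set ms\<close> hom by auto
    then show "ideal_set (adjoin_list (ls @ xs))" "graded_set (adjoin_list (ls @ xs))"
      by (auto intro!: ideal_set_adjoin_list graded_set_adjoin_list)
  qed
  \<comment> \<open>Invariant while \<open>ms\<close> is killed one form at a time. Adjoining a form
    involves the positions (i, j) and (i - 1, j - 1), which have the same difference, so both bounds
    persist.\<close>
  have "(\<forall>i j. s < j - int i \<or> j - int i < 0 \<longrightarrow> exact_at (adjoin_list (ls @ xs)) i j) \<and>
      \<not> exact_at (adjoin_list (ls @ xs)) (length xs) (int (length xs) + s)" if "ms = xs @ ys" for xs ys
    using that
  proof (induction xs arbitrary: ys rule: rev_induct)
    case Nil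
    have "exact_at (adjoin_list ls) i j" if "s < j - int i \<or> j - int i < 0" for i j
    proof (cases i)
      case 0
      have "p \<in> ideal_sum I (adjoin_list ls)" if "homogeneous j p" for p :: "('l, 'k) mpoly"
      proof (cases "s < j")
        case True
        then show ?thesis using above that by blast
      next
        case False
        then have "p = 0" using homogeneous_negative[of j p] \<open>homogeneous j p\<close> \<open>s < j - int i \<or> _\<close> 0 by simp
        then show ?thesis using ideal_set_zero[OF I_ideal] ideal_set_zero[OF J(1)[of "[]"]]
          by (auto simp: ideal_sum_def intro!: bexI[of _ 0])
      qed
      then show ?thesis using exact_at_0_iff[OF J[of "[]"]] 0 by simp
    next
      case (Suc h)
      have "exact_at (adjoin_list ls) (Suc h) j"
      proof (rule exact_at_regular)
        show "homogeneous 1 l" if "l \<in> set ls" for l using hom that by simp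
        show "q \<in> adjoin_list xs" if "ls = xs @ l # ys" "l * q \<in> adjoin_list xs" for xs l ys q
          using nzd[of xs l "ys @ ms" q] that by simp
      qed (rule reg)
      then show ?thesis using Suc by simp
    qed
    moreover have "\<not> exact_at (adjoin_list ls) 0 s" using exact_at_0_iff[OF J[of "[]"]] top by auto
    ultimately show ?case by simp
  next
    case (snoc l xs)
    then have IH: "\<And>i j. s < j - int i \<or> j - int i < 0 \<Longrightarrow> exact_at (adjoin_list (ls @ xs)) i j"
      "\<not> exact_at (adjoin_list (ls @ xs)) (length xs) (int (length xs) + s)"
      using snoc.IH[of "l # ys"] snoc.prems by auto
    have J': "ideal_set (adjoin_list (ls @ xs))" "graded_set (adjoin_list (ls @ xs))"
      using J[of xs] snoc.prems by auto
    have l: "homogeneous 1 l" using hom snoc.prems by simp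
    have nz: "q \<in> adjoin_list (ls @ xs)" if "l * q \<in> adjoin_list (ls @ xs)" for q
      using nzd[of "ls @ xs" l ys q] snoc.prems that by simp
    have eq: "adjoin_list (ls @ xs @ [l]) = adjoin l (adjoin_list (ls @ xs))"
      using adjoin_list_snoc[of "ls @ xs" l] by simp
    have "exact_at (adjoin_list (ls @ xs @ [l])) i j" if "s < j - int i \<or> j - int i < 0" for i j
      unfolding eq
    proof (rule exact_at_adjoin[OF J' l nz IH(1)[OF that]])
      fix h q assume "i = Suc h" "q \<in> cyc (adjoin_list (ls @ xs)) h (j - 1)"
      then show "q \<in> bnd (adjoin_list (ls @ xs)) h (j - 1)"
        using IH(1)[of "j - 1" h] that by (auto simp: exact_at_def)
    qed
    \<comment> \<open>The top class can move because the position one degree above it has difference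
      \<open>s + 1\<close>, where the homology vanishes.\<close>
    moreover have "\<not> exact_at (adjoin_list (ls @ xs @ [l])) (Suc (length xs)) (int (length xs) + s + 1)"
      unfolding eq by (rule not_exact_at_adjoin[OF J' l nz IH(1) IH(2)]) simp_all
    ultimately show ?case by (simp add: algebra_simps)
  qed
  from this[of ms "[]"] show "\<not> tor_cycles d D i j \<subseteq> tor_boundaries d D i j \<Longrightarrow> 0 \<le> j - int i \<and> j - int i \<le> s"
    and "\<not> tor_cycles d D (length ms) (int (length ms) + s) \<subseteq> tor_boundaries d D (length ms) (int (length ms) + s)"
    unfolding exact_at_max_ideal[symmetric] append_Nil2 max by (meson not_le, blast)
qed

end

section \<open>Existence of resolutions\<close>

text \<open>Dickson's lemma. The minimal elements form an antichain. In an infinite antichain any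
  two vectors have a coordinate where the later one is smaller; Ramsey's theorem makes it the same
  coordinate on an infinite subset, which gives an infinite descent.\<close>

lemma dickson:
  fixes A :: "('l::finite \<Rightarrow>\<^sub>0 nat) set"
  shows "\<exists>F\<subseteq>A. finite F \<and> (\<forall>m\<in>A. \<exists>m0\<in>F. \<exists>t. m = m0 + t)"
proof -
  define F where "F = {m\<in>A. \<forall>m'\<in>A. (\<exists>t. m = m' + t) \<longrightarrow> m' = m}"
  have "\<exists>m0\<in>F. \<exists>t. m = m0 + t" if "m \<in> A" for m
    using that
  proof (induction "monom_deg m" arbitrary: m rule: less_induct)
    case less
    show ?case
    proof (cases "m \<in> F")
      case True
      then show ?thesis by (metis add.right_neutral)
    next
      case False
      then obtain m' t where m': "m' \<in> A" "m = m' + t" "m' \<noteq> m" using less.prems by (auto simp: F_def)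
      then have "monom_deg t \<noteq> 0" by (auto simp: monom_deg_eq_0_iff)
      then have "monom_deg m' < monom_deg m" using m'(2) by (simp add: monom_deg_add)
      then obtain m0 t' where "m0 \<in> F" "m' = m0 + t'" using less.hyps m'(1) by blast
      then show ?thesis using m'(2) by (metis add.assoc)
    qed
  qed
  moreover have "finite F"
  proof (rule ccontr)
    assume "infinite F"
    then obtain x :: "nat \<Rightarrow> 'l \<Rightarrow>\<^sub>0 nat" where x: "inj x" "range x \<subseteq> F"
      using infinite_countable_subset by blast
    obtain e :: "'l \<Rightarrow> nat" and n where e: "e ` UNIV = {i. i < n}" "inj e"
      using finite_imp_inj_to_nat_seg[of "UNIV :: 'l set"] by auto
    have incomp: "\<exists>a. lookup (x j) a < lookup (x i) a" if "i \<noteq> j" for i j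
    proof (rule ccontr)
      assume "\<nexists>a. lookup (x j) a < lookup (x i) a"
      then have "x j = x i + (x j - x i)" 
        by (intro poly_mapping_eqI) (simp add: lookup_add lookup_minus not_less)
      then have "x i = x j" using x(2) unfolding F_def by blast
      then show False using x(1) that by (auto dest: injD)
    qed
    \<comment> \<open>The colour numbers a coordinate at which the later vector is smaller. Ramsey's
      theorem colours two-element sets, hence the pair is recovered as minimum and maximum.\<close>
    define c where "c S = e (SOME a. lookup (x (Max S)) a < lookup (x (Min S)) a)" for S
    have "\<forall>i\<in>(UNIV::nat set). \<forall>j\<in>UNIV. i \<noteq> j \<longrightarrow> c {i, j} < n" using e(1) by (auto simp: c_def)
    then obtain Y t where Y: "infinite Y" "\<forall>i\<in>Y. \<forall>j\<in>Y. i \<noteq> j \<longrightarrow> c {i, j} = t"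
      using Ramsey2[of "UNIV :: nat set" c n] by auto
    have c: "lookup (x j) (inv_into UNIV e (c {i, j})) < lookup (x i) (inv_into UNIV e (c {i, j}))" if "i < j" for i j
    proof -
      have "Max {i, j} = j" "Min {i, j} = i" using that by auto
      moreover have "lookup (x j) (SOME a. lookup (x j) a < lookup (x i) a) < lookup (x i) (SOME a. lookup (x j) a < lookup (x i) a)"
        using someI_ex[OF incomp[of i j]] that by simp
      ultimately show ?thesis by (simp add: c_def inv_f_f[OF e(2)])
    qed
    define y where "y k = lookup (x (enumerate Y k)) (inv_into UNIV e t)" for k
    have "y (Suc k) < y k" for k
    proof -
      have "enumerate Y k < enumerate Y (Suc k)" using enumerate_step[OF Y(1)] .
      then show ?thesis using c[of "enumerate Y k" "enumerate Y (Suc k)"] Y(2) enumerate_in_set[OF Y(1)]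
        by (auto simp: y_def)
    qed
    then show False using wf_less wf_iff_no_infinite_down_chain[of "{(a, b). a < (b::nat)}"] by blast
  qed
  ultimately show ?thesis by (intro exI[of _ F]) (auto simp: F_def)
qed

text \<open>A term order on the module monomials, the component \<open>k\<close> being read as an additional variable.\<close>

lemma exists_term_order:
  "\<exists>key :: nat \<Rightarrow> ('l::finite \<Rightarrow>\<^sub>0 nat) \<Rightarrow> (nat \<Rightarrow>\<^sub>0 nat).
    (\<forall>k m t. key k (m + t) = key k m + key 0 t) \<and> (\<forall>k m k' m'. key k m = key k' m' \<longrightarrow> k = k' \<and> m = m')"
proof -
  obtain e0 :: "'l \<Rightarrow> nat" where e0: "inj e0"
    using finite_imp_inj_to_nat_seg[of "UNIV :: 'l set"] by auto
  \<comment> \<open>The linear order on \<open>nat \<Rightarrow>\<^sub>0 nat\<close> is compatible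
    with addition. The variables carry no linear order and are numbered by \<open>e0\<close>;
    position 0 is left to the component.\<close>
  define key :: "nat \<Rightarrow> ('l \<Rightarrow>\<^sub>0 nat) \<Rightarrow> (nat \<Rightarrow>\<^sub>0 nat)"
    where "key k m = single 0 k + (\<Sum>a\<in>UNIV. single (Suc (e0 a)) (lookup m a))" for k m
  have "key k (m + t) = key k m + key 0 t" for k m t
    by (simp add: key_def lookup_add single_add sum.distrib algebra_simps)
  moreover have "k = k' \<and> m = m'" if "key k m = key k' m'" for k m k' m'
  proof -
    have "lookup (key k m) 0 = k" for k m
      by (simp add: key_def lookup_add lookup_sum lookup_single)
    moreover have "lookup (key k m) (Suc (e0 a)) = lookup m a" for k m a
      by (simp add: key_def lookup_add lookup_sum lookup_single when_def inj_eq[OF e0])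
    ultimately show ?thesis using that by (metis poly_mapping_eqI)
  qed
  ultimately show ?thesis by blast
qed

lemma lookup_single_mult:
  fixes p :: "('l::finite, 'k::comm_ring_1) mpoly"
  shows "lookup (single t b * p) (t + m) = b * lookup p m"
proof (induction p rule: poly_mapping_single_induct)
  case (add n c p)
  then show ?case by (simp add: distrib_left lookup_add mult_single lookup_single when_def)
qed simp

definition graded_submodule :: "int list \<Rightarrow> ('l::finite, 'k::field) mpoly vec set \<Rightarrow> bool" where
  "graded_submodule ds M \<longleftrightarrow> M \<subseteq> carrier_vec (length ds) \<and> 0\<^sub>v (length ds) \<in> M \<and>
    (\<forall>v\<in>M. \<forall>w\<in>M. v - w \<in> M) \<and> (\<forall>v\<in>M. \<forall>a. a \<cdot>\<^sub>v v \<in> M) \<and> (\<forall>v\<in>M. \<forall>j. hproj ds j v \<in> M)"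

text \<open>The generators are a Groebner basis: their leading monomials divide all leading monomials.\<close>

lemma graded_submodule_spanned:
  fixes M :: "('l::finite, 'k::field) mpoly vec set"
  assumes M: "graded_submodule ds M"
  shows "\<exists>B\<subseteq>M. finite B \<and> (\<forall>u\<in>B. \<exists>j. u \<in> hom_vecs ds j) \<and>
    (\<forall>V. 0\<^sub>v (length ds) \<in> V \<and> B \<subseteq> V \<and> (\<forall>v\<in>V. \<forall>w\<in>V. v + w \<in> V) \<and> (\<forall>v\<in>V. \<forall>a. a \<cdot>\<^sub>v v \<in> V) \<longrightarrow>
      (\<forall>j. M \<inter> hom_vecs ds j \<subseteq> V))"
proof -
  let ?n = "length ds"
  obtain key :: "nat \<Rightarrow> ('l::finite \<Rightarrow>\<^sub>0 nat) \<Rightarrow> (nat \<Rightarrow>\<^sub>0 nat)" where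
    key_add: "\<And>k m t. key k (m + t) = key k m + key 0 t" and
    key_inj: "\<And>k m k' m'. key k m = key k' m' \<Longrightarrow> k = k' \<and> m = m'"
    using exists_term_order by metis
  define supp :: "('l, 'k) mpoly vec \<Rightarrow> (nat \<times> ('l \<Rightarrow>\<^sub>0 nat)) set"
    where "supp v = Sigma {..<?n} (\<lambda>k. keys (v $ k))" for v
  define lead where "lead v = (\<lambda>(k, m). (k, m) \<in> supp v \<and> (\<forall>(k', m')\<in>supp v. key k' m' \<le> key k m))" for v
  have fin_supp: "finite (supp v)" for v by (simp add: supp_def)
  have ex_lead: "\<exists>km. lead v km" if "v \<in> carrier_vec ?n" "v \<noteq> 0\<^sub>v ?n" for v
  proof -
    have "supp v \<noteq> {}"
    proof
      assume "supp v = {}"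
      then have "keys (v $ k) = {}" if "k < ?n" for k
        using that unfolding supp_def by blast
      then have "v $ k = 0" if "k < ?n" for k
        using that by (metis empty_iff in_keys_iff lookup_zero poly_mapping_eqI)
      then show False using that by (auto simp: vec_eq_iff)
    qed
    then have "Max (case_prod key ` supp v) \<in> case_prod key ` supp v" using fin_supp by simp
    then obtain km where "km \<in> supp v" "case_prod key km = Max (case_prod key ` supp v)" by auto
    moreover have "\<forall>x\<in>supp v. case_prod key x \<le> Max (case_prod key ` supp v)" using fin_supp by simp
    ultimately have "lead v km" by (auto simp: lead_def split: prod.splits)
    then show ?thesis ..
  qed
  \<comment> \<open>Leading monomials are collected separately for each component, so that
    divisibility is a matter of exponent vectors only.\<close>
  define L where "L k = {m. \<exists>u\<in>M. (\<exists>j. u \<in> hom_vecs ds j) \<and> lead u (k, m)}" for k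
  have "\<forall>k. \<exists>F\<subseteq>L k. finite F \<and> (\<forall>m\<in>L k. \<exists>m0\<in>F. \<exists>t. m = m0 + t)" using dickson by blast
  then obtain F where F: "\<And>k. F k \<subseteq> L k" "\<And>k. finite (F k)" "\<And>k m. m \<in> L k \<Longrightarrow> \<exists>m0\<in>F k. \<exists>t. m = m0 + t"
    by metis
  have "\<forall>km\<in>Sigma {..<?n} F. \<exists>u\<in>M. (\<exists>j. u \<in> hom_vecs ds j) \<and> lead u km"
    using F(1) by (auto simp: L_def)
  then obtain u where u: "\<And>km. km \<in> Sigma {..<?n} F \<Longrightarrow> u km \<in> M \<and> (\<exists>j. u km \<in> hom_vecs ds j) \<and> lead (u km) km"
    by metis
  define B where "B = u ` Sigma {..<?n} F"
  have "v \<in> V" if V: "0\<^sub>v ?n \<in> V" "B \<subseteq> V" "\<And>v w. v \<in> V \<Longrightarrow> w \<in> V \<Longrightarrow> v + w \<in> V" "\<And>v a. v \<in> V \<Longrightarrow> a \<cdot>\<^sub>v v \<in> V"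
    and v: "v \<in> M" "v \<in> hom_vecs ds j" for V j v
  proof -
    define T where "T = Sigma {..<?n} (\<lambda>k. {m :: 'l \<Rightarrow>\<^sub>0 nat. int (monom_deg m) + ds ! k = j})"
    have fin_e: "finite {m :: 'l \<Rightarrow>\<^sub>0 nat. int (monom_deg m) + e = j}" for e
      by (rule finite_subset[OF _ finite_bounded_monoms[of "nat (j - e)"]]) auto
    have fin_T: "finite T" unfolding T_def by (intro finite_SigmaI fin_e) simp
    have supp_T: "supp v \<subseteq> T" if "v \<in> hom_vecs ds j" for v
      using that by (fastforce simp: T_def supp_def hom_vecs_def homogeneous_def)
    \<comment> \<open>Termination of the division: \<open>\<mu>\<close> counts the module monomials
      of degree \<open>j\<close> that lie at or below some monomial of the vector. There are
      finitely many, and cancelling the leading term loses at least that term.\<close>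
    define \<mu> where "\<mu> v = card {x \<in> T. \<exists>y\<in>supp v. case_prod key x \<le> case_prod key y}" for v
    show ?thesis
      using v
    proof (induction "\<mu> v" arbitrary: v rule: less_induct)
      case less
      have vc: "v \<in> carrier_vec ?n" using less.prems(2) by (rule hom_vecs_carrier)
      show ?case
      proof (cases "v = 0\<^sub>v ?n")
        case True
        then show ?thesis using V by simp
      next
        case False
        then obtain k m where km: "lead v (k, m)" using ex_lead[OF vc] by auto
        then have k: "k < ?n" and m: "m \<in> keys (v $ k)" by (auto simp: lead_def supp_def)
        have "m \<in> L k" using km less.prems by (auto simp: L_def)
        then obtain m0 t where m0: "m0 \<in> F k" "m = t + m0" using F(3) by (metis add.commute)
        define w where "w = u (k, m0)"
        obtain i where w: "w \<in> M" "w \<in> hom_vecs ds i" "lead w (k, m0)" "w \<in> B"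
          using u[of "(k, m0)"] m0 k by (auto simp: w_def B_def)
        have wc: "w \<in> carrier_vec ?n" using w(2) by (rule hom_vecs_carrier)
        have m0k: "m0 \<in> keys (w $ k)" using w(3) by (auto simp: lead_def supp_def)
        define b where "b = lookup (v $ k) m / lookup (w $ k) m0"
        let ?v = "v - single t b \<cdot>\<^sub>v w"
        have "int (monom_deg m) = j - ds ! k" "int (monom_deg m0) = i - ds ! k"
          using less.prems(2) w(2) m m0k k by (auto simp: hom_vecs_def homogeneous_def)
        then have "j = i + int (monom_deg t)" using m0(2) by (simp add: monom_deg_add)
        then have tw: "single t b \<cdot>\<^sub>v w \<in> hom_vecs ds j"
          using hom_vecs_smult[OF homogeneous_single[OF refl] w(2), of t b] by simp
        have vh: "?v \<in> hom_vecs ds j" using hom_vecs_diff[OF less.prems(2) tw] .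
        have vM: "?v \<in> M" using M less.prems(1) w(1) by (auto simp: graded_submodule_def)
        have small: "key k' m' < key k m" if "(k', m') \<in> supp ?v" for k' m'
        proof -
          from that have k': "k' < ?n" and m': "m' \<in> keys (v $ k' - single t b * w $ k')"
            using vc wc by (auto simp: supp_def)
          have "key k' m' \<le> key k m"
          proof (cases "m' \<in> keys (v $ k')")
            case True
            then show ?thesis using km k' by (auto simp: lead_def supp_def)
          next
            case False
            then have "m' \<in> keys (single t b * w $ k')" using m' by (auto simp: in_keys_iff lookup_minus)
            then obtain m1 where m1: "m1 \<in> keys (w $ k')" "m' = m1 + t"
              using keys_mult[of "single t b" "w $ k'"] by (auto simp: add.commute split: if_splits)
            then have "key k' m1 \<le> key k m0" using w(3) k' by (auto simp: lead_def supp_def)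
            then have "key k' m1 + key 0 t \<le> key k m0 + key 0 t" by (rule add_right_mono)
            then show ?thesis using m1 m0 by (simp add: key_add add.commute flip: key_add[of _ m0 t])
          qed
          moreover have "key k' m' \<noteq> key k m"
          proof
            assume "key k' m' = key k m"
            then have "k' = k" "m' = m" using key_inj by auto
            moreover have "lookup (v $ k - single t b * w $ k) m = 0"
              using m0k by (simp add: lookup_minus m0(2) lookup_single_mult b_def in_keys_iff)
            ultimately show False using m' by (simp add: in_keys_iff)
          qed
          ultimately show ?thesis by simp
        qed
        have "{x \<in> T. \<exists>y\<in>supp ?v. case_prod key x \<le> case_prod key y}
            \<subset> {x \<in> T. \<exists>y\<in>supp v. case_prod key x \<le> case_prod key y}"
        proof (rule psubsetI)
          have kmv: "(k, m) \<in> supp v" using km by (simp add: lead_def)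
          show "{x \<in> T. \<exists>y\<in>supp ?v. case_prod key x \<le> case_prod key y}
            \<subseteq> {x \<in> T. \<exists>y\<in>supp v. case_prod key x \<le> case_prod key y}"
          proof safe
            fix k1 m1 k2 m2 assume "(k2, m2) \<in> supp ?v" "key k1 m1 \<le> key k2 m2"
            then have "key k1 m1 \<le> key k m" using small[of k2 m2] by simp
            then show "\<exists>y\<in>supp v. key k1 m1 \<le> case_prod key y" using kmv by (intro bexI[of _ "(k, m)"]) auto
          qed
          have "(k, m) \<in> {x \<in> T. \<exists>y\<in>supp v. case_prod key x \<le> case_prod key y}"
            using kmv supp_T[OF less.prems(2)] by blast
          moreover have "(k, m) \<notin> {x \<in> T. \<exists>y\<in>supp ?v. case_prod key x \<le> case_prod key y}"
            using small by fastforce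
          ultimately show "{x \<in> T. \<exists>y\<in>supp ?v. case_prod key x \<le> case_prod key y}
            \<noteq> {x \<in> T. \<exists>y\<in>supp v. case_prod key x \<le> case_prod key y}" by blast
        qed
        then have "\<mu> ?v < \<mu> v" unfolding \<mu>_def using fin_T by (intro psubset_card_mono) auto
        then have "?v \<in> V" using less.hyps vM vh by blast
        moreover have "single t b \<cdot>\<^sub>v w \<in> V" using V w(4) by blast
        moreover have "v = ?v + single t b \<cdot>\<^sub>v w" using vc wc by (auto simp: vec_eq_iff)
        ultimately show ?thesis using V(3) by metis
      qed
    qed
  qed
  moreover have "finite B" using F(2) by (simp add: B_def)
  moreover have "B \<subseteq> M" "\<forall>x\<in>B. \<exists>j. x \<in> hom_vecs ds j" using u by (auto simp: B_def)
  ultimately show ?thesis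
    by (intro exI[of _ B] conjI) (assumption+, intro allI impI subsetI, elim conjE IntE, metis)
qed

lemma hproj_sum_eq:
  fixes v :: "('l::finite, 'k::field) mpoly vec"
  assumes "v \<in> carrier_vec (length ds)"
  shows "\<exists>E. finite E \<and> v = vec (length ds) (\<lambda>k. \<Sum>e\<in>E. hpart (e - ds ! k) (v $ k))"
proof -
  define E where "E = (\<Union>k<length ds. (\<lambda>m. int (monom_deg m) + ds ! k) ` keys (v $ k))"
  have fin: "finite E" by (simp add: E_def)
  have "v $ k = (\<Sum>e\<in>E. hpart (e - ds ! k) (v $ k))" if k: "k < length ds" for k
  proof (rule poly_mapping_eqI)
    fix m
    have "lookup (\<Sum>e\<in>E. hpart (e - ds ! k) (v $ k)) m =
        (\<Sum>e\<in>E. if e = int (monom_deg m) + ds ! k then lookup (v $ k) m else 0)"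
      unfolding lookup_sum by (intro sum.cong) (auto simp: lookup_hpart)
    also have "\<dots> = lookup (v $ k) m"
    proof (cases "m \<in> keys (v $ k)")
      case True
      then have "int (monom_deg m) + ds ! k \<in> E" using k unfolding E_def by blast
      then show ?thesis using fin by simp
    qed (simp add: in_keys_iff cong: if_cong)
    finally show "lookup (v $ k) m = lookup (\<Sum>e\<in>E. hpart (e - ds ! k) (v $ k)) m" ..
  qed
  then have "v = vec (length ds) (\<lambda>k. \<Sum>e\<in>E. hpart (e - ds ! k) (v $ k))"
    using assms by (intro eq_vecI) auto
  with fin show ?thesis by blast
qed

text \<open>The finitely many homogeneous generators become the columns of the matrix; arbitrary
  elements are reduced to their homogeneous components.\<close>

lemma graded_submodule_image:
  fixes M :: "('l::finite, 'k::field) mpoly vec set"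
  assumes M: "graded_submodule ds M"
  shows "\<exists>ds' G. graded_matrix ds ds' G \<and> M = (\<lambda>w. G *\<^sub>v w) ` carrier_vec (length ds')"
proof -
  let ?n = "length ds"
  obtain B where B: "B \<subseteq> M" "finite B" "\<And>u. u \<in> B \<Longrightarrow> \<exists>j. u \<in> hom_vecs ds j"
    and span: "\<And>V j. 0\<^sub>v ?n \<in> V \<Longrightarrow> B \<subseteq> V \<Longrightarrow> \<forall>v\<in>V. \<forall>w\<in>V. v + w \<in> V \<Longrightarrow> \<forall>v\<in>V. \<forall>a. a \<cdot>\<^sub>v v \<in> V \<Longrightarrow> M \<inter> hom_vecs ds j \<subseteq> V"
    using graded_submodule_spanned[OF M] by metis
  obtain us where us: "set us = B" using finite_list[OF B(2)] by blast
  obtain dg where dg: "\<And>u. u \<in> B \<Longrightarrow> u \<in> hom_vecs ds (dg u)" using B(3) by metis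
  define ds' where "ds' = map dg us"
  define G where "G = mat ?n (length us) (\<lambda>(r, c). us ! c $ r)"
  have len: "length ds' = length us" by (simp add: ds'_def)
  have G: "G \<in> carrier_mat ?n (length us)" by (simp add: G_def)
  have gm: "graded_matrix ds ds' G"
    unfolding graded_matrix_def
  proof (intro conjI allI impI)
    fix r c assume "r < ?n" "c < length ds'"
    then show "homogeneous (ds' ! c - ds ! r) (G $$ (r, c))"
      using dg[of "us ! c"] us by (auto simp: ds'_def G_def hom_vecs_def)
  qed (simp add: G len)
  let ?V = "(\<lambda>w. G *\<^sub>v w) ` carrier_vec (length ds')"
  have M_closed: "v - w \<in> M" "a \<cdot>\<^sub>v v \<in> M" "hproj ds j v \<in> M" if "v \<in> M" "w \<in> M" for v w a j
    using M that by (auto simp: graded_submodule_def)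
  have M0: "0\<^sub>v ?n \<in> M" "M \<subseteq> carrier_vec ?n" using M by (auto simp: graded_submodule_def)
  have M_add: "v + w \<in> M" if "v \<in> M" "w \<in> M" for v w
  proof -
    have "v - (-1) \<cdot>\<^sub>v w = v + w" using M0 that by (intro eq_vecI) auto
    then show ?thesis using M_closed[OF that(1) M_closed(2)[OF that(2,2)], of "-1"] by simp
  qed
  have V0: "0\<^sub>v ?n \<in> ?V"
  proof
    show "0\<^sub>v ?n = G *\<^sub>v 0\<^sub>v (length ds')" using G len by (intro eq_vecI) (auto simp: index_mult_mat_vec)
  qed simp
  have V_add: "\<forall>v\<in>?V. \<forall>w\<in>?V. v + w \<in> ?V"
  proof (intro ballI)
    fix v w assume "v \<in> ?V" "w \<in> ?V"
    then obtain v' w' where "v' \<in> carrier_vec (length ds')" "w' \<in> carrier_vec (length ds')" "v = G *\<^sub>v v'" "w = G *\<^sub>v w'"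
      by blast
    then show "v + w \<in> ?V" using G len 
      by (intro image_eqI[of _ _ "v' + w'"]) (simp_all add: mult_add_distrib_mat_vec[OF G])
  qed
  have V_smult: "\<forall>v\<in>?V. \<forall>a. a \<cdot>\<^sub>v v \<in> ?V"
  proof (intro ballI allI)
    fix v a assume "v \<in> ?V"
    then obtain v' where "v' \<in> carrier_vec (length ds')" "v = G *\<^sub>v v'" by blast
    then show "a \<cdot>\<^sub>v v \<in> ?V" using G len
      by (intro image_eqI[of _ _ "a \<cdot>\<^sub>v v'"] eq_vecI) (auto simp: index_mult_mat_vec)
  qed
  have V_B: "B \<subseteq> ?V"
  proof
    fix u assume "u \<in> B"
    then obtain c where c: "c < length us" "us ! c = u" using us by (metis in_set_conv_nth)
    have "u \<in> carrier_vec ?n" using dg[OF \<open>u \<in> B\<close>] by (rule hom_vecs_carrier)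
    then have "u = G *\<^sub>v unit_vec (length ds') c"
      using c len by (intro eq_vecI) (auto simp: index_mult_mat_vec G_def)
    then show "u \<in> ?V" by (rule image_eqI) simp
  qed
  have "?V \<subseteq> M"
  proof
    fix v assume "v \<in> ?V"
    then obtain w where w: "w \<in> carrier_vec (length us)" "v = G *\<^sub>v w" using len by auto
    have part: "vec ?n (\<lambda>r. \<Sum>c<N. us ! c $ r * w $ c) \<in> M" if "N \<le> length us" for N
      using that
    proof (induction N)
      case 0
      show ?case using M0 by (simp add: zero_vec_def)
    next
      case (Suc N)
      have uM: "us ! N \<in> M" using B(1) us Suc.prems by (auto simp: subset_iff)
      then have uc: "us ! N \<in> carrier_vec ?n" using M0 by auto
      have "vec ?n (\<lambda>r. \<Sum>c<N. us ! c $ r * w $ c) + w $ N \<cdot>\<^sub>v (us ! N) \<in> M"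
        using Suc M_add M_closed(2)[OF uM uM] by simp
      also have "vec ?n (\<lambda>r. \<Sum>c<N. us ! c $ r * w $ c) + w $ N \<cdot>\<^sub>v (us ! N) = vec ?n (\<lambda>r. \<Sum>c<Suc N. us ! c $ r * w $ c)"
        using uc by (intro eq_vecI) (auto simp: mult.commute)
      finally show ?case .
    qed
    have "v = vec ?n (\<lambda>r. \<Sum>c<length us. us ! c $ r * w $ c)"
      using w by (intro eq_vecI) (auto simp: index_mult_mat_vec G_def scalar_prod_def atLeast0LessThan)
    then show "v \<in> M" using part[of "length us"] by simp
  qed
  moreover have "M \<subseteq> ?V"
  proof
    fix v assume v: "v \<in> M"
    then have vc: "v \<in> carrier_vec ?n" using M0 by auto
    have hp: "hproj ds e v \<in> ?V" for e
      using span[OF V0 V_B V_add V_smult, of e] M_closed(3)[OF v v] hproj_hom_vecs by blast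
    obtain E where E: "finite E" "v = vec ?n (\<lambda>k. \<Sum>e\<in>E. hpart (e - ds ! k) (v $ k))"
      using hproj_sum_eq[OF vc] by blast
    have "vec ?n (\<lambda>k. \<Sum>e\<in>E. hpart (e - ds ! k) (v $ k)) \<in> ?V"
      using E(1)
    proof (induction E)
      case empty
      show ?case using V0 by (simp add: zero_vec_def)
    next
      case (insert e E)
      have "hproj ds e v + vec ?n (\<lambda>k. \<Sum>e\<in>E. hpart (e - ds ! k) (v $ k)) \<in> ?V"
        using V_add insert.IH hp by blast
      also have "hproj ds e v + vec ?n (\<lambda>k. \<Sum>e\<in>E. hpart (e - ds ! k) (v $ k))
          = vec ?n (\<lambda>k. \<Sum>e\<in>insert e E. hpart (e - ds ! k) (v $ k))"
        using insert.hyps by (intro eq_vecI) (auto simp: hproj_def)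
      finally show ?case .
    qed
    then show "v \<in> ?V" using E(2) by simp
  qed
  ultimately show ?thesis using gm by blast
qed

lemma graded_submodule_kernel:
  fixes G :: "('l::finite, 'k::field) mpoly mat"
  assumes G: "graded_matrix ds ds' G"
  shows "graded_submodule ds' {v \<in> carrier_vec (length ds'). G *\<^sub>v v = 0\<^sub>v (length ds)}"
proof -
  have Gc: "G \<in> carrier_mat (length ds) (length ds')" using G by (simp add: graded_matrix_def)
  have "G *\<^sub>v 0\<^sub>v (length ds') = 0\<^sub>v (length ds)" using Gc by (intro eq_vecI) (auto simp: index_mult_mat_vec)
  moreover have "G *\<^sub>v (v - w) = 0\<^sub>v (length ds)" if "v \<in> carrier_vec (length ds')" "w \<in> carrier_vec (length ds')"
    "G *\<^sub>v v = 0\<^sub>v (length ds)" "G *\<^sub>v w = 0\<^sub>v (length ds)" for v w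
    using mult_minus_distrib_mat_vec[OF Gc that(1,2)] that by simp
  moreover have "G *\<^sub>v (a \<cdot>\<^sub>v v) = 0\<^sub>v (length ds)" if "v \<in> carrier_vec (length ds')" "G *\<^sub>v v = 0\<^sub>v (length ds)" for a v
  proof -
    have "G *\<^sub>v (a \<cdot>\<^sub>v v) = a \<cdot>\<^sub>v (G *\<^sub>v v)" using Gc that(1) by (intro eq_vecI) (auto simp: index_mult_mat_vec)
    then show ?thesis using that by (auto simp: vec_eq_iff)
  qed
  moreover have "G *\<^sub>v hproj ds' j v = 0\<^sub>v (length ds)" if "v \<in> carrier_vec (length ds')" "G *\<^sub>v v = 0\<^sub>v (length ds)" for j v
    using graded_matrix_hproj[OF G that(1)] that(2) by (auto simp: hproj_def)
  ultimately show ?thesis by (auto simp: graded_submodule_def hproj_carrier)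
qed

text \<open>The ideal is a submodule of the free module of rank one, thus the image of a matrix, and
  every kernel is the image of the next matrix.\<close>

theorem exists_resolution:
  fixes I :: "('l::finite, 'k::field) mpoly set"
  assumes I: "ideal_set I" "graded_set I"
  shows "\<exists>d D g. graded_free_resolution I {0} d D g"
proof -
  let ?M = "{v \<in> carrier_vec 1. v $ 0 \<in> I}"
  have "graded_submodule [0] ?M"
    using I by (auto simp: graded_submodule_def hproj_def ideal_set_diff ideal_set_mult ideal_set_zero graded_set_def)
  from graded_submodule_image[OF this] obtain d0 G0 where
    G0: "graded_matrix [0] d0 G0" "?M = (\<lambda>w. G0 *\<^sub>v w) ` carrier_vec (length d0)" by blast
  \<comment> \<open>The state of the recursion is a matrix with its row and column degrees.
    \<open>P\<close> fixes the first state to \<open>G0\<close>, and \<open>R\<close> says that the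
    next matrix maps onto the kernel of the present one.\<close>
  define P where "P = (\<lambda>(n::nat) (ds :: int list, ds' :: int list, G :: ('l, 'k) mpoly mat). graded_matrix ds ds' G \<and> (n = 0 \<longrightarrow> ds = [0] \<and> ds' = d0 \<and> G = G0))"
  define R where "R = (\<lambda>(n::nat) (ds :: int list, ds' :: int list, G :: ('l, 'k) mpoly mat) (es :: int list, es' :: int list, H :: ('l, 'k) mpoly mat). es = ds' \<and> 
    {v \<in> carrier_vec (length ds'). G *\<^sub>v v = 0\<^sub>v (length ds)} = (\<lambda>w. H *\<^sub>v w) ` carrier_vec (length es'))"
  have "\<exists>x. P 0 x" using G0 by (auto simp: P_def)
  moreover have "\<exists>y. P (Suc n) y \<and> R n x y" if "P n x" for n x
  proof -
    obtain ds ds' G where x: "x = (ds, ds', G)" by (cases x)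
    with that have "graded_matrix ds ds' G" by (simp add: P_def)
    from graded_submodule_image[OF graded_submodule_kernel[OF this]] obtain es' H where
      "graded_matrix ds' es' H" 
      "{v \<in> carrier_vec (length ds'). G *\<^sub>v v = 0\<^sub>v (length ds)} = (\<lambda>w. H *\<^sub>v w) ` carrier_vec (length es')" by blast
    then have "P (Suc n) (ds', es', H) \<and> R n x (ds', es', H)" by (simp add: P_def R_def x)
    then show ?thesis by blast
  qed
  ultimately obtain f where f: "\<And>n. P n (f n)" "\<And>n. R n (f n) (f (Suc n))"
    using dependent_nat_choice[of P R] by blast
  define d where "d n = fst (snd (f n))" for n
  \<comment> \<open>State 0 holds the augmentation, whose only row is \<open>g\<close>; the
    differentials start with state 1.\<close>
  define D where "D n = snd (snd (f (Suc n)))" for n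
  define g where "g = row G0 0"
  have f0: "f 0 = ([0], d 0, G0)" "d 0 = d0" using f(1)[of 0] by (auto simp: P_def d_def split: prod.splits)
  have fS: "f (Suc n) = (d n, d (Suc n), D n)" for n
    using f(2)[of n] by (auto simp: R_def d_def D_def split: prod.splits)
  have gm: "graded_matrix (d n) (d (Suc n)) (D n)" for n
    using f(1)[of "Suc n"] fS by (simp add: P_def)
  have ker0: "{v \<in> carrier_vec (length (d 0)). G0 *\<^sub>v v = 0\<^sub>v 1} = (\<lambda>w. D 0 *\<^sub>v w) ` carrier_vec (length (d 1))"
    using f(2)[of 0] fS[of 0] f0 by (simp add: R_def)
  have ker: "{v \<in> carrier_vec (length (d (Suc n))). D n *\<^sub>v v = 0\<^sub>v (length (d n))}
      = (\<lambda>w. D (Suc n) *\<^sub>v w) ` carrier_vec (length (d (Suc (Suc n))))" for n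
    using f(2)[of "Suc n"] fS[of n] fS[of "Suc n"] by (simp add: R_def)
  have G0c: "G0 \<in> carrier_mat 1 (length (d 0))" using G0 f0 by (simp add: graded_matrix_def)
  have gv: "(G0 *\<^sub>v v) $ 0 = g \<bullet> v" for v using G0c by (simp add: g_def index_mult_mat_vec)
  have G0v: "G0 *\<^sub>v v = 0\<^sub>v 1 \<longleftrightarrow> g \<bullet> v = 0" for v
    using G0c gv[of v] by (auto simp: vec_eq_iff)
  have gI: "g \<bullet> v \<in> I" if "v \<in> carrier_vec (length (d 0))" for v
  proof -
    have "G0 *\<^sub>v v \<in> ?M" unfolding G0(2) using that f0 by blast
    then show ?thesis using gv by simp
  qed
  have "graded_free_resolution I {0} d D g"
    unfolding graded_free_resolution_def
  proof (intro conjI allI impI ballI)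
    show gc: "g \<in> carrier_vec (length (d 0))" using G0c unfolding g_def by (intro carrier_vecI) simp
    fix k assume k: "k < length (d 0)"
    have "g \<bullet> unit_vec (length (d 0)) k = g $ k" using gc k by simp
    then show "g $ k \<in> I" using gI[of "unit_vec (length (d 0)) k"] by simp
    show "homogeneous (d 0 ! k) (g $ k)" using G0(1) k G0c f0 by (auto simp: graded_matrix_def g_def)
  next
    show "D i \<in> carrier_mat (length (d i)) (length (d (Suc i)))" for i
      using gm[of i] by (simp add: graded_matrix_def)
    show "homogeneous (d (Suc i) ! c - d i ! r) (D i $$ (r, c))"
      if "r < length (d i)" "c < length (d (Suc i))" for i r c
      using gm[of i] that by (simp add: graded_matrix_def)
  next
    fix p assume "p \<in> I"
    then have "vec 1 (\<lambda>_. p) \<in> ?M" by simp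
    then obtain v where "v \<in> carrier_vec (length (d 0))" "vec 1 (\<lambda>_. p) = G0 *\<^sub>v v" unfolding G0(2) f0 by blast
    then show "\<exists>v\<in>carrier_vec (length (d 0)). p - g \<bullet> v \<in> {0}" using gv[of v]
      by (intro bexI[of _ v]) (auto dest: arg_cong[of _ _ "\<lambda>v. v $ 0"])
  next
    show "{v \<in> carrier_vec (length (d 0)). g \<bullet> v \<in> {0}} = (\<lambda>w. D 0 *\<^sub>v w) ` carrier_vec (length (d 1))"
      using ker0 G0v by simp
  qed (rule ker)
  then show ?thesis by blast
qed

section \<open>The Hibi ideal as a toric ideal\<close>

lemma module_times: "Modules.module ((*) :: 'r::comm_ring_1 \<Rightarrow> 'r \<Rightarrow> 'r)"
  by unfold_locales (simp_all add: algebra_simps)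

lemma ideal_generated_superset: "B \<subseteq> ideal_generated B"
  unfolding ideal_generated_def by (rule module.span_superset[OF module_times])

lemma ideal_set_ideal_generated: "ideal_set (ideal_generated B)"
  unfolding ideal_set_def ideal_generated_def
  by (auto intro: module.span_zero[OF module_times] module.span_add[OF module_times] module.span_scale[OF module_times])

lemma ideal_generated_induct [consumes 1, case_names zero step]:
  assumes "p \<in> ideal_generated B" "P 0" "\<And>a b y. b \<in> B \<Longrightarrow> P y \<Longrightarrow> P (a * b + y)"
  shows "P p"
  using assms unfolding ideal_generated_def by (rule module.span_induct_alt[OF module_times])

lemma graded_set_ideal_generated:
  fixes B :: "('l::finite, 'k::comm_ring_1) mpoly set"
  assumes "\<And>b. b \<in> B \<Longrightarrow> \<exists>d. homogeneous d b"
  shows "graded_set (ideal_generated B)"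
  unfolding graded_set_def
proof (intro ballI allI)
  fix p e assume "p \<in> ideal_generated B"
  then show "hpart e p \<in> ideal_generated B"
  proof (induction rule: ideal_generated_induct)
    case zero
    then show ?case using ideal_set_zero[OF ideal_set_ideal_generated] by simp
  next
    case (step a b y)
    then obtain d where "homogeneous d b" using assms by blast
    then have "hpart e (a * b + y) = hpart (e - d) a * b + hpart e y"
      using hpart_mult[of d b e a] by (simp add: hpart_add mult.commute)
    moreover have "hpart (e - d) a * b \<in> ideal_generated B"
      using step.hyps ideal_generated_superset[of B] by (intro ideal_set_mult[OF ideal_set_ideal_generated]) auto
    ultimately show ?case using step.IH ideal_set_add[OF ideal_set_ideal_generated] by metis
  qed
qed

section \<open>Birkhoff's correspondence between lattice elements and down-sets\<close>

abbreviation (input) least :: "'l::{finite, distrib_lattice}" where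
  "least \<equiv> Inf_fin UNIV"

text \<open>The poset of join irreducible elements with a bottom element added. It is realised inside the
  lattice, the added element being the least element of the lattice.\<close>

definition ext_irreducibles :: "'l::{finite, distrib_lattice} set" where
  "ext_irreducibles = insert least join_irreducibles"

lemma least_le: "(least :: 'l::{finite, distrib_lattice}) \<le> a"
  by (rule Inf_fin.coboundedI) auto

lemma least_in_ext_irreducibles [simp]: "least \<in> ext_irreducibles"
  by (simp add: ext_irreducibles_def)

text \<open>In a distributive lattice join irreducible elements are join prime: distribute
  \<open>inf p (sup b c)\<close>. For the added bottom element both sides are true.\<close>

lemma ext_irreducible_prime:
  assumes "p \<in> ext_irreducibles" shows "p \<le> sup b c \<longleftrightarrow> p \<le> b \<or> p \<le> c"
proof
  assume le: "p \<le> sup b c"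
  show "p \<le> b \<or> p \<le> c"
  proof (cases "p = least")
    case True
    then show ?thesis using least_le by auto
  next
    case False
    have "p = sup (inf p b) (inf p c)" using le by (simp add: inf_absorb1 flip: inf_sup_distrib1)
    then have "p = inf p b \<or> p = inf p c"
      using assms False unfolding ext_irreducibles_def join_irreducibles_def by blast
    then show ?thesis by (auto simp: le_iff_inf)
  qed
qed (auto intro: le_supI1 le_supI2)

definition irr_below :: "'l::{finite, distrib_lattice} \<Rightarrow> 'l set" where
  "irr_below a = {p \<in> ext_irreducibles. p \<le> a}"

text \<open>Every element is the join of the irreducible ones below it: a reducible \<open>a\<close>
  is the join of two strictly smaller elements, to which induction applies.\<close>

lemma irr_below_subset_imp_le:
  assumes "irr_below a \<subseteq> irr_below b" shows "a \<le> b"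
  using assms
proof (induction "card {x. x \<le> a}" arbitrary: a rule: less_induct)
  case less
  show ?case
  proof (cases "a \<in> ext_irreducibles")
    case True
    then show ?thesis using less.prems by (auto simp: irr_below_def)
  next
    case False
    then obtain c d where cd: "a = sup c d" "a \<noteq> c" "a \<noteq> d"
      by (auto simp: ext_irreducibles_def join_irreducibles_def)
    have "x \<le> b" if "x < a" for x
    proof (rule less.hyps)
      have "{y. y \<le> x} \<subseteq> {y. y \<le> a}" "a \<notin> {y. y \<le> x}" "a \<in> {y. y \<le> a}"
        using that by (auto simp: less_le_not_le intro: order.trans)
      then show "card {y. y \<le> x} < card {x. x \<le> a}"
        by (intro psubset_card_mono) auto
      show "irr_below x \<subseteq> irr_below b" using less.prems that by (auto simp: irr_below_def)
    qed
    moreover have "c < a" "d < a" using cd by (auto simp: less_le)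
    ultimately show ?thesis using cd by simp
  qed
qed

lemma irr_below_inj: "irr_below a = irr_below b \<Longrightarrow> a = b"
  using irr_below_subset_imp_le by (intro order.antisym) auto

text \<open>The join of \<open>D\<close> does it. By primality an irreducible element below the join
  is below a member of \<open>D\<close>.\<close>

lemma irr_below_surj:
  assumes "D \<subseteq> ext_irreducibles" "D \<noteq> {}" "\<And>p q. q \<in> D \<Longrightarrow> p \<in> ext_irreducibles \<Longrightarrow> p \<le> q \<Longrightarrow> p \<in> D"
  obtains a where "irr_below a = D"
proof
  have "finite A \<Longrightarrow> A \<noteq> {} \<Longrightarrow> p \<in> ext_irreducibles \<Longrightarrow> p \<le> Sup_fin A \<longleftrightarrow> (\<exists>q\<in>A. p \<le> q)" for p :: 'a and A
    by (induction A rule: finite_ne_induct) (auto simp: ext_irreducible_prime)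
  from this[of D] show "irr_below (Sup_fin D) = D" using assms unfolding irr_below_def by auto
qed

lemma lookup_Abs_finite [simp]: "lookup (Abs_poly_mapping (f :: 'l::finite \<Rightarrow> nat)) = f"
  by simp

definition chi :: "'l::finite set \<Rightarrow> 'l \<Rightarrow>\<^sub>0 nat" where
  "chi D = Abs_poly_mapping (\<lambda>p. if p \<in> D then 1 else 0)"

lemma lookup_chi: "lookup (chi D) p = (if p \<in> D then 1 else 0)"
  by (simp add: chi_def)

text \<open>The toric map sends the variable of \<open>a\<close> to the product of the variables of
  all \<open>p \<le> a\<close> in \<open>ext_irreducibles\<close>; this is the exponent vector of
  the image of a monomial. The target reuses the variables of the source.\<close>

definition toric_exp :: "('l::{finite, distrib_lattice} \<Rightarrow>\<^sub>0 nat) \<Rightarrow> ('l \<Rightarrow>\<^sub>0 nat)" where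
  "toric_exp m = Abs_poly_mapping (\<lambda>p. if p \<in> ext_irreducibles then \<Sum>a\<in>{a. p \<le> a}. lookup m a else 0)"

lemma lookup_toric_exp:
  "lookup (toric_exp m) p = (if p \<in> ext_irreducibles then \<Sum>a\<in>{a. p \<le> a}. lookup m a else 0)"
  by (simp add: toric_exp_def)

lemma toric_exp_zero [simp]: "toric_exp 0 = 0"
  by (rule poly_mapping_eqI) (simp add: lookup_toric_exp)

lemma toric_exp_add: "toric_exp (m + n) = toric_exp m + toric_exp n"
  by (rule poly_mapping_eqI) (simp add: lookup_toric_exp lookup_add sum.distrib)

lemma toric_exp_single: "toric_exp (single a 1) = chi (irr_below a)"
  by (rule poly_mapping_eqI) (auto simp: lookup_toric_exp lookup_chi lookup_single irr_below_def when_def)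

lemma lookup_toric_exp_least: "lookup (toric_exp m) least = monom_deg m"
  for m :: "'l::{finite, distrib_lattice} \<Rightarrow>\<^sub>0 nat"
proof -
  have "{a :: 'l. least \<le> a} = UNIV" using least_le by auto
  then show ?thesis by (simp only: lookup_toric_exp monom_deg_eq least_in_ext_irreducibles if_True)
qed

definition toric :: "('l::{finite, distrib_lattice}, 'k::comm_ring_1) mpoly \<Rightarrow> ('l, 'k) mpoly" where
  "toric p = lin_ext (\<lambda>m. single (toric_exp m) 1) p"

lemma toric_mult: "toric (p * q) = toric p * toric q"
  unfolding toric_def by (rule lin_ext_mult) (simp add: toric_exp_add mult_single)

lemma toric_add: "toric (p + q) = toric p + toric q"
  and toric_diff: "toric (p - q) = toric p - toric q"
  and toric_zero: "toric 0 = 0"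
  and toric_sum: "toric (\<Sum>x\<in>A. f x) = (\<Sum>x\<in>A. toric (f x))"
  by (simp_all add: toric_def lin_ext_add lin_ext_diff lin_ext_sum)

lemma toric_single: "toric (single m c) = single (toric_exp m) c"
  by (simp add: toric_def lin_ext_single mult_single)

lemma toric_Var: "toric (Var a) = single (chi (irr_below a)) 1"
  unfolding Var_def toric_single toric_exp_single ..

text \<open>The set of irreducibles below a meet is the intersection, and by primality that below a
  join is the union.\<close>

lemma chi_inf_sup: "chi (irr_below (inf a b)) + chi (irr_below (sup a b)) = chi (irr_below a) + chi (irr_below b)"
  by (rule poly_mapping_eqI) (auto simp: lookup_add lookup_chi irr_below_def ext_irreducible_prime)

section \<open>The Hibi ideal is the kernel of the toric map\<close>

lemma ideal_set_hibi: "ideal_set hibi_ideal"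
  unfolding hibi_ideal_def by (rule ideal_set_ideal_generated)

lemma graded_set_hibi: "graded_set hibi_ideal"
  unfolding hibi_ideal_def
proof (rule graded_set_ideal_generated)
  fix b :: "('a, 'b) mpoly"
  assume "b \<in> {Var a * Var b - Var (inf a b) * Var (sup a b) | a b. \<not> a \<le> b \<and> \<not> b \<le> a}"
  then obtain x y where "b = Var x * Var y - Var (inf x y) * Var (sup x y)" by blast
  moreover have "homogeneous (1 + 1) (Var u * Var v :: ('a, 'b) mpoly)" for u v
    by (rule homogeneous_mult[OF homogeneous_Var homogeneous_Var])
  ultimately have "homogeneous (1 + 1) b" by (simp only: homogeneous_diff)
  then show "\<exists>d. homogeneous d b" ..
qed

lemma hibi_relation: "Var a * Var b - Var (inf a b) * Var (sup a b) \<in> hibi_ideal"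
proof (cases "a \<le> b \<or> b \<le> a")
  case True
  then have "Var a * Var b - Var (inf a b) * Var (sup a b) = (0 :: ('a, 'b) mpoly)"
    by (auto simp: inf_absorb1 inf_absorb2 sup_absorb1 sup_absorb2 mult.commute)
  then show ?thesis using ideal_set_zero[OF ideal_set_hibi] by simp
next
  case False
  then show ?thesis unfolding hibi_ideal_def by (intro subsetD[OF ideal_generated_superset]) blast
qed

lemma toric_hibi:
  assumes "p \<in> hibi_ideal" shows "toric p = 0"
  using assms unfolding hibi_ideal_def
proof (induction rule: ideal_generated_induct)
  case (step a b y)
  then obtain x z where "b = Var x * Var z - Var (inf x z) * Var (sup x z)" by blast
  then have "toric b = 0" by (simp add: toric_diff toric_mult toric_Var mult_single chi_inf_sup)
  then show ?case using step by (simp add: toric_add toric_mult)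
qed (simp add: toric_zero)

text \<open>Congruence of monomials modulo the Hibi ideal. The type argument fixes the field, which
  does not occur in the exponents.\<close>

definition hibi_cong :: "'k::field itself \<Rightarrow> ('l::{finite, distrib_lattice} \<Rightarrow>\<^sub>0 nat) \<Rightarrow> ('l \<Rightarrow>\<^sub>0 nat) \<Rightarrow> bool" where
  "hibi_cong _ m n \<longleftrightarrow> single m (1::'k) - single n 1 \<in> hibi_ideal"

lemma hibi_cong_refl: "hibi_cong K m m"
  by (simp add: hibi_cong_def ideal_set_zero[OF ideal_set_hibi])

lemma hibi_cong_trans: "hibi_cong K m n \<Longrightarrow> hibi_cong K n l \<Longrightarrow> hibi_cong K m l"
  unfolding hibi_cong_def using ideal_set_add[OF ideal_set_hibi] by fastforce

lemma hibi_cong_sym: "hibi_cong K m n \<Longrightarrow> hibi_cong K n m"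
  unfolding hibi_cong_def using ideal_set_uminus[OF ideal_set_hibi] by fastforce

lemma hibi_cong_add:
  assumes "hibi_cong (K :: 'k::field itself) m n" shows "hibi_cong K (t + m) (t + n)"
proof -
  have "single t (1::'k) * (single m 1 - single n 1) \<in> hibi_ideal"
    using assms ideal_set_mult[OF ideal_set_hibi] unfolding hibi_cong_def by blast
  then show ?thesis by (simp add: hibi_cong_def right_diff_distrib mult_single)
qed

lemma hibi_cong_inf_sup: "hibi_cong K (single a 1 + single b 1) (single (sup a b) 1 + single (inf a b) 1)"
  using hibi_relation[of a b] by (simp add: hibi_cong_def Var_def mult_single add.commute)

lemma hibi_cong_imp_toric_exp_eq:
  assumes "hibi_cong (K :: 'k::field itself) m n" shows "toric_exp m = toric_exp n"
proof -
  have "toric (single m (1::'k) - single n 1) = 0" using assms toric_hibi unfolding hibi_cong_def by blast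
  then have "single (toric_exp m) (1::'k) = single (toric_exp n) 1" by (simp add: toric_diff toric_single)
  then have "keys (single (toric_exp m) (1::'k)) = keys (single (toric_exp n) (1::'k))" by (rule arg_cong)
  then show ?thesis by simp
qed

text \<open>Straightening: the largest variable of a standard monomial is determined by the support of its
  image under the toric map.\<close>

lemma hibi_cong_split_top:
  assumes "m \<noteq> 0"
  shows "\<exists>T n. hibi_cong K m (single T 1 + n) \<and> (\<forall>p\<in>ext_irreducibles. p \<le> T \<longleftrightarrow> lookup (toric_exp m) p > 0)"
  using assms
proof (induction "monom_deg m" arbitrary: m rule: less_induct)
  case less
  then obtain a where a: "lookup m a > 0" by (metis gr0I lookup_zero poly_mapping_eqI)
  define m0 where "m0 = m - single a 1"
  have m: "m = single a 1 + m0" using single_add_diff[OF a] by (simp add: m0_def)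
  have pa: "lookup (toric_exp m) p > 0 \<longleftrightarrow> p \<le> a \<or> lookup (toric_exp m0) p > 0" if "p \<in> ext_irreducibles" for p
    using that unfolding m toric_exp_add toric_exp_single by (auto simp: lookup_add lookup_chi irr_below_def)
  show ?case
  proof (cases "m0 = 0")
    case True
    then show ?thesis using pa m hibi_cong_refl by (intro exI[of _ a] exI[of _ 0]) auto
  next
    case False
    have "monom_deg m0 < monom_deg m" by (simp add: m monom_deg_add)
    then obtain T n where T: "hibi_cong K m0 (single T 1 + n)" "\<forall>p\<in>ext_irreducibles. p \<le> T \<longleftrightarrow> lookup (toric_exp m0) p > 0"
      using less.hyps False by blast
    have "hibi_cong K m (single a 1 + (single T 1 + n))" unfolding m by (rule hibi_cong_add[OF T(1)])
    \<comment> \<open>Trading \<open>a\<close> and \<open>T\<close> for their join and meet makes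
      the join the new largest variable.\<close>
    moreover have "hibi_cong K (n + (single a 1 + single T 1)) (n + (single (sup a T) 1 + single (inf a T) 1))"
      by (rule hibi_cong_add[OF hibi_cong_inf_sup])
    ultimately have "hibi_cong K m (single (sup a T) 1 + (single (inf a T) 1 + n))"
      using hibi_cong_trans by (simp add: ac_simps) blast
    then show ?thesis using pa T(2) ext_irreducible_prime by blast
  qed
qed

text \<open>Both monomials split off the same largest variable, since it depends only on the common
  toric exponent; the cofactors again have equal exponents and smaller degree.\<close>

lemma toric_exp_eq_imp_hibi_cong:
  assumes "toric_exp m = toric_exp n" shows "hibi_cong K m n"
  using assms
proof (induction "monom_deg m" arbitrary: m n rule: less_induct)
  case less
  have deg: "monom_deg m = monom_deg n" using less.prems by (metis lookup_toric_exp_least)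
  show ?case
  proof (cases "m = 0")
    case True
    then have "n = 0" using deg monom_deg_eq_0_iff by (metis monom_deg_zero)
    then show ?thesis using True hibi_cong_refl by blast
  next
    case False
    then have "n \<noteq> 0" using deg monom_deg_eq_0_iff by (metis monom_deg_zero)
    then obtain T' n' where n': "hibi_cong K n (single T' 1 + n')"
      "\<forall>p\<in>ext_irreducibles. p \<le> T' \<longleftrightarrow> lookup (toric_exp n) p > 0"
      using hibi_cong_split_top by blast
    obtain T m' where m': "hibi_cong K m (single T 1 + m')"
      "\<forall>p\<in>ext_irreducibles. p \<le> T \<longleftrightarrow> lookup (toric_exp m) p > 0"
      using False hibi_cong_split_top by blast
    have "irr_below T = irr_below T'" using m'(2) n'(2) less.prems by (auto simp: irr_below_def)
    then have T: "T' = T" using irr_below_inj by metis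
    have e: "toric_exp m = toric_exp (single T 1) + toric_exp m'" "toric_exp n = toric_exp (single T 1) + toric_exp n'"
      using hibi_cong_imp_toric_exp_eq[OF m'(1)] hibi_cong_imp_toric_exp_eq[OF n'(1)] T by (simp_all only: toric_exp_add)
    then have e': "toric_exp m' = toric_exp n'" using less.prems by simp
    have "monom_deg m = Suc (monom_deg m')"
      using hibi_cong_imp_toric_exp_eq[OF m'(1)]
      by (metis lookup_toric_exp_least monom_deg_add monom_deg_single plus_1_eq_Suc)
    then have "hibi_cong K m' n'" using less.hyps e' by simp
    then have "hibi_cong K (single T 1 + m') (single T' 1 + n')" unfolding T by (rule hibi_cong_add)
    then show ?thesis using m'(1) n'(1) hibi_cong_trans hibi_cong_sym by blast
  qed
qed

lemma hibi_ideal_eq: "hibi_ideal = {p. toric p = 0}"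
proof
  show "hibi_ideal \<subseteq> {p. toric p = 0}" using toric_hibi by blast
  show "{p. toric p = 0} \<subseteq> (hibi_ideal :: ('a, 'b) mpoly set)"
  proof
    fix p :: "('a, 'b) mpoly" assume "p \<in> {p. toric p = 0}"
    then have p: "toric p = 0" by simp
    \<comment> \<open>One monomial is chosen for each exponent vector. The resulting linear map
      \<open>G\<close> satisfies \<open>q - G (toric q) \<in> hibi_ideal\<close> for every
      \<open>q\<close>.\<close>
    define r where "r f = (SOME m :: 'a \<Rightarrow>\<^sub>0 nat. toric_exp m = f)" for f
    have r: "toric_exp (r (toric_exp m)) = toric_exp m" for m :: "'a \<Rightarrow>\<^sub>0 nat" unfolding r_def by (rule someI) simp
    define G :: "('a, 'b) mpoly \<Rightarrow> ('a, 'b) mpoly" where "G q = lin_ext (\<lambda>f. single (r f) 1) q" for q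
    have "q - G (toric q) \<in> hibi_ideal" for q :: "('a, 'b) mpoly"
    proof (induction q rule: poly_mapping_single_induct)
      case zero
      then show ?case by (simp add: toric_zero G_def ideal_set_zero[OF ideal_set_hibi])
    next
      case (add m c q)
      have "hibi_cong TYPE('b) m (r (toric_exp m))" by (rule toric_exp_eq_imp_hibi_cong) (simp add: r)
      then have "single 0 c * (single m 1 - single (r (toric_exp m)) 1) \<in> hibi_ideal"
        using ideal_set_mult[OF ideal_set_hibi] unfolding hibi_cong_def by blast
      then have "single 0 c * (single m 1 - single (r (toric_exp m)) 1) + (q - G (toric q)) \<in> hibi_ideal"
        using add ideal_set_add[OF ideal_set_hibi] by blast
      also have "single 0 c * (single m 1 - single (r (toric_exp m)) 1) + (q - G (toric q)) 
          = (single m c + q) - G (toric (single m c + q))"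
        by (simp add: G_def toric_add toric_single lin_ext_add lin_ext_single right_diff_distrib mult_single)
      finally show ?case .
    qed
    from this[of p] show "p \<in> hibi_ideal" by (simp add: p G_def)
  qed
qed

text \<open>These are exactly the exponent vectors in the image of the toric map.\<close>

definition order_reversing :: "('l::{finite, distrib_lattice} \<Rightarrow>\<^sub>0 nat) \<Rightarrow> bool" where
  "order_reversing f \<longleftrightarrow> (\<forall>p. p \<notin> ext_irreducibles \<longrightarrow> lookup f p = 0) \<and>
    (\<forall>p\<in>ext_irreducibles. \<forall>q\<in>ext_irreducibles. p \<le> q \<longrightarrow> lookup f q \<le> lookup f p)"

lemma order_reversing_mono:
  "order_reversing f \<Longrightarrow> p \<in> ext_irreducibles \<Longrightarrow> q \<in> ext_irreducibles \<Longrightarrow> p \<le> q \<Longrightarrow> lookup f q \<le> lookup f p"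
  by (simp add: order_reversing_def)

lemma order_reversing_outside: "order_reversing f \<Longrightarrow> p \<notin> ext_irreducibles \<Longrightarrow> lookup f p = 0"
  by (simp add: order_reversing_def)

lemma order_reversing_toric_exp: "order_reversing (toric_exp m)"
  by (auto simp: order_reversing_def lookup_toric_exp intro!: sum_mono2)

lemma order_reversing_chi: "order_reversing (chi (irr_below a))"
  by (metis order_reversing_toric_exp toric_exp_single)

lemma order_reversing_add: "order_reversing f \<Longrightarrow> order_reversing g \<Longrightarrow> order_reversing (f + g)"
  by (auto simp: order_reversing_def lookup_add add_mono)

text \<open>The support is a down-set, hence of the form \<open>irr_below a\<close>; subtract its
  indicator and induct on the value at the bottom.\<close>

lemma order_reversing_imp_toric_exp:
  assumes "order_reversing f" shows "\<exists>m. toric_exp m = f"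
  using assms
proof (induction "lookup f least" arbitrary: f rule: less_induct)
  case less
  show ?case
  proof (cases "lookup f least = 0")
    case True
    have "lookup f p = 0" for p
    proof (cases "p \<in> ext_irreducibles")
      case True
      then have "lookup f p \<le> lookup f least"
        using order_reversing_mono[OF less.prems least_in_ext_irreducibles _ least_le] by blast
      then show ?thesis using \<open>lookup f least = 0\<close> by simp
    qed (use less.prems order_reversing_outside in blast)
    then have "f = 0" by (intro poly_mapping_eqI) simp
    then show ?thesis by (intro exI[of _ 0]) simp
  next
    case False
    let ?D = "{p \<in> ext_irreducibles. lookup f p \<noteq> 0}"
    have "least \<in> ?D" using False by simp
    have "p \<in> ?D" if "q \<in> ?D" "p \<in> ext_irreducibles" "p \<le> q" for p q
    proof -
      have "lookup f q \<le> lookup f p" using order_reversing_mono[OF less.prems, of p q] that by auto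
      then show ?thesis using that by auto
    qed
    then obtain a where a: "irr_below a = ?D"
      using irr_below_surj[of ?D] \<open>least \<in> ?D\<close> by blast
    let ?g = "f - chi ?D"
    have f: "f = chi ?D + ?g"
      by (rule poly_mapping_eqI) (auto simp: lookup_add lookup_minus lookup_chi)
    have "order_reversing ?g"
      using less.prems by (auto simp: order_reversing_def lookup_minus lookup_chi intro: diff_le_mono)
    moreover have "lookup ?g least < lookup f least" using False by (simp add: lookup_minus lookup_chi)
    ultimately obtain m where "toric_exp m = ?g" using less.hyps by blast
    then have "toric_exp (single a 1 + m) = f" unfolding toric_exp_add toric_exp_single a using f by simp
    then show ?thesis ..
  qed
qed

section \<open>A system of parameters\<close>

lemma least_in_irr_below [simp]: "least \<in> irr_below a"
  by (simp add: irr_below_def least_le)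

text \<open>Because the bottom element is counted, \<open>card (irr_below a)\<close> is the rank of
  \<open>a\<close> plus one, and the indices run from 1 to the number of elements of
  \<open>ext_irreducibles\<close>.\<close>

definition rank_form :: "nat \<Rightarrow> ('l::{finite, distrib_lattice}, 'k::comm_ring_1) mpoly" where
  "rank_form i = (\<Sum>a | card (irr_below a) = i. Var a)"

lemma homogeneous_rank_form: "homogeneous 1 (rank_form i)"
  unfolding rank_form_def by (rule homogeneous_sum) (rule homogeneous_Var)

lemma toric_rank_form: "toric (rank_form i) = (\<Sum>a | card (irr_below a) = i. single (chi (irr_below a)) 1)"
  by (simp add: rank_form_def toric_sum toric_Var)

text \<open>A natural labelling of the extended poset. \<open>N\<close> exceeds every label, so that
  in \<open>N * f - lab\<close> the value of \<open>f\<close> dominates the label.\<close>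

locale labelling =
  fixes lab :: "'l::{finite, distrib_lattice} \<Rightarrow> int" and N :: int
  assumes lab_nonneg: "0 \<le> lab p" and lab_less: "lab p < N"
    and lab_inj: "lab p = lab q \<Longrightarrow> p = q"
    and lab_mono: "p \<in> ext_irreducibles \<Longrightarrow> q \<in> ext_irreducibles \<Longrightarrow> p < q \<Longrightarrow> lab p < lab q"
begin

text \<open>Comparing the keys amounts to comparing the values of \<open>f\<close> and breaking ties by the labels.\<close>

definition key :: "('l \<Rightarrow>\<^sub>0 nat) \<Rightarrow> 'l \<Rightarrow> int" where
  "key f p = N * int (lookup f p) - lab p"

definition initial_segment :: "('l \<Rightarrow>\<^sub>0 nat) \<Rightarrow> 'l set \<Rightarrow> bool" where
  "initial_segment f A \<longleftrightarrow> A \<subseteq> ext_irreducibles \<and> (\<forall>p\<in>A. \<forall>q\<in>ext_irreducibles - A. key f q < key f p)"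

definition segment :: "('l \<Rightarrow>\<^sub>0 nat) \<Rightarrow> nat \<Rightarrow> 'l set" where
  "segment f i = (SOME A. initial_segment f A \<and> card A = i)"

definition raise :: "nat \<Rightarrow> ('l \<Rightarrow>\<^sub>0 nat) \<Rightarrow> ('l \<Rightarrow>\<^sub>0 nat)" where
  "raise i f = f + chi (segment f i)"

text \<open>\<open>f\<close> can be lowered by one on \<open>A\<close> with \<open>A\<close> still
  coming first in the sorting: lowering costs \<open>N\<close> in the key, hence the gap of more
  than \<open>N\<close>.\<close>

definition removable :: "('l \<Rightarrow>\<^sub>0 nat) \<Rightarrow> 'l set \<Rightarrow> bool" where
  "removable f A \<longleftrightarrow> (\<forall>p\<in>A. 0 < lookup f p) \<and> (\<forall>p\<in>A. \<forall>q\<in>ext_irreducibles - A. key f q + N < key f p)"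

lemma removableD:
  "removable f A \<Longrightarrow> p \<in> A \<Longrightarrow> q \<in> ext_irreducibles \<Longrightarrow> q \<notin> A \<Longrightarrow> key f q + N < key f p"
  by (simp add: removable_def)

lemma N_pos: "0 < N"
  using lab_nonneg[of undefined] lab_less[of undefined] by linarith

lemma N_cancel: "N * x < N * y + N \<Longrightarrow> x \<le> y"
  using N_pos by (metis distrib_left mult.right_neutral mult_less_cancel_left_pos zless_add1_eq order_le_less)

lemma key_less_imp_le: "key f q < key f p \<Longrightarrow> lookup f q \<le> lookup f p"
  using N_cancel[of "int (lookup f q)" "int (lookup f p)"] lab_less[of q] lab_nonneg[of p]
  by (simp add: key_def)

lemma key_gap_imp_less: "key f q + N < key f p \<Longrightarrow> lookup f q < lookup f p"
  using N_cancel[of "int (lookup f q) + 1" "int (lookup f p)"] lab_less[of q] lab_nonneg[of p]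
  by (simp add: key_def algebra_simps)

lemma key_inj: assumes "key f p = key f q" shows "p = q"
proof -
  have "lookup f p \<le> lookup f q" "lookup f q \<le> lookup f p"
    using N_cancel[of "int (lookup f q)" "int (lookup f p)"] lab_less[of q] lab_nonneg[of p]
      N_cancel[of "int (lookup f p)" "int (lookup f q)"] lab_less[of p] lab_nonneg[of q] assms
    by (simp_all add: key_def)
  then have "lab p = lab q" using assms by (simp add: key_def)
  then show ?thesis by (rule lab_inj)
qed

lemma key_add_chi: "key (f + chi A) p = key f p + (if p \<in> A then N else 0)"
  by (simp add: key_def lookup_add lookup_chi algebra_simps)

lemma initial_segment_chain:
  "initial_segment f A \<Longrightarrow> initial_segment f B \<Longrightarrow> A \<subseteq> B \<or> B \<subseteq> A"
  unfolding initial_segment_def by (meson DiffI less_asym subset_iff)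

lemma initial_segment_unique:
  "initial_segment f A \<Longrightarrow> initial_segment f B \<Longrightarrow> card A = card B \<Longrightarrow> A = B"
  using initial_segment_chain[of f A B] card_subset_eq[of B A] card_subset_eq[of A B] by auto

lemma initial_segment_exists:
  "i \<le> card (ext_irreducibles :: 'l set) \<Longrightarrow> \<exists>A. initial_segment f A \<and> card A = i"
proof (induction i)
  case 0
  show ?case by (intro exI[of _ "{}"]) (simp add: initial_segment_def)
next
  case (Suc i)
  then obtain A where A: "initial_segment f A" "card A = i" by auto
  let ?R = "ext_irreducibles - A"
  have "A \<noteq> ext_irreducibles" using A Suc.prems by auto
  then have R: "?R \<noteq> {}" "finite ?R" using A by (auto simp: initial_segment_def)
  then have "Max (key f ` ?R) \<in> key f ` ?R" by simp
  then obtain q where q: "q \<in> ?R" "key f q = Max (key f ` ?R)" by auto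
  have "key f q' < key f q" if "q' \<in> ?R" "q' \<noteq> q" for q'
  proof -
    have "key f q' \<le> key f q" unfolding q(2) using that R by (intro Max_ge) auto
    moreover have "key f q' \<noteq> key f q" using key_inj that by blast
    ultimately show ?thesis by linarith
  qed
  then have "initial_segment f (insert q A)" using A(1) q(1) by (auto simp: initial_segment_def)
  moreover have "card (insert q A) = Suc i" using A(2) q(1) by (simp add: finite_subset[OF _ finite])
  ultimately show ?case by blast
qed

lemma segment:
  assumes "i \<le> card (ext_irreducibles :: 'l set)"
  shows "initial_segment f (segment f i)" "card (segment f i) = i"
  using someI_ex[OF initial_segment_exists[OF assms, of f]] by (auto simp: segment_def)

lemma segment_eqI: "initial_segment f A \<Longrightarrow> segment f (card A) = A"
proof -
  assume A: "initial_segment f A"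
  then have "card A \<le> card (ext_irreducibles :: 'l set)" by (intro card_mono) (auto simp: initial_segment_def)
  then show ?thesis using segment initial_segment_unique A by metis
qed

text \<open>Initial segments are down-sets: a smaller element has at least the same value of
  \<open>f\<close> and a smaller label, hence a larger key.\<close>

lemma initial_segment_irr_below:
  assumes "order_reversing f" "initial_segment f A" "A \<noteq> {}"
  obtains a where "irr_below a = A"
proof (rule irr_below_surj)
  show "A \<subseteq> ext_irreducibles" "A \<noteq> {}" using assms by (auto simp: initial_segment_def)
  fix p q assume pq: "q \<in> A" "p \<in> ext_irreducibles" "p \<le> q"
  then have q: "q \<in> ext_irreducibles" using assms by (auto simp: initial_segment_def)
  show "p \<in> A"
  proof (rule ccontr)
    assume "p \<notin> A"
    then have "key f p < key f q" using assms(2) pq by (auto simp: initial_segment_def)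
    moreover have "p < q" using pq \<open>p \<notin> A\<close> by (auto simp: less_le)
    then have "lab p < lab q" using lab_mono pq q by blast
    moreover have "N * int (lookup f q) \<le> N * int (lookup f p)"
      using order_reversing_mono[OF assms(1) pq(2) q pq(3)] N_pos by simp
    ultimately show False by (simp add: key_def)
  qed
qed

lemma order_reversing_add_segment:
  assumes "order_reversing f" "initial_segment f A" shows "order_reversing (f + chi A)"
proof (cases "A = {}")
  case True
  then have "f + chi A = f" by (intro poly_mapping_eqI) (simp add: lookup_add lookup_chi)
  then show ?thesis using assms by simp
next
  case False
  then obtain a where "irr_below a = A" using initial_segment_irr_below assms by blast
  then show ?thesis using order_reversing_add[OF assms(1) order_reversing_chi] by metis
qed

text \<open>Raising an initial segment only widens the gap between it and the rest, so the sorting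
  of the poset is unchanged.\<close>

lemma initial_segment_add_chi:
  assumes "initial_segment f B"
  shows "initial_segment (f + chi B) A \<longleftrightarrow> initial_segment f A"
proof -
  have "key (f + chi B) q < key (f + chi B) p \<longleftrightarrow> key f q < key f p"
    if "p \<in> ext_irreducibles" "q \<in> ext_irreducibles" for p q
  proof -
    have "q \<in> B \<Longrightarrow> p \<notin> B \<Longrightarrow> key f p < key f q" "p \<in> B \<Longrightarrow> q \<notin> B \<Longrightarrow> key f q < key f p"
      using assms that by (auto simp: initial_segment_def)
    then show ?thesis using N_pos by (cases "p \<in> B"; cases "q \<in> B") (simp_all add: key_add_chi)
  qed
  then show ?thesis unfolding initial_segment_def by (meson DiffD1 subsetD)
qed

lemma segment_add_chi: "initial_segment f B \<Longrightarrow> segment (f + chi B) i = segment f i"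
  by (simp add: segment_def initial_segment_add_chi)

lemma removable_add_chi: "initial_segment g A \<Longrightarrow> removable (g + chi A) A"
  by (auto simp: removable_def key_add_chi initial_segment_def lookup_add lookup_chi)

lemma removable_diff_chi:
  assumes f: "order_reversing f" and A: "A \<subseteq> ext_irreducibles" "removable f A"
  shows "f = (f - chi A) + chi A" "order_reversing (f - chi A)" "initial_segment (f - chi A) A"
proof -
  show eq: "f = (f - chi A) + chi A"
    using A by (intro poly_mapping_eqI) (auto simp: removable_def lookup_add lookup_minus lookup_chi)
  have key_eq: "key f x = key (f - chi A) x + (if x \<in> A then N else 0)" for x
    using key_add_chi[of "f - chi A" A x] by (simp only: eq[symmetric])
  show "initial_segment (f - chi A) A"
    unfolding initial_segment_def
  proof (intro conjI ballI A)
    fix p q assume pq: "p \<in> A" "q \<in> ext_irreducibles - A"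
    then have "key f q + N < key f p" using removableD[OF A(2)] by blast
    then show "key (f - chi A) q < key (f - chi A) p" using key_eq[of p] key_eq[of q] pq by simp
  qed
  show "order_reversing (f - chi A)"
    unfolding order_reversing_def
  proof (intro conjI allI impI ballI)
    fix p :: 'l assume "p \<notin> ext_irreducibles"
    then show "lookup (f - chi A) p = 0" using order_reversing_outside[OF f] by (simp add: lookup_minus)
  next
    fix p q :: 'l assume pq: "p \<in> ext_irreducibles" "q \<in> ext_irreducibles" "p \<le> q"
    have le: "lookup f q \<le> lookup f p" using order_reversing_mono[OF f pq] .
    show "lookup (f - chi A) q \<le> lookup (f - chi A) p"
    proof (cases "p \<in> A \<and> q \<notin> A")
      case True
      then have "lookup f q < lookup f p" using A(2) pq by (intro key_gap_imp_less) (auto simp: removable_def)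
      then show ?thesis using True by (simp add: lookup_minus lookup_chi)
    next
      case False
      then show ?thesis using le by (auto simp: lookup_minus lookup_chi)
    qed
  qed
qed

text \<open>Only the gap at the end of \<open>A\<close> matters, and adding the indicator of a
  different initial segment \<open>B\<close> shifts both sides of that gap equally.\<close>

lemma removable_exchange:
  assumes A: "initial_segment f A" and B: "initial_segment f B" and "A \<noteq> B" and rem: "removable (f + chi B) A"
  shows "removable f A"
proof (cases "A \<subseteq> B")
  case True
  then obtain b where b: "b \<in> B" "b \<notin> A" using \<open>A \<noteq> B\<close> by blast
  then have bQ: "b \<in> ext_irreducibles" using B by (auto simp: initial_segment_def)
  \<comment> \<open>Both \<open>b\<close> and \<open>p\<close> lie in \<open>B\<close>, so their gap
    is the same in \<open>f\<close>. Elements outside \<open>B\<close> come after \<open>b\<close>,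
    which gives the gap for them.\<close>
  have gap: "key f b + N < key f p" if "p \<in> A" for p
    using removableD[OF rem that bQ b(2)] True that b by (auto simp: key_add_chi)
  have "key f q + N < key f p" if "p \<in> A" "q \<in> ext_irreducibles - A" for p q
  proof (cases "q \<in> B")
    case True
    then show ?thesis using removableD[OF rem, of p q] that \<open>A \<subseteq> B\<close> by (auto simp: key_add_chi)
  next
    case False
    then have "key f q < key f b" using B b that by (auto simp: initial_segment_def)
    then show ?thesis using gap[OF that(1)] by linarith
  qed
  moreover have "0 < lookup f p" if "p \<in> A" for p using key_gap_imp_less[OF gap[OF that]] by simp
  ultimately show ?thesis by (auto simp: removable_def)
next
  case False
  then have BA: "B \<subseteq> A" using initial_segment_chain[OF A B] by blast
  obtain a where a: "a \<in> A" "a \<notin> B" using False by blast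
  then have aQ: "a \<in> ext_irreducibles" using A by (auto simp: initial_segment_def)
  \<comment> \<open>Here \<open>a\<close> and everything outside \<open>A\<close> are untouched by
    \<open>B\<close>, so their gap is already there in \<open>f\<close>; the members of
    \<open>B\<close> come before \<open>a\<close>.\<close>
  have ka: "key f a < key f p" if "p \<in> B" for p using B that a aQ by (auto simp: initial_segment_def)
  have "0 < lookup (f + chi B) a" using rem a(1) by (simp add: removable_def)
  then have a0: "0 < lookup f a" using a by (simp add: lookup_add lookup_chi)
  have gap: "key f q + N < key f a" if "q \<in> ext_irreducibles - A" for q
  proof -
    have "q \<notin> B" using that BA by blast
    then show ?thesis using removableD[OF rem a(1), of q] a that by (simp add: key_add_chi)
  qed
  have "0 < lookup f p" if "p \<in> A" for p
  proof (cases "p \<in> B")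
    case True
    then have "lookup f a \<le> lookup f p" using ka key_less_imp_le by blast
    then show ?thesis using a0 by linarith
  next
    case False
    have "0 < lookup (f + chi B) p" using rem that by (simp add: removable_def)
    then show ?thesis using False by (simp add: lookup_add lookup_chi)
  qed
  moreover have "key f q + N < key f p" if "p \<in> A" "q \<in> ext_irreducibles - A" for p q
  proof (cases "p \<in> B")
    case True
    then show ?thesis using ka[OF True] gap[OF that(2)] by linarith
  next
    case False
    moreover have "q \<notin> B" using that BA by blast
    ultimately show ?thesis using removableD[OF rem, of p q] that by (simp add: key_add_chi)
  qed
  ultimately show ?thesis by (auto simp: removable_def)
qed


section \<open>The raising maps\<close>

lemma order_reversing_raise: "i \<le> card (ext_irreducibles :: 'l set) \<Longrightarrow> order_reversing f \<Longrightarrow> order_reversing (raise i f)"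
  unfolding raise_def by (intro order_reversing_add_segment segment)

lemma lookup_raise_least:
  assumes "i \<in> {1..card (ext_irreducibles :: 'l set)}" "order_reversing f" shows "lookup (raise i f) least = Suc (lookup f least)"
proof -
  have "segment f i \<noteq> {}" using segment(2)[of i f] assms(1) by auto
  then obtain a where "irr_below a = segment f i"
    using initial_segment_irr_below[OF assms(2) segment(1)] assms(1) by auto
  then have "least \<in> segment f i" using least_in_irr_below by metis
  then show ?thesis by (simp add: raise_def lookup_add lookup_chi)
qed

lemma segment_raise: "i \<le> card (ext_irreducibles :: 'l set) \<Longrightarrow> segment (raise i f) j = segment f j"
  unfolding raise_def by (rule segment_add_chi[OF segment(1)])

lemma raise_commute: "i \<le> card (ext_irreducibles :: 'l set) \<Longrightarrow> j \<le> card (ext_irreducibles :: 'l set) \<Longrightarrow> raise i (raise j f) = raise j (raise i f)"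
  unfolding raise_def[of i "raise j f"] raise_def[of j "raise i f"] 
  by (simp only: segment_raise) (simp add: raise_def ac_simps)

lemma raise_inj:
  assumes "i \<le> card (ext_irreducibles :: 'l set)" "raise i f = raise i g" shows "f = g"
proof -
  have "segment f i = segment g i" using segment_raise[OF assms(1)] assms(2) by metis
  then have "f + chi (segment g i) = g + chi (segment g i)" using assms(2) by (simp add: raise_def)
  then show ?thesis by simp
qed

text \<open>The maps \<open>raise i\<close> behave like multiplication by distinct variables.\<close>

lemma raise_eq_raise:
  assumes i: "i \<le> card (ext_irreducibles :: 'l set)" and j: "j \<le> card (ext_irreducibles :: 'l set)" and "i \<noteq> j" and f: "order_reversing f"
    and eq: "raise i f = raise j g"
  obtains h where "order_reversing h" "f = raise j h" "g = raise i h"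
proof -
  let ?A = "segment f j" and ?B = "segment f i"
  have "segment g j = ?A" using segment_raise[OF i, of f j] segment_raise[OF j, of g j] eq by simp
  then have eq': "f + chi ?B = g + chi ?A" and A: "initial_segment g ?A"
    using eq segment(1)[OF j, of g] by (simp_all add: raise_def)
  have "?A \<noteq> ?B" using segment(2)[OF i, of f] segment(2)[OF j, of f] \<open>i \<noteq> j\<close> by auto
  then have rem: "removable f ?A"
    using removable_exchange segment(1) i j removable_add_chi[OF A] eq' by metis
  have sub: "?A \<subseteq> ext_irreducibles" using A by (simp add: initial_segment_def)
  let ?h = "f - chi ?A"
  note h = removable_diff_chi[OF f sub rem]
  have "segment ?h j = ?A" using segment_eqI[OF h(3)] segment(2)[OF j] by simp
  then have fj: "f = raise j ?h" using h(1) by (simp add: raise_def)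
  then have "raise j g = raise j (raise i ?h)" using eq raise_commute[OF i j] by metis
  then have "g = raise i ?h" by (rule raise_inj[OF j])
  then show ?thesis using that[OF h(2) fj] by blast
qed

definition raised :: "nat \<Rightarrow> ('l \<Rightarrow>\<^sub>0 nat) set" where
  "raised n = {raise i g | i g. i \<in> {1..n} \<and> order_reversing g}"

text \<open>A removable set is an initial segment of the lowered function, so its cardinality is the
  index of the raising map.\<close>

lemma raised_iff_removable:
  assumes f: "order_reversing f"
  shows "f \<in> raised (card (ext_irreducibles :: 'l set)) \<longleftrightarrow> (\<exists>A. A \<noteq> {} \<and> A \<subseteq> ext_irreducibles \<and> removable f A)"
proof
  assume "f \<in> raised (card (ext_irreducibles :: 'l set))"
  then obtain i g where ig: "f = raise i g" "i \<in> {1..card (ext_irreducibles :: 'l set)}" by (auto simp: raised_def)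
  then have "initial_segment g (segment g i)" "card (segment g i) = i" using segment by auto
  then show "\<exists>A. A \<noteq> {} \<and> A \<subseteq> ext_irreducibles \<and> removable f A"
    using ig removable_add_chi by (intro exI[of _ "segment g i"]) (auto simp: raise_def initial_segment_def)
next
  assume "\<exists>A. A \<noteq> {} \<and> A \<subseteq> ext_irreducibles \<and> removable f A"
  then obtain A where A: "A \<noteq> {}" "A \<subseteq> ext_irreducibles" "removable f A" by blast
  note h = removable_diff_chi[OF f A(2,3)]
  have "f = raise (card A) (f - chi A)" using h(1) segment_eqI[OF h(3)] by (simp add: raise_def)
  moreover have "card A \<in> {1..card (ext_irreducibles :: 'l set)}"
    using A card_mono[OF _ A(2)] by (auto simp: Suc_le_eq card_gt_0_iff finite_subset)
  ultimately show "f \<in> raised (card (ext_irreducibles :: 'l set))" using h(2) unfolding raised_def by blast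
qed

text \<open>The weight makes \<open>raise i f\<close> the leading term of the product of the monomial \<open>f\<close> with the
  \<open>i\<close>-th parameter.\<close>

definition weight :: "('l \<Rightarrow>\<^sub>0 nat) \<Rightarrow> int" where
  "weight f = (\<Sum>(p, q)\<in>ext_irreducibles \<times> ext_irreducibles. min (key f p) (key f q))"

text \<open>Pairs inside \<open>A \<times> A\<close> gain exactly \<open>N\<close>. A pair with one
  member in \<open>A\<close> gains nothing precisely when its smaller key is outside
  \<open>A\<close>. So among the sets of a given size the initial segment is the unique one with the
  least gain.\<close>

lemma weight_add_chi:
  assumes A: "A \<subseteq> ext_irreducibles"
  shows "weight f + N * (int (card A))\<^sup>2 \<le> weight (f + chi A)"
    and "\<not> initial_segment f A \<Longrightarrow> weight f + N * (int (card A))\<^sup>2 < weight (f + chi A)"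
    and "initial_segment f A \<Longrightarrow> weight (f + chi A) = weight f + N * (int (card A))\<^sup>2"
proof -
  let ?Q = "ext_irreducibles \<times> ext_irreducibles :: ('l \<times> 'l) set"
  let ?l = "\<lambda>(p, q). min (key f p) (key f q) + (if (p, q) \<in> A \<times> A then N else 0)"
  let ?r = "\<lambda>(p, q). min (key (f + chi A) p) (key (f + chi A) q)"
  have "(\<Sum>x\<in>?Q. if x \<in> A \<times> A then N else 0) = (\<Sum>x\<in>A \<times> A. N)"
    using A by (intro sum.mono_neutral_cong_right) auto
  also have "\<dots> = N * (int (card A))\<^sup>2" by (simp add: card_cartesian_product power2_eq_square)
  finally have l: "sum ?l ?Q = weight f + N * (int (card A))\<^sup>2"
    by (simp add: weight_def sum.distrib split_def mem_Times_iff)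
  have r: "sum ?r ?Q = weight (f + chi A)" by (simp add: weight_def)
  have le: "?l x \<le> ?r x" for x using N_pos by (cases x) (auto simp: key_add_chi)
  show "weight f + N * (int (card A))\<^sup>2 \<le> weight (f + chi A)"
    unfolding l[symmetric] r[symmetric] by (rule sum_mono) (rule le)
  show "weight f + N * (int (card A))\<^sup>2 < weight (f + chi A)" if "\<not> initial_segment f A"
  proof -
    from that A obtain p q where pq: "p \<in> A" "q \<in> ext_irreducibles" "q \<notin> A" "\<not> key f q < key f p"
      by (auto simp: initial_segment_def)
    then have "key f q \<noteq> key f p" using key_inj by blast
    then have "?l (p, q) < ?r (p, q)" using pq N_pos by (auto simp: key_add_chi)
    moreover have "(p, q) \<in> ?Q" using pq A by auto
    ultimately show ?thesis
      unfolding l[symmetric] r[symmetric] using le by (intro sum_strict_mono_ex1 ballI bexI) (assumption | simp)+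
  qed
  show "weight (f + chi A) = weight f + N * (int (card A))\<^sup>2" if "initial_segment f A"
    unfolding l[symmetric] r[symmetric]
  proof (rule sum.cong)
    fix x assume "x \<in> ?Q"
    moreover have "key f q < key f p" if "p \<in> A" "q \<in> ext_irreducibles" "q \<notin> A" for p q
      using that \<open>initial_segment f A\<close> by (auto simp: initial_segment_def)
    ultimately show "?r x = ?l x" using N_pos by (cases x) (fastforce simp: key_add_chi min_def)
  qed simp
qed

text \<open>Leading terms are those of least weight; the other terms have the same degree and larger
  weight.\<close>

definition unitriangular :: "('l \<Rightarrow>\<^sub>0 nat) \<Rightarrow> ('l, 'k::field) mpoly \<Rightarrow> bool" where
  "unitriangular f v \<longleftrightarrow> lookup v f = 1 \<and>
    (\<forall>h\<in>keys v. order_reversing h \<and> lookup h least = lookup f least \<and> (h = f \<or> weight f < weight h))"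

lemma unitriangular_single: "order_reversing f \<Longrightarrow> unitriangular f (single f 1)"
  by (simp add: unitriangular_def)

lemma unitriangular_raise:
  fixes v :: "('l, 'k::field) mpoly"
  assumes v: "unitriangular g v" and g: "order_reversing g" and i: "i \<in> {1..card (ext_irreducibles :: 'l set)}"
  shows "unitriangular (raise i g) (toric (rank_form i) * v)"
proof -
  have i': "i \<le> card (ext_irreducibles :: 'l set)" using i by simp
  have sub: "irr_below a \<subseteq> ext_irreducibles" for a :: 'l by (auto simp: irr_below_def)
  have wr: "weight (raise i g) = weight g + N * (int i)\<^sup>2"
    using weight_add_chi(3)[OF _ segment(1)[OF i']] segment[OF i', of g] by (simp add: raise_def initial_segment_def)
  have "segment g i \<noteq> {}" using segment(2)[OF i', of g] i by auto
  then obtain a0 where a0: "irr_below a0 = segment g i"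
    using initial_segment_irr_below[OF g segment(1)[OF i']] by blast
  \<comment> \<open>Two inequalities add up: \<open>h\<close> weighs at least as much as
    \<open>g\<close>, and adding a set of \<open>i\<close> elements gains at least the gain of the
    initial segment. Both are equalities only for \<open>g\<close> and \<open>a0\<close>.\<close>
  have lead: "h' = raise i g \<and> h = g \<and> a = a0 \<or> weight (raise i g) < weight h'"
    if "card (irr_below a) = i" "h \<in> keys v" "h' = chi (irr_below a) + h" for a h h'
  proof (cases "h = g")
    case True
    show ?thesis
    proof (cases "initial_segment g (irr_below a)")
      case True
      then have s: "irr_below a = segment g i" using segment_eqI that(1) by metis
      then have "a = a0" using a0 irr_below_inj by metis
      then show ?thesis using s \<open>h = g\<close> that(3) by (simp add: raise_def add.commute)
    next
      case False
      then have "weight g + N * (int (card (irr_below a)))\<^sup>2 < weight (g + chi (irr_below a))"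
        by (rule weight_add_chi(2)[OF sub])
      then have "weight (raise i g) < weight h'" using that(1,3) \<open>h = g\<close> wr by (simp only: add.commute)
      then show ?thesis ..
    qed
  next
    case False
    then have "weight g < weight h" using v that(2) by (auto simp: unitriangular_def)
    moreover have "weight h + N * (int i)\<^sup>2 \<le> weight h'"
      using weight_add_chi(1)[OF sub, of h a] that by (simp add: add.commute)
    ultimately show ?thesis using wr by linarith
  qed
  have key_term: "\<exists>h. h \<in> keys v \<and> h' = chi (irr_below a) + h"
    if "h' \<in> keys (single (chi (irr_below a)) 1 * v)" for a h'
    using that keys_mult[of "single (chi (irr_below a)) 1" v] by (auto split: if_splits)
  have prod: "toric (rank_form i) * v = (\<Sum>a | card (irr_below a) = i. single (chi (irr_below a)) 1 * v)"
    by (simp add: toric_rank_form sum_distrib_right)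
  have "lookup (toric (rank_form i) * v) (raise i g) = 
      (\<Sum>a | card (irr_below a) = i. if a = a0 then 1 else 0)"
    unfolding prod lookup_sum
  proof (rule sum.cong)
    fix a :: 'l assume a: "a \<in> {a. card (irr_below a) = i}"
    show "lookup (single (chi (irr_below a)) 1 * v) (raise i g) = (if a = a0 then 1 else 0)"
    proof (cases "a = a0")
      case True
      then have "raise i g = chi (irr_below a) + g" using a0 by (simp add: raise_def add.commute)
      then show ?thesis using True v by (simp add: lookup_single_mult unitriangular_def)
    next
      case False
      have "raise i g \<notin> keys (single (chi (irr_below a)) 1 * v)"
      proof
        assume "raise i g \<in> keys (single (chi (irr_below a)) 1 * v)"
        then obtain h where "h \<in> keys v" "raise i g = chi (irr_below a) + h" using key_term by blast
        then show False using lead[of a h "raise i g"] a False by auto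
      qed
      then show ?thesis using False by (simp add: in_keys_iff)
    qed
  qed simp
  also have "\<dots> = 1" using a0 segment(2)[OF i', of g] by simp
  finally have "lookup (toric (rank_form i) * v) (raise i g) = 1" .
  moreover have "order_reversing h' \<and> lookup h' least = lookup (raise i g) least \<and>
      (h' = raise i g \<or> weight (raise i g) < weight h')" if h': "h' \<in> keys (toric (rank_form i) * v)" for h'
  proof -
    have "\<exists>a. card (irr_below a) = i \<and> h' \<in> keys (single (chi (irr_below a)) 1 * v)"
    proof (rule ccontr)
      assume "\<nexists>a. card (irr_below a) = i \<and> h' \<in> keys (single (chi (irr_below a)) 1 * v)"
      then have "lookup (toric (rank_form i) * v) h' = 0"
        unfolding prod lookup_sum by (intro sum.neutral) (auto simp: in_keys_iff)
      then show False using h' by (simp add: in_keys_iff)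
    qed
    then obtain a h where a: "card (irr_below a) = i" "h \<in> keys v" "h' = chi (irr_below a) + h" using key_term by blast
    have h: "order_reversing h" "lookup h least = lookup g least" using v a(2) by (auto simp: unitriangular_def)
    have "order_reversing h'" unfolding a(3) by (rule order_reversing_add[OF order_reversing_chi h(1)])
    moreover have "lookup h' least = lookup (raise i g) least"
      using lookup_raise_least[OF i g] h(2) a(3) by (simp add: lookup_add lookup_chi)
    ultimately show ?thesis using lead[OF a] by auto
  qed
  ultimately show ?thesis by (simp add: unitriangular_def)
qed

end

section \<open>A K-basis of the toric ring adapted to the parameters\<close>

context labelling
begin

definition unraise :: "('l \<Rightarrow>\<^sub>0 nat) \<Rightarrow> nat \<times> ('l \<Rightarrow>\<^sub>0 nat)" where
  "unraise f = (SOME x. fst x \<in> {1..card (ext_irreducibles :: 'l set)} \<and> order_reversing (snd x) \<and> f = raise (fst x) (snd x))"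

lemma unraise:
  assumes "f \<in> raised (card (ext_irreducibles :: 'l set))"
  shows "fst (unraise f) \<in> {1..card (ext_irreducibles :: 'l set)}" "order_reversing (snd (unraise f))"
    "raise (fst (unraise f)) (snd (unraise f)) = f"
proof -
  have "\<exists>x. fst x \<in> {1..card (ext_irreducibles :: 'l set)} \<and> order_reversing (snd x) \<and> f = raise (fst x) (snd x)"
    using assms by (auto simp: raised_def)
  from someI_ex[OF this] show "fst (unraise f) \<in> {1..card (ext_irreducibles :: 'l set)}" "order_reversing (snd (unraise f))"
    "raise (fst (unraise f)) (snd (unraise f)) = f" by (auto simp: unraise_def)
qed

text \<open>The first argument bounds the recursion depth; it is the value of \<open>f\<close> at the least element.\<close>

primrec psi_aux :: "nat \<Rightarrow> ('l \<Rightarrow>\<^sub>0 nat) \<Rightarrow> ('l, 'k::field) mpoly" where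
  "psi_aux 0 f = single f 1"
| "psi_aux (Suc n) f = (if f \<in> raised (card (ext_irreducibles :: 'l set))
     then toric (rank_form (fst (unraise f))) * psi_aux n (snd (unraise f)) else single f 1)"

text \<open>A product of parameters times a monomial that is not raised. The \<open>psi f\<close>
  form a basis in which multiplication by the i-th parameter acts on indices as
  \<open>raise i\<close>.\<close>

definition psi :: "('l \<Rightarrow>\<^sub>0 nat) \<Rightarrow> ('l, 'k::field) mpoly" where
  "psi f = psi_aux (lookup f least) f"

lemma psi_not_raised: "f \<notin> raised (card (ext_irreducibles :: 'l set)) \<Longrightarrow> psi f = (single f 1 :: ('l, 'k::field) mpoly)"
  unfolding psi_def by (cases "lookup f least") auto

lemma lookup_unraise_least:
  assumes "f \<in> raised (card (ext_irreducibles :: 'l set))"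
  shows "lookup f least = Suc (lookup (snd (unraise f)) least)"
  using lookup_raise_least unraise[OF assms] by metis

lemma psi_raised:
  assumes "f \<in> raised (card (ext_irreducibles :: 'l set))"
  shows "psi f = toric (rank_form (fst (unraise f))) * psi (snd (unraise f))"
  using assms lookup_unraise_least[OF assms] by (simp add: psi_def)

lemma raise_in_raised: "i \<in> {1..n} \<Longrightarrow> order_reversing f \<Longrightarrow> raise i f \<in> raised n"
  by (auto simp: raised_def)

text \<open>Shows that the choice made by \<open>unraise\<close> does not matter.\<close>

lemma psi_raise:
  assumes "i \<in> {1..card (ext_irreducibles :: 'l set)}" "order_reversing f"
  shows "psi (raise i f) = (toric (rank_form i) * psi f :: ('l, 'k::field) mpoly)"
  using assms
proof (induction "lookup f least" arbitrary: i f rule: less_induct)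
  case less
  define j g where "j = fst (unraise (raise i f))" and "g = snd (unraise (raise i f))"
  have R: "raise i f \<in> raised (card (ext_irreducibles :: 'l set))" using less.prems by (rule raise_in_raised)
  have jg: "j \<in> {1..card (ext_irreducibles :: 'l set)}" "order_reversing g" "raise j g = raise i f"
    using unraise[OF R] by (auto simp: j_def g_def)
  have psi: "psi (raise i f) = (toric (rank_form j) * psi g :: ('l, 'k) mpoly)"
    using psi_raised[OF R] by (simp add: j_def g_def)
  show ?case
  proof (cases "j = i")
    case True
    then have "g = f" using raise_inj[of i g f] jg less.prems by auto
    then show ?thesis using psi True by simp
  next
    case False
    \<comment> \<open>The chosen preimage uses another index \<open>j\<close>; both preimages are
      raised from a common \<open>h\<close> of smaller degree, where the induction hypothesis
      applies and the two parameters commute.\<close>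
    then obtain h where h: "order_reversing h" "f = raise j h" "g = raise i h"
      using raise_eq_raise[of i j f g] less.prems jg by auto
    have "lookup h least < lookup f least" using lookup_raise_least[OF jg(1) h(1)] h(2) by simp
    then have "psi g = (toric (rank_form i) * psi h :: ('l, 'k) mpoly)" "psi f = (toric (rank_form j) * psi h :: ('l, 'k) mpoly)"
      using less.hyps[of h] less.prems(1) jg(1) h by auto
    then show ?thesis using psi by (simp add: ac_simps)
  qed
qed

lemma unitriangular_psi:
  assumes "order_reversing f" shows "unitriangular f (psi f :: ('l, 'k::field) mpoly)"
  using assms
proof (induction "lookup f least" arbitrary: f rule: less_induct)
  case less
  show ?case
  proof (cases "f \<in> raised (card (ext_irreducibles :: 'l set))")
    case True
    have "lookup (snd (unraise f)) least < lookup f least" using lookup_unraise_least[OF True] by simp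
    then have "unitriangular (snd (unraise f)) (psi (snd (unraise f)) :: ('l, 'k) mpoly)"
      using less.hyps unraise(2)[OF True] by blast
    from unitriangular_raise[OF this unraise(2,1)[OF True]] show ?thesis
      unfolding psi_raised[OF True] unraise(3)[OF True] .
  next
    case False
    then show ?thesis using unitriangular_single[OF less.prems] by (simp add: psi_not_raised)
  qed
qed

definition Psi :: "('l, 'k::field) mpoly \<Rightarrow> ('l, 'k) mpoly" where
  "Psi u = lin_ext psi u"

lemma lookup_const_mult: "lookup (single 0 c * p) m = c * lookup (p :: ('l, 'k::field) mpoly) m"
  using lookup_single_mult[of 0 c p m] by simp

text \<open>At an index of least weight only its own basis element contributes, so its coefficient
  would have to vanish.\<close>

lemma Psi_eq_0_imp:
  assumes u: "\<And>f. f \<in> keys u \<Longrightarrow> order_reversing f" and "Psi u = (0 :: ('l, 'k::field) mpoly)"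
  shows "u = 0"
proof (rule ccontr)
  assume "u \<noteq> 0"
  then have ne: "keys u \<noteq> {}" by (metis ex_in_conv in_keys_iff lookup_zero poly_mapping_eqI)
  define f where "f = arg_min_on weight (keys u)"
  have f: "f \<in> keys u" using ne by (simp add: f_def arg_min_if_finite)
  have min: "\<not> weight g < weight f" if "g \<in> keys u" for g
    using arg_min_least[OF finite_keys ne that, of weight] by (simp add: f_def)
  have "lookup (Psi u) f = (\<Sum>g\<in>keys u. lookup u g * lookup (psi g :: ('l, 'k) mpoly) f)"
    by (simp add: Psi_def lin_ext_def lookup_sum lookup_const_mult)
  also have "\<dots> = (\<Sum>g\<in>keys u. if g = f then lookup u f else 0)"
  proof (rule sum.cong)
    fix g assume g: "g \<in> keys u"
    note T = unitriangular_psi[OF u[OF g], where 'k = 'k]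
    show "lookup u g * lookup (psi g :: ('l, 'k) mpoly) f = (if g = f then lookup u f else 0)"
    proof (cases "g = f")
      case False
      then have "f \<notin> keys (psi g :: ('l, 'k) mpoly)" using T min[OF g] by (auto simp: unitriangular_def)
      then show ?thesis using False by (simp add: in_keys_iff)
    qed (use T in \<open>simp add: unitriangular_def\<close>)
  qed simp
  also have "\<dots> = lookup u f" using f by simp
  finally show False using assms(2) f by (simp add: in_keys_iff)
qed

lemma finite_order_reversing: "finite {g :: 'l \<Rightarrow>\<^sub>0 nat. order_reversing g \<and> lookup g least = n}"
proof (rule finite_subset)
  show "{g :: 'l \<Rightarrow>\<^sub>0 nat. order_reversing g \<and> lookup g least = n} \<subseteq> {g. monom_deg g \<le> card (UNIV :: 'l set) * n}"
  proof safe
    fix g :: "'l \<Rightarrow>\<^sub>0 nat" assume g: "order_reversing g" "n = lookup g least"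
    have "lookup g p \<le> lookup g least" for p
      using order_reversing_mono[OF g(1) least_in_ext_irreducibles _ least_le, of p] order_reversing_outside[OF g(1), of p]
      by (cases "p \<in> ext_irreducibles") auto
    then have "monom_deg g \<le> (\<Sum>p\<in>(UNIV :: 'l set). lookup g least)"
      unfolding monom_deg_eq by (intro sum_mono)
    then show "monom_deg g \<le> card (UNIV :: 'l set) * lookup g least" by simp
  qed
qed (rule finite_bounded_monoms)

text \<open>Back substitution in a unitriangular system. In a fixed degree only finitely many
  functions are heavier, and their number decreases.\<close>

lemma Psi_surj_single:
  assumes "order_reversing f"
  shows "\<exists>u. (\<forall>g\<in>keys u. order_reversing g \<and> lookup g least = lookup f least) \<and> Psi u = (single f 1 :: ('l, 'k::field) mpoly)"
  using assms
proof (induction "card {g. order_reversing g \<and> lookup g least = lookup f least \<and> weight f < weight g}" arbitrary: f rule: less_induct)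
  case less
  let ?n = "lookup f least"
  let ?p = "psi f :: ('l, 'k) mpoly"
  let ?K = "keys ?p - {f}"
  have T: "unitriangular f ?p" using unitriangular_psi[OF less.prems] .
  have "\<exists>u. (\<forall>g\<in>keys u. order_reversing g \<and> lookup g least = ?n) \<and> Psi u = (single h 1 :: ('l, 'k) mpoly)" if h: "h \<in> ?K" for h
  proof -
    have h': "order_reversing h" "lookup h least = ?n" "weight f < weight h" using T h by (auto simp: unitriangular_def)
    let ?S = "\<lambda>f. {g. order_reversing g \<and> lookup g least = lookup f least \<and> weight f < weight g}"
    have "h \<in> ?S f" "h \<notin> ?S h" "?S h \<subseteq> ?S f" using h' by auto
    then have "?S h \<subset> ?S f" by blast
    then have "card (?S h) < card (?S f)"
      by (rule psubset_card_mono[rotated]) (rule finite_subset[OF _ finite_order_reversing[of ?n]], auto)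
    from less.hyps[OF this h'(1)] show ?thesis using h'(2) by simp
  qed
  then obtain U where U: "\<And>h. h \<in> ?K \<Longrightarrow> (\<forall>g\<in>keys (U h). order_reversing g \<and> lookup g least = ?n) \<and> Psi (U h) = (single h 1 :: ('l, 'k) mpoly)"
    by metis
  define u where "u = single f 1 - (\<Sum>h\<in>?K. single 0 (lookup ?p h) * U h)"
  have "Psi u = ?p - (\<Sum>h\<in>?K. single 0 (lookup ?p h) * Psi (U h))"
    by (simp add: u_def Psi_def lin_ext_diff lin_ext_single lin_ext_sum lin_ext_const_mult)
  also have "(\<Sum>h\<in>?K. single 0 (lookup ?p h) * Psi (U h)) = (\<Sum>h\<in>?K. single h (lookup ?p h))"
    using U by (intro sum.cong) (simp_all add: mult_single)
  finally have Psi_u: "Psi u = ?p - (\<Sum>h\<in>?K. single h (lookup ?p h))" .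
  have "(\<Sum>h\<in>keys ?p. single h (lookup ?p h)) = single f (lookup ?p f) + (\<Sum>h\<in>?K. single h (lookup ?p h))"
    using T by (intro sum.remove) (auto simp: unitriangular_def in_keys_iff)
  from trans[OF poly_mapping_sum_single this]
  have "?p - (\<Sum>h\<in>?K. single h (lookup ?p h)) = single f (lookup ?p f)"
    by (metis add_diff_cancel_right')
  then have "Psi u = single f 1" using Psi_u T by (simp add: unitriangular_def)
  moreover have "order_reversing g \<and> lookup g least = ?n" if "g \<in> keys u" for g
  proof (cases "g = f")
    case False
    have "lookup u g = - (\<Sum>h\<in>?K. lookup ?p h * lookup (U h) g)"
      using False by (simp add: u_def lookup_minus lookup_sum lookup_const_mult lookup_single)
    moreover have "lookup u g \<noteq> 0" using that by (simp add: in_keys_iff)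
    ultimately have "(\<Sum>h\<in>?K. lookup ?p h * lookup (U h) g) \<noteq> 0" by simp
    then obtain h where h: "h \<in> ?K" "lookup ?p h * lookup (U h) g \<noteq> 0" by (rule sum.not_neutral_contains_not_neutral)
    then have "g \<in> keys (U h)" by (simp add: in_keys_iff)
    then show ?thesis using U[OF h(1)] by blast
  qed (use less.prems in simp)
  ultimately show ?case by blast
qed

lemma Psi_surj:
  assumes "\<And>f. f \<in> keys v \<Longrightarrow> order_reversing f \<and> P (lookup f least)"
  shows "\<exists>u. (\<forall>g\<in>keys u. order_reversing g \<and> P (lookup g least)) \<and> Psi u = (v :: ('l, 'k::field) mpoly)"
  using assms
proof (induction v rule: poly_mapping_single_induct)
  case zero
  show ?case by (intro exI[of _ 0]) (simp add: Psi_def)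
next
  case (add m c p)
  have "m \<in> keys (single m c + p)" using add.hyps by (simp add: keys_single_add)
  then have m: "order_reversing m" "P (lookup m least)" using add.prems by auto
  have "f \<in> keys (single m c + p)" if "f \<in> keys p" for f
    using that add.hyps by (simp add: keys_single_add)
  then obtain u where u: "\<forall>g\<in>keys u. order_reversing g \<and> P (lookup g least)" "Psi u = p"
    using add.IH add.prems by blast
  obtain w where w: "\<forall>g\<in>keys w. order_reversing g \<and> lookup g least = lookup m least" "Psi w = (single m 1 :: ('l, 'k) mpoly)"
    using Psi_surj_single[OF m(1)] by blast
  have "Psi (single 0 c * w + u) = single m c + p"
    using u w by (simp add: Psi_def lin_ext_add lin_ext_const_mult mult_single)
  moreover have "order_reversing g \<and> P (lookup g least)" if "g \<in> keys (single 0 c * w + u)" for g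
  proof -
    have "g \<in> keys w \<or> g \<in> keys u" using that by (auto simp: in_keys_iff lookup_add lookup_const_mult)
    then show ?thesis using u w m by auto
  qed
  ultimately show ?case by blast
qed

definition Raise :: "nat \<Rightarrow> ('l, 'k::field) mpoly \<Rightarrow> ('l, 'k) mpoly" where
  "Raise i u = lin_ext (\<lambda>f. single (raise i f) 1) u"

lemma lookup_Raise:
  assumes "i \<le> card (ext_irreducibles :: 'l set)"
  shows "lookup (Raise i u) (raise i f) = lookup (u :: ('l, 'k::field) mpoly) f"
proof -
  have "raise i g = raise i f \<longleftrightarrow> g = f" for g using raise_inj[OF assms] by blast
  then have "lookup (Raise i u) (raise i f) = (\<Sum>g\<in>keys u. if g = f then lookup u f else 0)"
    unfolding Raise_def lin_ext_def lookup_sum by (intro sum.cong) (auto simp: lookup_const_mult lookup_single when_def)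
  then show ?thesis by (simp add: in_keys_iff)
qed

lemma keys_Raise: "keys (Raise i u) \<subseteq> raise i ` keys (u :: ('l, 'k::field) mpoly)"
  using keys_lin_ext[of "\<lambda>f. single (raise i f) 1" u] by (auto simp: Raise_def)

lemma Psi_Raise:
  assumes "i \<in> {1..card (ext_irreducibles :: 'l set)}" "\<And>f. f \<in> keys u \<Longrightarrow> order_reversing f"
  shows "Psi (Raise i u) = (toric (rank_form i) * Psi u :: ('l, 'k::field) mpoly)"
proof -
  have "Psi (Raise i u) = (\<Sum>f\<in>keys u. single 0 (lookup u f) * psi (raise i f))"
    unfolding Raise_def Psi_def lin_ext_def[of "\<lambda>f. single (raise i f) 1" u] lin_ext_sum
    by (simp add: lin_ext_const_mult lin_ext_single)
  also have "\<dots> = (\<Sum>f\<in>keys u. single 0 (lookup u f) * (toric (rank_form i) * psi f))"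
    using assms psi_raise[where 'k = 'k] by (intro sum.cong) simp_all
  also have "\<dots> = toric (rank_form i) * Psi u"
    by (simp add: Psi_def lin_ext_def sum_distrib_left ac_simps)
  finally show ?thesis .
qed

end

section \<open>Ideals of parameters in the adapted basis\<close>

lemma mem_adjoin_list_iff:
  fixes l :: "nat \<Rightarrow> 'r::comm_ring_1"
  shows "p \<in> adjoin_list (map l [1..<Suc n]) \<longleftrightarrow> (\<exists>c. p = (\<Sum>i\<in>{1..n}. l i * c i))"
proof (induction n arbitrary: p)
  case (Suc n)
  have "p \<in> adjoin_list (map l [1..<Suc (Suc n)]) \<longleftrightarrow> (\<exists>q. p - l (Suc n) * q \<in> adjoin_list (map l [1..<Suc n]))"
    using adjoin_list_snoc[of "map l [1..<Suc n]" "l (Suc n)"] by (simp add: adjoin_def)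
  also have "\<dots> \<longleftrightarrow> (\<exists>q c. p - l (Suc n) * q = (\<Sum>i\<in>{1..n}. l i * c i))" using Suc.IH by simp
  also have "\<dots> \<longleftrightarrow> (\<exists>c. p = (\<Sum>i\<in>{1..Suc n}. l i * c i))"
  proof
    assume "\<exists>q c. p - l (Suc n) * q = (\<Sum>i\<in>{1..n}. l i * c i)"
    then obtain q c where "p - l (Suc n) * q = (\<Sum>i\<in>{1..n}. l i * c i)" by blast
    then have "p = (\<Sum>i\<in>{1..Suc n}. l i * (c(Suc n := q)) i)" by (simp add: algebra_simps)
    then show "\<exists>c. p = (\<Sum>i\<in>{1..Suc n}. l i * c i)" by blast
  next
    assume "\<exists>c. p = (\<Sum>i\<in>{1..Suc n}. l i * c i)"
    then obtain c where "p = (\<Sum>i\<in>{1..Suc n}. l i * c i)" by blast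
    then have "p - l (Suc n) * c (Suc n) = (\<Sum>i\<in>{1..n}. l i * c i)" by simp
    then show "\<exists>q c. p - l (Suc n) * q = (\<Sum>i\<in>{1..n}. l i * c i)" by blast
  qed
  finally show ?case .
qed simp

lemma order_reversing_keys_toric: "f \<in> keys (toric p) \<Longrightarrow> order_reversing f"
  using keys_lin_ext[of "\<lambda>m. single (toric_exp m) 1" p] order_reversing_toric_exp by (auto simp: toric_def)

lemma toric_surj:
  assumes "\<And>f. f \<in> keys v \<Longrightarrow> order_reversing f"
  shows "\<exists>p. toric p = (v :: ('l::{finite, distrib_lattice}, 'k::field) mpoly)"
  using assms
proof (induction v rule: poly_mapping_single_induct)
  case zero
  show ?case using toric_zero by blast
next
  case (add m c p)
  have "m \<in> keys (single m c + p)" using add.hyps by (simp add: keys_single_add)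
  then obtain n where n: "toric_exp n = m" using order_reversing_imp_toric_exp add.prems by blast
  have "f \<in> keys (single m c + p)" if "f \<in> keys p" for f
    using that add.hyps by (simp add: keys_single_add)
  then obtain q where "toric q = p" using add.IH add.prems by blast
  then have "toric (single n c + q) = single m c + p" by (simp add: toric_add toric_single n)
  then show ?case by blast
qed

context labelling
begin

abbreviation (input) param_ideal :: "nat \<Rightarrow> ('l, 'k::field) mpoly set" where
  "param_ideal n \<equiv> adjoin_list (map rank_form [1..<Suc n])"

text \<open>In the adapted basis the ideal of the first \<open>n\<close> parameters is spanned by
  basis elements: those whose index is raised by one of the first \<open>n\<close> maps.\<close>

lemma mem_param_ideal_iff:
  assumes n: "n \<le> card (ext_irreducibles :: 'l set)"
  shows "p \<in> ideal_sum hibi_ideal (param_ideal n) \<longleftrightarrow> (\<exists>u. keys u \<subseteq> raised n \<and> toric p = (Psi u :: ('l, 'k::field) mpoly))"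
proof -
  have "p \<in> ideal_sum hibi_ideal (param_ideal n) \<longleftrightarrow> (\<exists>c. toric (p - (\<Sum>i\<in>{1..n}. rank_form i * c i)) = 0)"
    unfolding ideal_sum_def hibi_ideal_eq mem_Collect_eq Bex_def mem_adjoin_list_iff by blast
  also have "\<dots> \<longleftrightarrow> (\<exists>c. toric p = (\<Sum>i\<in>{1..n}. toric (rank_form i) * toric (c i)))"
    by (simp add: toric_diff toric_sum toric_mult)
  also have "\<dots> \<longleftrightarrow> (\<exists>u. keys u \<subseteq> raised n \<and> toric p = Psi u)"
  proof
    assume "\<exists>c. toric p = (\<Sum>i\<in>{1..n}. toric (rank_form i) * toric (c i))"
    then obtain c where c: "toric p = (\<Sum>i\<in>{1..n}. toric (rank_form i) * toric (c i))" by blast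
    have "\<exists>u. (\<forall>g\<in>keys u. order_reversing g \<and> True) \<and> Psi u = toric (c i)" for i
      using order_reversing_keys_toric by (intro Psi_surj) blast
    then obtain u where u: "\<And>i g. g \<in> keys (u i) \<Longrightarrow> order_reversing g" "\<And>i. Psi (u i) = toric (c i)" by metis
    have "toric p = (\<Sum>i\<in>{1..n}. Psi (Raise i (u i)))"
      unfolding c using u n by (intro sum.cong) (simp_all add: Psi_Raise)
    then have "toric p = Psi (\<Sum>i\<in>{1..n}. Raise i (u i))" by (simp add: Psi_def lin_ext_sum)
    moreover have "keys (\<Sum>i\<in>{1..n}. Raise i (u i)) \<subseteq> raised n"
    proof
      fix f assume "f \<in> keys (\<Sum>i\<in>{1..n}. Raise i (u i))"
      then obtain i where "i \<in> {1..n}" "f \<in> keys (Raise i (u i))"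
        using keys_sum[of "\<lambda>i. Raise i (u i)" "{1..n}"] by blast
      then show "f \<in> raised n" using keys_Raise[of i "u i"] u(1) raise_in_raised by blast
    qed
    ultimately show "\<exists>u. keys u \<subseteq> raised n \<and> toric p = Psi u" by blast
  next
    have *: "\<exists>c. Psi u = (\<Sum>i\<in>{1..n}. toric (rank_form i) * toric (c i))" if "keys u \<subseteq> raised n" for u :: "('l, 'k) mpoly"
      using that
    proof (induction u rule: poly_mapping_single_induct)
      case zero
      show ?case by (intro exI[of _ "\<lambda>_. 0"]) (simp add: Psi_def toric_zero)
    next
      case (add m b u)
      have "f \<in> keys (single m b + u)" if "f \<in> keys u" for f
        using that add.hyps by (simp add: keys_single_add)
      then obtain c where c: "Psi u = (\<Sum>i\<in>{1..n}. toric (rank_form i) * toric (c i))"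
        using add.IH add.prems by blast
      have "m \<in> keys (single m b + u)" using add.hyps by (simp add: keys_single_add)
      then obtain j g where jg: "m = raise j g" "j \<in> {1..n}" "order_reversing g" using add.prems by (auto simp: raised_def)
      have "order_reversing f" if "f \<in> keys (psi g :: ('l, 'k) mpoly)" for f
        using unitriangular_psi[OF jg(3), where 'k = 'k] that by (auto simp: unitriangular_def)
      then obtain q where q: "toric q = (psi g :: ('l, 'k) mpoly)" using toric_surj by blast
      have "Psi (single m b + u) = single 0 b * (toric (rank_form j) * psi g) + Psi u"
        using jg n psi_raise[of j g, where 'k = 'k] by (simp add: Psi_def lin_ext_add lin_ext_single)
      also have "\<dots> = (\<Sum>i\<in>{1..n}. if i = j then toric (rank_form i) * toric (single 0 b * q) else 0) + Psi u"
        using jg(2) by (simp add: toric_mult toric_single q ac_simps)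
      also have "\<dots> = (\<Sum>i\<in>{1..n}. toric (rank_form i) * toric (c i + (if i = j then single 0 b * q else 0)))"
        unfolding c sum.distrib[symmetric] by (intro sum.cong) (simp_all add: toric_add toric_zero algebra_simps)
      finally have e: "Psi (single m b + u) =
        (\<Sum>i\<in>{1..n}. toric (rank_form i) * toric (c i + (if i = j then single 0 b * q else 0)))" .
      show ?case by (intro exI[of _ "\<lambda>i. c i + (if i = j then single 0 b * q else 0)"]) (rule e)
    qed
    assume "\<exists>u. keys u \<subseteq> raised n \<and> toric p = Psi u"
    then obtain u where u: "keys u \<subseteq> raised n" "toric p = Psi u" by blast
    from *[OF u(1)] show "\<exists>c. toric p = (\<Sum>i\<in>{1..n}. toric (rank_form i) * toric (c i))"
      unfolding u(2) .
  qed
  finally show ?thesis .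
qed

lemma order_reversing_raised: "n \<le> card (ext_irreducibles :: 'l set) \<Longrightarrow> f \<in> raised n \<Longrightarrow> order_reversing f"
  using order_reversing_raise by (fastforce simp: raised_def)

lemma Psi_inj:
  assumes "\<And>f. f \<in> keys u \<Longrightarrow> order_reversing f" "\<And>f. f \<in> keys w \<Longrightarrow> order_reversing f"
    and "Psi u = (Psi w :: ('l, 'k::field) mpoly)"
  shows "u = w"
proof -
  have "order_reversing f" if "f \<in> keys (u - w)" for f
  proof -
    have "f \<in> keys u \<or> f \<in> keys w" using that by (auto simp: in_keys_iff lookup_minus)
    then show ?thesis using assms by blast
  qed
  moreover have "Psi (u - w) = 0" using assms(3) by (simp add: Psi_def lin_ext_diff)
  ultimately have "u - w = 0" using Psi_eq_0_imp by blast
  then show ?thesis by simp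
qed

text \<open>Multiplication raises each index \<open>f\<close> of \<open>p\<close>. If the raised
  index is also in the image of an earlier map \<open>raise j\<close>, then
  \<open>raise_eq_raise\<close> shows that \<open>f\<close> itself is.\<close>

theorem rank_form_regular:
  assumes n: "n < card (ext_irreducibles :: 'l set)"
    and p: "rank_form (Suc n) * p \<in> ideal_sum hibi_ideal (param_ideal n)"
  shows "p \<in> ideal_sum (hibi_ideal :: ('l, 'k::field) mpoly set) (param_ideal n)"
proof -
  let ?k = "Suc n"
  obtain w where w: "keys w \<subseteq> raised n" "toric (rank_form ?k * p) = (Psi w :: ('l, 'k) mpoly)"
    using p mem_param_ideal_iff n by (meson less_imp_le)
  have wr: "order_reversing f" if "f \<in> keys w" for f using order_reversing_raised[of n f] w(1) that n by (meson less_imp_le subsetD)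
  have "\<exists>u. (\<forall>g\<in>keys u. order_reversing g \<and> True) \<and> Psi u = toric p"
    using order_reversing_keys_toric by (intro Psi_surj) blast
  then obtain u where u: "\<And>g. g \<in> keys u \<Longrightarrow> order_reversing g" "Psi u = toric p" by blast
  have Psi_eq: "Psi (Raise ?k u) = Psi w" using w(2) u n by (simp add: toric_mult Psi_Raise)
  have Rr: "order_reversing f" if "f \<in> keys (Raise ?k u)" for f
    using that keys_Raise[of ?k u] u(1) order_reversing_raise[of ?k] n by auto
  have eq: "Raise ?k u = w" by (rule Psi_inj[OF Rr wr Psi_eq])
  have "f \<in> raised n" if f: "f \<in> keys u" for f
  proof -
    have "raise ?k f \<in> keys w" using f lookup_Raise[of ?k u f] n eq by (simp add: in_keys_iff)
    then obtain j g where "raise ?k f = raise j g" "j \<in> {1..n}" using w(1) by (auto simp: raised_def)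
    moreover from this obtain h where "order_reversing h" "f = raise j h"
      using raise_eq_raise[of ?k j f g] n u(1)[OF f] by auto
    ultimately show ?thesis using raise_in_raised by blast
  qed
  then show ?thesis using mem_param_ideal_iff[of n p] u(2) n by (metis less_imp_le subsetI)
qed

theorem mem_param_ideal_of_raised:
  assumes raised: "\<And>f. order_reversing f \<Longrightarrow> int (lookup f least) = j \<Longrightarrow> f \<in> raised (card (ext_irreducibles :: 'l set))"
    and p: "homogeneous j p"
  shows "p \<in> ideal_sum (hibi_ideal :: ('l, 'k::field) mpoly set) (param_ideal (card (ext_irreducibles :: 'l set)))"
proof -
  have "order_reversing f \<and> int (lookup f least) = j" if f: "f \<in> keys (toric p)" for f
  proof -
    obtain m where "m \<in> keys p" "f = toric_exp m"
      using f keys_lin_ext[of "\<lambda>m. single (toric_exp m) 1" p] by (auto simp: toric_def)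
    then show ?thesis using p order_reversing_toric_exp[of m] lookup_toric_exp_least[of m] by (auto simp: homogeneous_def)
  qed
  then obtain u where u: "\<forall>g\<in>keys u. order_reversing g \<and> int (lookup g least) = j" "Psi u = toric p"
    using Psi_surj[of "toric p" "\<lambda>n. int n = j"] by blast
  then have "keys u \<subseteq> raised (card (ext_irreducibles :: 'l set))" using raised by blast
  then show ?thesis using mem_param_ideal_iff[OF order_refl] u(2) by metis
qed

text \<open>For an index that is not raised the basis element is the monomial itself, and expansions
  in the basis are unique.\<close>

theorem not_mem_param_ideal:
  assumes f: "order_reversing f" "f \<notin> raised (card (ext_irreducibles :: 'l set))"
  shows "\<exists>p. homogeneous (int (lookup f least)) p \<and>
    p \<notin> ideal_sum (hibi_ideal :: ('l, 'k::field) mpoly set) (param_ideal (card (ext_irreducibles :: 'l set)))"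
proof -
  obtain m where m: "toric_exp m = f" using order_reversing_imp_toric_exp f(1) by blast
  let ?p = "single m 1 :: ('l, 'k) mpoly"
  have "homogeneous (int (lookup f least)) ?p"
    by (rule homogeneous_single) (simp add: lookup_toric_exp_least flip: m)
  moreover have "?p \<notin> ideal_sum hibi_ideal (param_ideal (card (ext_irreducibles :: 'l set)))"
  proof
    assume "?p \<in> ideal_sum hibi_ideal (param_ideal (card (ext_irreducibles :: 'l set)))"
    then obtain u where u: "keys u \<subseteq> raised (card (ext_irreducibles :: 'l set))" "toric ?p = Psi u"
      using mem_param_ideal_iff[OF order_refl] by blast
    have "Psi (single f 1) = (psi f :: ('l, 'k) mpoly)" by (simp add: Psi_def lin_ext_single)
    also have "\<dots> = toric ?p" using psi_not_raised[OF f(2), where 'k = 'k] by (simp add: toric_single m)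
    finally have "Psi (single f 1) = (Psi u :: ('l, 'k) mpoly)" using u(2) by (rule trans)
    moreover have "order_reversing g" if "g \<in> keys (single f (1::'k))" for g
      using that f(1) by simp
    moreover have "order_reversing g" if "g \<in> keys u" for g
      using order_reversing_raised[OF order_refl] u(1) that by blast
    ultimately have "single f 1 = u" by (rule Psi_inj[rotated 2])
    then show False using u(1) f(2) by auto
  qed
  ultimately show ?thesis by blast
qed

end

section \<open>The top degree\<close>

context labelling
begin

text \<open>Sort the poset by decreasing keys. Along this list \<open>f\<close> drops by at most one at each step, and only at
  descents of the labels. Since labels ascend along a chain, position plus value of \<open>f\<close> is strictly
  increasing along chains.\<close>

lemma not_raised_bound:
  assumes f: "order_reversing f" "f \<notin> raised (card (ext_irreducibles :: 'l set))"
    and C: "C \<subseteq> (ext_irreducibles :: 'l set)" "Complete_Partial_Order.chain (\<le>) C"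
  shows "card C + lookup f least \<le> card (ext_irreducibles :: 'l set)"
proof -
  let ?Q = "ext_irreducibles :: 'l set"
  have nrem: "\<not> removable f A" if "A \<subseteq> ?Q" "A \<noteq> {}" for A
    using raised_iff_removable[OF f(1)] f(2) that by blast
  define pos where "pos p = card {x \<in> ?Q. key f p < key f x}" for p
  define g where "g p = pos p + lookup f p" for p
  \<comment> \<open>From one element to the next \<open>g\<close> may stay the same, but then the
    label drops. Chaining these steps, a tie between two elements would force descending labels,
    whereas labels ascend along the poset.\<close>
  have step: "g p < g q \<or> g p = g q \<and> lab q < lab p"
    if p: "p \<in> ?Q" and q: "q \<in> ?Q" and less: "key f q < key f p"
      and next_key: "\<And>x. x \<in> ?Q \<Longrightarrow> key f x < key f p \<Longrightarrow> key f x \<le> key f q" for p q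
  proof -
    let ?A = "{x \<in> ?Q. key f p \<le> key f x}"
    have "key f p < key f x" if "x \<in> ?Q" "key f q < key f x" "x \<noteq> p" for x
    proof (rule ccontr)
      assume "\<not> key f p < key f x"
      then have "key f x < key f p" using key_inj[of f x p] that(3) by (auto simp: not_less le_less)
      then show False using next_key[OF that(1)] that(2) by simp
    qed
    then have "{x \<in> ?Q. key f q < key f x} = insert p {x \<in> ?Q. key f p < key f x}"
      using p less by auto
    then have pos: "pos q = Suc (pos p)" by (simp add: pos_def)
    have fle: "lookup f q \<le> lookup f p" using key_less_imp_le[OF less] .
    \<comment> \<open>This initial segment ends at \<open>p\<close>. That it cannot be removed
      leaves two reasons: \<open>f\<close> is already zero at its end, or the drop to the next
      element \<open>q\<close> is small.\<close>
    have "\<not> removable f ?A" using p by (intro nrem) auto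
    then consider x where "x \<in> ?A" "lookup f x = 0"
      | x y where "x \<in> ?A" "y \<in> ?Q - ?A" "\<not> key f y + N < key f x" by (auto simp: removable_def)
    then show ?thesis
    proof cases
      case 1
      then have "lookup f p = 0" using key_less_imp_le[of f p x] key_inj[of f p x] by (auto simp: le_less)
      then show ?thesis using fle pos by (simp add: g_def)
    next
      case 2
      then have "key f y \<le> key f q" using next_key by auto
      then have le: "key f p \<le> key f q + N" using 2 by auto
      then have "N * int (lookup f p) < N * (int (lookup f q) + 1) + N"
        using lab_less[of p] lab_nonneg[of q] by (simp add: key_def algebra_simps)
      then have "lookup f p \<le> Suc (lookup f q)" using N_cancel by force
      then consider "lookup f p = lookup f q" | "lookup f p = Suc (lookup f q)" using fle by linarith
      then show ?thesis
      proof cases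
        case 1
        then show ?thesis using pos by (simp add: g_def)
      next
        case 2
        then have "lab q \<le> lab p" using le by (simp add: key_def algebra_simps)
        moreover have "lab q \<noteq> lab p" using lab_inj less by blast
        ultimately show ?thesis using pos 2 by (simp add: g_def)
      qed
    qed
  qed
  have steps: "g p < g q \<or> g p = g q \<and> lab q < lab p"
    if "p \<in> ?Q" "q \<in> ?Q" "key f q < key f p" for p q
    using that
  proof (induction "card {x \<in> ?Q. key f q < key f x \<and> key f x < key f p}" arbitrary: p rule: less_induct)
    case less
    let ?B = "\<lambda>p. {x \<in> ?Q. key f q < key f x \<and> key f x < key f p}"
    show ?case
    proof (cases "?B p = {}")
      case True
      then show ?thesis using step[OF less.prems] by (metis (mono_tags, lifting) empty_iff mem_Collect_eq not_less)
    next
      case False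
      have "Max (key f ` ?B p) \<in> key f ` ?B p" using False by (intro Max_in) auto
      then obtain p' where p'B: "p' \<in> ?B p" "key f p' = Max (key f ` ?B p)" by auto
      have p': "p' \<in> ?B p" "\<And>x. x \<in> ?B p \<Longrightarrow> key f x \<le> key f p'"
        unfolding p'B(2) by (fact p'B(1), rule Max_ge) auto
      have "g p < g p' \<or> g p = g p' \<and> lab p' < lab p"
      proof (rule step)
        show "key f x \<le> key f p'" if "x \<in> ?Q" "key f x < key f p" for x
          using p'(2)[of x] p'(1) that by (cases "key f q < key f x") auto
      qed (use p'(1) less.prems in auto)
      moreover have "card (?B p') < card (?B p)" using p'(1) by (intro psubset_card_mono) auto
      then have "g p' < g q \<or> g p' = g q \<and> lab q < lab p'" using less.hyps[of p'] p'(1) less.prems by auto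
      ultimately show ?thesis by auto
    qed
  qed
  have key_lt: "key f q < key f p" if "p \<in> ?Q" "q \<in> ?Q" "p < q" for p q
  proof -
    have "N * int (lookup f q) \<le> N * int (lookup f p)"
      using order_reversing_mono[OF f(1) that(1,2)] that(3) N_pos by simp
    then show ?thesis using lab_mono[OF that] by (simp add: key_def)
  qed
  have mono: "g p < g q" if "p \<in> ?Q" "q \<in> ?Q" "p < q" for p q
    using steps[OF that(1,2) key_lt[OF that]] lab_mono[OF that] by auto
  have "inj_on g C"
  proof (rule inj_onI)
    fix p q assume pq: "p \<in> C" "q \<in> C" "g p = g q"
    then have "p \<le> q \<or> q \<le> p" using C(2) by (auto simp: Complete_Partial_Order.chain_def)
    then show "p = q" using mono[of p q] mono[of q p] pq C(1) by (auto simp: le_less)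
  qed
  then have card: "card C = card (g ` C)" by (simp add: card_image)
  have "finite ?Q" "?Q \<noteq> {}" using least_in_ext_irreducibles by (auto simp del: least_in_ext_irreducibles)
  then have "Min (key f ` ?Q) \<in> key f ` ?Q" by (intro Min_in) auto
  then obtain z where z: "z \<in> ?Q" "key f z = Min (key f ` ?Q)" by auto
  then have z_min: "key f z \<le> key f x" if "x \<in> ?Q" for x using that by simp
  \<comment> \<open>No element lies outside the whole poset, so the only obstruction is a zero of
    \<open>f\<close>; the last element \<open>z\<close> then also has value 0.\<close>
  have "\<not> removable f ?Q" using \<open>?Q \<noteq> {}\<close> by (intro nrem) auto
  then obtain x where "x \<in> ?Q" "lookup f x = 0" by (auto simp: removable_def)
  then have "lookup f z = 0" using key_less_imp_le[of f z x] key_inj[of f z x] z_min[of x] by (auto simp: le_less)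
  moreover have "pos z < card ?Q" unfolding pos_def using z(1) by (intro psubset_card_mono) auto
  ultimately have gz: "g z < card ?Q" by (simp add: g_def)
  have upper: "g p < card ?Q" if "p \<in> ?Q" for p
    using steps[OF that z(1)] z_min[OF that] key_inj[of f z p] gz by (cases "z = p") (auto simp: le_less)
  have lower: "lookup f least \<le> g p" if "p \<in> ?Q" for p
  proof (cases "p = least")
    case False
    then have "g least < g p" using mono[OF least_in_ext_irreducibles that] least_le[of p] by (simp add: le_less)
    then show ?thesis by (simp add: g_def)
  qed (simp add: g_def)
  have "g ` C \<subseteq> {lookup f least..<card ?Q}" using upper lower C(1) by auto
  then have "card C \<le> card ?Q - lookup f least" using card card_mono[of "{lookup f least..<card ?Q}" "g ` C"] by simp
  moreover have "lookup f least < card ?Q" using lower upper least_in_ext_irreducibles order_le_less_trans by blast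
  ultimately show ?thesis by linarith
qed

end

section \<open>Heights in the extended poset and the rank\<close>

definition height :: "'l::{finite, distrib_lattice} \<Rightarrow> nat" where
  "height p = Max (card ` {C. C \<subseteq> {x \<in> ext_irreducibles. x < p} \<and> Complete_Partial_Order.chain (\<le>) C})"

text \<open>This is \<open>poset_rank join_irreducibles + 1\<close>: the bottom element lengthens
  every maximal chain by one.\<close>

definition max_height :: "'l::{finite, distrib_lattice} itself \<Rightarrow> nat" where
  "max_height _ = Max (height ` (ext_irreducibles :: 'l set))"

lemma card_le_height:
  "C \<subseteq> {x \<in> ext_irreducibles. x < p} \<Longrightarrow> Complete_Partial_Order.chain (\<le>) C \<Longrightarrow> card C \<le> height p"
  unfolding height_def by (rule Max_ge) auto

lemma height_chain:
  obtains C where "C \<subseteq> {x \<in> ext_irreducibles. x < p}" "Complete_Partial_Order.chain (\<le>) C" "card C = height p"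
proof -
  have "{} \<in> {C. C \<subseteq> {x \<in> ext_irreducibles. x < p} \<and> Complete_Partial_Order.chain (\<le>) C}"
    by (simp add: Complete_Partial_Order.chain_def)
  then have "height p \<in> card ` {C. C \<subseteq> {x \<in> ext_irreducibles. x < p} \<and> Complete_Partial_Order.chain (\<le>) C}"
    unfolding height_def by (intro Max_in) auto
  then show ?thesis using that by auto
qed

lemma chain_insert_above:
  assumes "Complete_Partial_Order.chain (\<le>) C" "\<And>x. x \<in> C \<Longrightarrow> x \<le> (p :: 'l::order)"
  shows "Complete_Partial_Order.chain (\<le>) (insert p C)"
  using assms by (auto simp: Complete_Partial_Order.chain_def)

lemma height_less:
  fixes p :: "'l::{finite, distrib_lattice}"
  assumes "p \<in> ext_irreducibles" "p < q" shows "height p < height q"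
proof -
  obtain C where C: "C \<subseteq> {x \<in> ext_irreducibles. x < p}" "Complete_Partial_Order.chain (\<le>) C" "card C = height p"
    by (rule height_chain)
  have "insert p C \<subseteq> {x \<in> ext_irreducibles. x < q}" using C(1) assms by auto
  moreover have "Complete_Partial_Order.chain (\<le>) (insert p C)"
    using C(1,2) by (intro chain_insert_above) auto
  ultimately have "card (insert p C) \<le> height q" by (rule card_le_height)
  moreover have "p \<notin> C" using C(1) by auto
  ultimately show ?thesis using C(3) by (simp add: finite_subset[OF _ finite])
qed

lemma chain_greatest:
  fixes C :: "'l::{finite, order} set"
  assumes "Complete_Partial_Order.chain (\<le>) C" "C \<noteq> {}"
  obtains t where "t \<in> C" "\<And>x. x \<in> C \<Longrightarrow> x \<le> t"
proof -
  obtain t where "t \<in> C" "\<forall>x\<in>C. t \<le> x \<longrightarrow> t = x"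
    using finite_has_maximal[of C] assms(2) by auto
  then show ?thesis using assms(1) that[of t] by (auto simp: Complete_Partial_Order.chain_def)
qed

text \<open>Dropping the top of a longest chain below \<open>q\<close> lowers the height by exactly
  one, so no level is skipped.\<close>

lemma height_levels:
  fixes q :: "'l::{finite, distrib_lattice}"
  assumes "j < height q" shows "\<exists>x\<in>(ext_irreducibles :: 'l set). height x = j"
  using assms
proof (induction "height q" arbitrary: q rule: less_induct)
  case less
  obtain C where C: "C \<subseteq> {x \<in> ext_irreducibles. x < q}" "Complete_Partial_Order.chain (\<le>) C" "card C = height q"
    by (rule height_chain)
  then have "C \<noteq> {}" using less.prems by auto
  then obtain t where t: "t \<in> C" "\<And>x. x \<in> C \<Longrightarrow> x \<le> t" using chain_greatest C(2) by blast
  have tQ: "t \<in> ext_irreducibles" "t < q" using t(1) C(1) by auto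
  have "C - {t} \<subseteq> {x \<in> ext_irreducibles. x < t}" using C(1) t(2) by (auto simp: less_le)
  moreover have "Complete_Partial_Order.chain (\<le>) (C - {t})" using C(2) by (auto simp: Complete_Partial_Order.chain_def)
  ultimately have "card (C - {t}) \<le> height t" by (rule card_le_height)
  then have "height q \<le> Suc (height t)" using t(1) C(3) by (simp add: card_Diff_singleton_if)
  moreover have tq: "height t < height q" using height_less[OF tQ] .
  ultimately have "height q = Suc (height t)" by simp
  then show ?case using less.hyps[OF tq] tQ(1) less.prems by (cases "j = height t") auto
qed

lemma height_le_max_height: "p \<in> ext_irreducibles \<Longrightarrow> height p \<le> max_height TYPE('l)"
  for p :: "'l::{finite, distrib_lattice}"
  unfolding max_height_def by (rule Max_ge) auto

lemma max_height_attained: "\<exists>p\<in>(ext_irreducibles :: 'l::{finite, distrib_lattice} set). height p = max_height TYPE('l)"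
proof -
  have "max_height TYPE('l) \<in> height ` (ext_irreducibles :: 'l set)"
    unfolding max_height_def by (rule Max_in) (auto simp: ext_irreducibles_def)
  then show ?thesis by auto
qed

lemma height_least: "height (least :: 'l::{finite, distrib_lattice}) = 0"
proof -
  have "{x \<in> ext_irreducibles. x < (least :: 'l)} = {}" by (auto simp: less_le_not_le least_le)
  then show ?thesis by (metis card.empty height_chain subset_empty)
qed

lemma least_not_join_irreducible: "least \<notin> (join_irreducibles :: 'l::{finite, distrib_lattice} set)"
  by (simp add: join_irreducibles_def)

lemma card_ext_irreducibles:
  "card (ext_irreducibles :: 'l::{finite, distrib_lattice} set) = Suc (card (join_irreducibles :: 'l set))"
  unfolding ext_irreducibles_def by (rule card_insert_disjoint) (auto simp: least_not_join_irreducible)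

lemma card_chain_le_max_height:
  fixes C :: "'l::{finite, distrib_lattice} set"
  assumes "C \<subseteq> join_irreducibles" "Complete_Partial_Order.chain (\<le>) C"
  shows "card C \<le> max_height TYPE('l)"
proof -
  \<comment> \<open>Adding the bottom and dropping the top keeps the cardinality, and the rest lies
    strictly below the top.\<close>
  let ?C = "insert least C"
  have chain: "Complete_Partial_Order.chain (\<le>) ?C"
    using assms(2) least_le by (auto simp: Complete_Partial_Order.chain_def)
  then obtain t where t: "t \<in> ?C" "\<And>x. x \<in> ?C \<Longrightarrow> x \<le> t" using chain_greatest by blast
  have sub: "?C \<subseteq> ext_irreducibles" using assms(1) by (auto simp: ext_irreducibles_def)
  have "?C - {t} \<subseteq> {x \<in> ext_irreducibles. x < t}" using sub t(2) by (auto simp: less_le)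
  moreover have "Complete_Partial_Order.chain (\<le>) (?C - {t})" using chain by (auto simp: Complete_Partial_Order.chain_def)
  ultimately have "card (?C - {t}) \<le> height t" by (rule card_le_height)
  moreover have "card (?C - {t}) = card C"
    using t(1) assms(1) least_not_join_irreducible by (subst card_Diff_singleton) (auto simp: card_insert_if)
  moreover have "height t \<le> max_height TYPE('l)" using height_le_max_height t(1) sub by blast
  ultimately show ?thesis by simp
qed

lemma poset_rank_join_irreducibles:
  "poset_rank (join_irreducibles :: 'l::{finite, distrib_lattice} set) = int (max_height TYPE('l)) - 1"
  unfolding poset_rank_def
proof (rule Max_eqI)
  let ?S = "{int (card C) - 1 |C. C \<subseteq> (join_irreducibles :: 'l set) \<and> Complete_Partial_Order.chain (\<le>) C}"
  show "finite ?S" by simp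
  show "y \<le> int (max_height TYPE('l)) - 1" if "y \<in> ?S" for y
  proof -
    obtain C :: "'l set" where "C \<subseteq> join_irreducibles" "Complete_Partial_Order.chain (\<le>) C" "y = int (card C) - 1"
      using \<open>y \<in> ?S\<close> by blast
    then show ?thesis using card_chain_le_max_height[of C] by simp
  qed
  obtain p :: 'l where p: "p \<in> ext_irreducibles" "height p = max_height TYPE('l)" using max_height_attained by blast
  obtain C where C: "C \<subseteq> {x \<in> ext_irreducibles. x < p}" "Complete_Partial_Order.chain (\<le>) C" "card C = height p"
    by (rule height_chain)
  let ?C = "insert p C - {least}"
  have "Complete_Partial_Order.chain (\<le>) (insert p C)" using C(1,2) by (intro chain_insert_above) auto
  then have chain: "Complete_Partial_Order.chain (\<le>) ?C" by (auto simp: Complete_Partial_Order.chain_def)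
  have sub: "?C \<subseteq> join_irreducibles" using C(1) p(1) by (auto simp: ext_irreducibles_def)
  have "p \<notin> C" using C(1) by auto
  then have "card (insert p C) = Suc (height p)" using C(3) by simp
  then have "height p \<le> card ?C" using card_Diff_singleton_if[of "insert p C" least] by (simp split: if_splits)
  then have "card ?C = max_height TYPE('l)" using card_chain_le_max_height[OF sub chain] p(2) by simp
  then show "int (max_height TYPE('l)) - 1 \<in> ?S" using sub chain by (metis (mono_tags, lifting) mem_Collect_eq)
qed

text \<open>Labels that sort by height first make the next construction attain the bound.\<close>

lemma exists_height_labelling:
  "\<exists>lab N. labelling lab N \<and> (\<forall>p q :: 'l::{finite, distrib_lattice}. height p < height q \<longrightarrow> lab p < lab q)"
proof -
  obtain e :: "'l \<Rightarrow> nat" and n where e: "e ` UNIV = {i. i < n}" "inj e"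
    using finite_imp_inj_to_nat_seg[of "UNIV :: 'l set"] by auto
  have e_less: "e p < n" for p using e(1) by blast
  \<comment> \<open>Height is the leading digit in base \<open>n\<close>; \<open>e\<close>, with
    values below \<open>n\<close>, separates elements of equal height.\<close>
  define lab where "lab p = int (height p * n + e p)" for p
  have mono: "lab p < lab q" if "height p < height q" for p q
  proof -
    have "Suc (height p) * n \<le> height q * n" using that by (intro mult_le_mono1) simp
    then show ?thesis using e_less[of p] by (simp add: lab_def del: of_nat_add of_nat_mult)
  qed
  have "labelling lab (1 + Max (range lab))"
  proof
    show "0 \<le> lab p" for p by (simp add: lab_def)
    show "lab p < 1 + Max (range lab)" for p
    proof -
      have "lab p \<le> Max (range lab)" by (rule Max_ge) auto
      then show ?thesis by linarith
    qed
    show "p = q" if "lab p = lab q" for p q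
    proof -
      have "height p = height q" using that mono[of p q] mono[of q p] by (metis less_irrefl linorder_neqE_nat)
      then have "e p = e q" using that by (simp add: lab_def)
      then show ?thesis using e(2) by (auto dest: injD)
    qed
    show "lab p < lab q" if "p \<in> ext_irreducibles" "p < q" for p q using mono height_less that by blast
  qed
  then show ?thesis using mono by blast
qed

text \<open>List the poset by increasing height and, within a level, by decreasing label. Let
  \<open>f\<close> end with 0, drop by one at each step inside a level and stay constant between
  levels. Each of the \<open>max_height + 1\<close> levels contributes its size minus one to the
  value at the bottom.\<close>

lemma (in labelling) exists_not_raised:
  assumes lab_height: "\<And>p q. height p < height q \<Longrightarrow> lab p < lab q"
  shows "\<exists>f. order_reversing f \<and> f \<notin> raised (card (ext_irreducibles :: 'l set)) \<and>
    lookup f least + max_height TYPE('l) + 1 = card (ext_irreducibles :: 'l set)"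
proof -
  let ?Q = "ext_irreducibles :: 'l set"
  let ?M = "max_height TYPE('l)"
  define lev where "lev j = {x \<in> ?Q. height x = j}" for j
  have lev_ne: "lev j \<noteq> {}" if j: "j \<le> ?M" for j
  proof -
    obtain p :: 'l where p: "p \<in> ?Q" "height p = ?M" using max_height_attained by blast
    show ?thesis
    proof (cases "j = ?M")
      case True
      then show ?thesis using p by (auto simp: lev_def)
    next
      case False
      then show ?thesis using height_levels[of j p] p j by (auto simp: lev_def)
    qed
  qed
  define before where "before p = {x \<in> lev (height p). lab x < lab p}" for p
  define f where "f = Abs_poly_mapping (\<lambda>p. if p \<in> ?Q then
    (\<Sum>j\<in>{height p<..?M}. card (lev j) - 1) + card (before p) else 0)"
  have f: "lookup f p = (\<Sum>j\<in>{height p<..?M}. card (lev j) - 1) + card (before p)" if "p \<in> ?Q" for p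
    using that by (simp add: f_def)
  have before_le: "card (before p) \<le> card (lev (height p)) - 1" if "p \<in> ?Q" for p
  proof -
    have "before p \<subseteq> lev (height p) - {p}" by (auto simp: before_def)
    then have "card (before p) \<le> card (lev (height p) - {p})" by (intro card_mono) auto
    then show ?thesis using that by (simp add: lev_def)
  qed
  have OR: "order_reversing f"
    unfolding order_reversing_def
  proof (intro conjI allI impI ballI)
    show "lookup f p = 0" if "p \<notin> ?Q" for p using that by (simp add: f_def)
    fix p q assume pq: "p \<in> ?Q" "q \<in> ?Q" "p \<le> q"
    show "lookup f q \<le> lookup f p"
    proof (cases "p = q")
      case False
      then have h: "height p < height q" using pq height_less[of p q] by (simp add: less_le)
      have "lookup f q \<le> (\<Sum>j\<in>{height q<..?M}. card (lev j) - 1) + (card (lev (height q)) - 1)"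
        using f[OF pq(2)] before_le[OF pq(2)] by simp
      also have "\<dots> = (\<Sum>j\<in>insert (height q) {height q<..?M}. card (lev j) - 1)" by simp
      also have "\<dots> \<le> (\<Sum>j\<in>{height p<..?M}. card (lev j) - 1)"
        using h height_le_max_height[OF pq(2)] by (intro sum_mono2) auto
      finally show ?thesis using f[OF pq(1)] by simp
    qed simp
  qed
  have lev0: "lev 0 = {least}"
  proof -
    have "x = least" if "x \<in> ?Q" "height x = 0" for x
      using height_less[of least x] that least_le[of x] by (auto simp: le_less)
    then show ?thesis using height_least by (auto simp: lev_def)
  qed
  have "card ?Q = (\<Sum>j\<in>{..?M}. card (lev j))"
  proof -
    have "?Q = (\<Union>j\<in>{..?M}. lev j)" using height_le_max_height by (auto simp: lev_def)
    also have "card \<dots> = (\<Sum>j\<in>{..?M}. card (lev j))" by (rule card_UN_disjoint) (auto simp: lev_def)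
    finally show ?thesis .
  qed
  also have "{..?M} = insert 0 {0<..?M}" by auto
  also have "(\<Sum>j\<in>insert 0 {0<..?M}. card (lev j)) = 1 + (\<Sum>j\<in>{0<..?M}. card (lev j))" by (simp add: lev0)
  also have "(\<Sum>j\<in>{0<..?M}. card (lev j)) = (\<Sum>j\<in>{0<..?M}. (card (lev j) - 1) + 1)"
    using lev_ne by (intro sum.cong) (auto simp: card_gt_0_iff Suc_le_eq)
  also have "\<dots> = lookup f least + ?M"
  proof -
    have "before least = {}" by (simp add: before_def height_least lev0)
    then show ?thesis using f[OF least_in_ext_irreducibles] by (simp add: height_least sum_Suc)
  qed
  finally have deg: "lookup f least + ?M + 1 = card ?Q" by simp
  have "\<not> removable f A" if A: "A \<noteq> {}" "A \<subseteq> ?Q" for A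
  proof
    assume rem: "removable f A"
    \<comment> \<open>The last element \<open>p\<close> of a removable set leads to a contradiction:
      the element after \<open>p\<close> is outside the set, but every gap in the list is at most
      \<open>N\<close>, and at the end of the list \<open>f\<close> is zero.\<close>
    have "Min (key f ` A) \<in> key f ` A" using A by (intro Min_in) auto
    then obtain p where p: "p \<in> A" "key f p = Min (key f ` A)" by auto
    then have p_min: "key f p \<le> key f x" if "x \<in> A" for x using that by simp
    have pQ: "p \<in> ?Q" using p(1) A(2) by auto
    have no_q: "False" if "q \<in> ?Q" "key f q < key f p" "key f p \<le> key f q + N" for q
    proof -
      have "q \<notin> A" using p_min[of q] that by auto
      then show False using removableD[OF rem p(1) that(1)] that by auto
    qed
    have top: "\<exists>q\<in>B. \<forall>x\<in>B. lab x \<le> lab q" if "B \<noteq> {}" for B :: "'l set"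
    proof -
      have "Max (lab ` B) \<in> lab ` B" using that by (intro Max_in) auto
      then obtain q where "q \<in> B" "lab q = Max (lab ` B)" by auto
      then show ?thesis by (intro bexI[of _ q]) auto
    qed
    show False
    proof (cases "before p = {}")
      case False
      then obtain q where q: "q \<in> before p" "\<forall>x\<in>before p. lab x \<le> lab q" using top by blast
      then have qQ: "q \<in> ?Q" "height q = height p" "lab q < lab p" by (auto simp: before_def lev_def)
      have "before p = insert q (before q)"
        using q qQ lab_inj by (fastforce simp: before_def le_less)
      moreover have "q \<notin> before q" by (simp add: before_def)
      ultimately have "card (before p) = Suc (card (before q))" by simp
      then have "lookup f p = Suc (lookup f q)" using f[OF pQ] f[OF qQ(1)] qQ(2) by simp
      then show False
        using no_q[OF qQ(1)] qQ(3) lab_less[of p] lab_nonneg[of q] by (simp add: key_def algebra_simps)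
    next
      case True
      then have fp: "lookup f p = (\<Sum>j\<in>{height p<..?M}. card (lev j) - 1)" using f[OF pQ] by simp
      show False
      proof (cases "height p < ?M")
        case True
        \<comment> \<open>The element after \<open>p\<close> opens the next level: it has the
          largest label there and the same value of \<open>f\<close>. Its label is larger than that
          of \<open>p\<close>, so the gap is a difference of labels, below \<open>N\<close>.\<close>
        then obtain q where q: "q \<in> lev (Suc (height p))" "\<forall>x\<in>lev (Suc (height p)). lab x \<le> lab q"
          using top lev_ne[of "Suc (height p)"] by auto
        then have qQ: "q \<in> ?Q" "height q = Suc (height p)" by (auto simp: lev_def)
        have "before q = lev (height q) - {q}" using q qQ lab_inj by (fastforce simp: before_def le_less)
        then have "card (before q) = card (lev (height q)) - 1" using q(1) qQ by simp
        moreover have "{height p<..?M} = insert (height q) {height q<..?M}" using qQ True by auto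
        ultimately have "lookup f q = lookup f p" using fp f[OF qQ(1)] by simp
        moreover have "lab p < lab q" using lab_height qQ(2) by simp
        ultimately show False
          using no_q[OF qQ(1)] lab_less[of q] lab_nonneg[of p] by (simp add: key_def)
      next
        case False
        then have "lookup f p = 0" using fp by simp
        then show False using rem p(1) by (auto simp: removable_def)
      qed
    qed
  qed
  then have "f \<notin> raised (card ?Q)" using raised_iff_removable[OF OR] by blast
  then show ?thesis using OR deg by blast
qed

text \<open>The quotient by the parameters is an Artinian ring with this top degree.\<close>

definition top_degree :: "'l::{finite, distrib_lattice} itself \<Rightarrow> int" where
  "top_degree _ = int (card (join_irreducibles :: 'l set)) - poset_rank (join_irreducibles :: 'l set) - 1"

text \<open>Collects what is needed of the parameters, with the labelling eliminated.\<close>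

theorem rank_forms:
  fixes p :: "('l::{finite, distrib_lattice}, 'k::field) mpoly"
  defines "n \<equiv> card (ext_irreducibles :: 'l set)"
  defines "J m \<equiv> ideal_sum (hibi_ideal :: ('l, 'k) mpoly set) (adjoin_list (map rank_form [1..<Suc m]))"
  shows "m < n \<Longrightarrow> rank_form (Suc m) * p \<in> J m \<Longrightarrow> p \<in> J m"
    and "top_degree TYPE('l) < j \<Longrightarrow> homogeneous j p \<Longrightarrow> p \<in> J n"
    and "\<exists>p. homogeneous (top_degree TYPE('l)) p \<and> p \<notin> J n"
    and "0 \<le> top_degree TYPE('l)"
proof -
  obtain lab N where "labelling lab N" and lab_height: "\<And>p q :: 'l. height p < height q \<Longrightarrow> lab p < lab q"
    using exists_height_labelling by metis
  interpret labelling lab N by fact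
  have s: "top_degree TYPE('l) = int n - int (max_height TYPE('l)) - 1"
    by (simp add: top_degree_def n_def card_ext_irreducibles poset_rank_join_irreducibles)
  show "m < n \<Longrightarrow> rank_form (Suc m) * p \<in> J m \<Longrightarrow> p \<in> J m"
    unfolding n_def J_def by (rule rank_form_regular)
  obtain f where f: "order_reversing f" "f \<notin> raised n" "lookup f least + max_height TYPE('l) + 1 = n"
    using exists_not_raised[OF lab_height] unfolding n_def by blast
  then have fs: "int (lookup f least) = top_degree TYPE('l)" using s by simp
  then show "0 \<le> top_degree TYPE('l)" by simp
  show "\<exists>p. homogeneous (top_degree TYPE('l)) p \<and> p \<notin> J n"
    using not_mem_param_ideal[OF f(1) f(2)[unfolded n_def], where 'k = 'k] fs unfolding n_def J_def by simp
  assume j: "top_degree TYPE('l) < j" "homogeneous j p"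
  obtain q :: 'l where q: "q \<in> ext_irreducibles" "height q = max_height TYPE('l)" using max_height_attained by blast
  obtain C where C: "C \<subseteq> {x \<in> ext_irreducibles. x < q}" "Complete_Partial_Order.chain (\<le>) C" "card C = height q"
    by (rule height_chain)
  have "q \<notin> C" using C(1) by auto
  then have card: "card (insert q C) = Suc (max_height TYPE('l))" using C(3) q(2) by simp
  have chain: "Complete_Partial_Order.chain (\<le>) (insert q C)" "insert q C \<subseteq> ext_irreducibles"
    using C(1,2) q(1) by (auto intro!: chain_insert_above)
  have "f \<in> raised n" if "order_reversing f" "int (lookup f least) = j" for f
  proof (rule ccontr)
    assume "f \<notin> raised n"
    then have "Suc (max_height TYPE('l)) + lookup f least \<le> n"
      using not_raised_bound[OF that(1) _ chain(2,1)] card unfolding n_def by simp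
    then show False using j(1) s that(2) by simp
  qed
  then show "p \<in> J n" using mem_param_ideal_of_raised[OF _ j(2)] unfolding n_def J_def by blast
qed

section \<open>Linear changes of coordinates\<close>

text \<open>The K-algebra homomorphism sending the variable of \<open>a\<close> to
  \<open>g a\<close>. It carries regularity from variables over to other bases of the linear
  forms.\<close>

definition subst :: "('l::finite \<Rightarrow> ('l, 'k::field) mpoly) \<Rightarrow> ('l, 'k) mpoly \<Rightarrow> ('l, 'k) mpoly" where
  "subst g p = lin_ext (\<lambda>m. \<Prod>a\<in>UNIV. g a ^ lookup m a) p"

lemma subst_mult: "subst g (p * q) = subst g p * subst g q"
  unfolding subst_def by (rule lin_ext_mult) (simp add: lookup_add power_add prod.distrib)

lemma subst_add: "subst g (p + q) = subst g p + subst g q"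
  and subst_diff: "subst g (p - q) = subst g p - subst g q"
  and subst_sum: "subst g (\<Sum>x\<in>A. f x) = (\<Sum>x\<in>A. subst g (f x))"
  by (simp_all add: subst_def lin_ext_add lin_ext_diff lin_ext_sum)

lemma subst_const: "subst g (single 0 c) = single 0 c"
  by (simp add: subst_def lin_ext_single)

lemma subst_Var: "subst g (Var a) = g a"
proof -
  have "(\<Prod>b\<in>UNIV. g b ^ lookup (single a (1::nat)) b) = (\<Prod>b\<in>UNIV. if b = a then g a else 1)"
    by (rule prod.cong) (auto simp: lookup_single)
  then show ?thesis by (simp add: subst_def Var_def lin_ext_single)
qed

lemma single_split_Var:
  assumes "0 < lookup m a"
  shows "single m c = Var a * single (m - single a 1) (c :: 'k::comm_ring_1)"
  using single_add_diff[OF assms] by (simp add: Var_def mult_single)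

lemma ring_hom_eq_id:
  fixes F :: "('l::finite, 'k::field) mpoly \<Rightarrow> ('l, 'k) mpoly"
  assumes "\<And>p q. F (p + q) = F p + F q" "\<And>p q. F (p * q) = F p * F q"
    and "\<And>c. F (single 0 c) = single 0 c" "\<And>a. F (Var a) = Var a"
  shows "F p = p"
proof (induction p rule: poly_mapping_single_induct)
  case zero
  show ?case using assms(3)[of 0] by simp
next
  case (add m c p)
  have "F (single m c) = single m c"
  proof (induction "monom_deg m" arbitrary: m rule: less_induct)
    case less
    show ?case
    proof (cases "m = 0")
      case True
      then show ?thesis using assms(3) by simp
    next
      case False
      then obtain a where a: "0 < lookup m a" by (metis gr0I lookup_zero poly_mapping_eqI)
      have "monom_deg m = 1 + monom_deg (m - single a 1)" by (metis single_add_diff[OF a] monom_deg_add monom_deg_single)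
      then have "F (single (m - single a 1) c) = single (m - single a 1) c" using less.hyps by simp
      then show ?thesis unfolding single_split_Var[OF a] by (simp only: assms)
    qed
  qed
  then show ?case using add by (simp add: assms)
qed

lemma subst_subst_id:
  assumes "\<And>a. subst g (h a) = Var a" shows "subst g (subst h p) = p"
  by (rule ring_hom_eq_id) (simp_all add: subst_add subst_mult subst_const subst_Var assms)

lemma lookup_power_0:
  fixes p :: "('l::finite, 'k::field) mpoly"
  shows "lookup (p ^ n) 0 = lookup p 0 ^ n"
  by (induction n) (simp_all add: lookup_mult_0)

lemma lookup_prod_0:
  fixes f :: "'a \<Rightarrow> ('l::finite, 'k::field) mpoly"
  shows "lookup (\<Prod>x\<in>A. f x) 0 = (\<Prod>x\<in>A. lookup (f x) 0)"
  by (induction A rule: infinite_finite_induct) (simp_all add: lookup_mult_0)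

lemma lookup_subst_0:
  assumes "\<And>a. lookup (g a) 0 = 0" shows "lookup (subst g p) 0 = lookup p 0"
proof (induction p rule: poly_mapping_single_induct)
  case (add m c p)
  have "lookup (subst g (single m c)) 0 = lookup (single m c) 0"
  proof (cases "m = 0")
    case False
    then obtain a where "0 < lookup m a" by (metis gr0I lookup_zero poly_mapping_eqI)
    then have "(\<Prod>a\<in>UNIV. (0::'b) ^ lookup m a) = 0" by (intro prod_zero) auto
    then show ?thesis using False 
      by (simp add: subst_def lin_ext_single lookup_mult_0 lookup_prod_0 lookup_power_0 assms lookup_single)
  qed (simp add: subst_const)
  then show ?case using add by (simp add: subst_add lookup_add)
qed (simp add: subst_def)

text \<open>The monomial ideal generated by the variables in \<open>A\<close>, given by its
  monomials so that nonzerodivisors can be read off.\<close>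

definition var_ideal :: "'l set \<Rightarrow> ('l, 'k::zero) mpoly set" where
  "var_ideal A = {p. \<forall>m\<in>keys p. \<exists>a\<in>A. 0 < lookup m a}"

lemma var_ideal_add:
  assumes "p \<in> var_ideal A" "q \<in> var_ideal A" shows "p + q \<in> var_ideal A"
  using assms keys_add[of p q] by (auto simp: var_ideal_def)

lemma var_ideal_nzd:
  fixes q :: "('l::finite, 'k::field) mpoly"
  assumes "Var b * q \<in> var_ideal A" "b \<notin> A" shows "q \<in> var_ideal A"
  unfolding var_ideal_def
proof (intro CollectI ballI)
  fix m assume "m \<in> keys q"
  then have "single b 1 + m \<in> keys (Var b * q)" by (simp add: Var_def in_keys_iff lookup_single_mult)
  then obtain a where "a \<in> A" "0 < lookup (single b 1 + m) a" using assms(1) by (auto simp: var_ideal_def)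
  moreover from this have "a \<noteq> b" using assms(2) by blast
  ultimately show "\<exists>a\<in>A. 0 < lookup m a" by (auto simp: lookup_add lookup_single)
qed

lemma adjoin_var_ideal: "adjoin (Var b) (var_ideal A) = (var_ideal (insert b A) :: ('l::finite, 'k::field) mpoly set)"
proof
  show "adjoin (Var b) (var_ideal A) \<subseteq> (var_ideal (insert b A) :: ('l, 'k) mpoly set)"
  proof
    fix p :: "('l, 'k) mpoly" assume "p \<in> adjoin (Var b) (var_ideal A)"
    then obtain q where q: "p - Var b * q \<in> var_ideal A" by (auto simp: adjoin_def)
    have "Var b * q \<in> var_ideal (insert b A)"
      using keys_mult[of "Var b" q] by (auto simp: var_ideal_def Var_def lookup_add)
    moreover have "p - Var b * q \<in> var_ideal (insert b A)" using q by (auto simp: var_ideal_def)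
    ultimately show "p \<in> var_ideal (insert b A)" using var_ideal_add by fastforce
  qed
  show "(var_ideal (insert b A) :: ('l, 'k) mpoly set) \<subseteq> adjoin (Var b) (var_ideal A)"
  proof
    fix p :: "('l, 'k) mpoly" assume "p \<in> var_ideal (insert b A)"
    then show "p \<in> adjoin (Var b) (var_ideal A)"
    proof (induction p rule: poly_mapping_single_induct)
      case zero
      show ?case by (auto simp: adjoin_def var_ideal_def intro: exI[of _ 0])
    next
      case (add m c p)
      have "m \<in> keys (single m c + p)" using add.hyps by (simp add: keys_single_add)
      then obtain a where a: "a \<in> insert b A" "0 < lookup m a" using add.prems by (auto simp: var_ideal_def)
      have "f \<in> keys (single m c + p)" if "f \<in> keys p" for f
        using that add.hyps by (simp add: keys_single_add)
      then have "p \<in> var_ideal (insert b A)" using add.prems by (auto simp: var_ideal_def)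
      then obtain q where q: "p - Var b * q \<in> var_ideal A" using add.IH by (auto simp: adjoin_def)
      show ?case
      proof (cases "a = b")
        case True
        have "single m c + p - Var b * (single (m - single b 1) c + q) = p - Var b * q"
          using single_split_Var[of m b c] a True by (simp add: algebra_simps)
        then show ?thesis using q unfolding adjoin_def by (metis (mono_tags) mem_Collect_eq)
      next
        case False
        then have "single m c \<in> var_ideal A" using a by (auto simp: var_ideal_def)
        then have "single m c + (p - Var b * q) \<in> var_ideal A" using q by (rule var_ideal_add)
        then show ?thesis unfolding adjoin_def by (auto simp: algebra_simps)
      qed
    qed
  qed
qed

lemma adjoin_list_Var: "adjoin_list (map Var as) = (var_ideal (set as) :: ('l::finite, 'k::field) mpoly set)"
proof (induction as rule: rev_induct)
  case Nil
  have "p = 0" if "p \<in> var_ideal {}" for p :: "('l, 'k) mpoly"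
    using that by (intro poly_mapping_eqI) (auto simp: var_ideal_def in_keys_iff)
  then show ?case by (auto simp: var_ideal_def)
qed (simp add: adjoin_list_snoc adjoin_var_ideal)

lemma mem_adjoin_list_subst:
  assumes "\<And>p. subst h (subst g p) = p" "\<And>p. subst g (subst h p) = p"
  shows "p \<in> adjoin_list (map (subst g) ls) \<longleftrightarrow> subst h p \<in> adjoin_list ls"
proof (induction ls arbitrary: p rule: rev_induct)
  case Nil
  have "subst h 0 = 0" using subst_const[of h 0] by simp
  then show ?case using assms(2)[of p] subst_const[of g 0] by auto
next
  case (snoc l ls)
  have "p \<in> adjoin_list (map (subst g) (ls @ [l])) \<longleftrightarrow> (\<exists>q. subst h p - l * subst h q \<in> adjoin_list ls)"
    by (simp add: adjoin_list_snoc adjoin_def snoc.IH subst_diff subst_mult assms(1))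
  also have "\<dots> \<longleftrightarrow> (\<exists>q. subst h p - l * q \<in> adjoin_list ls)"
  proof
    assume "\<exists>q. subst h p - l * q \<in> adjoin_list ls"
    then obtain q where "subst h p - l * q \<in> adjoin_list ls" by blast
    then show "\<exists>q. subst h p - l * subst h q \<in> adjoin_list ls" by (intro exI[of _ "subst g q"]) (simp add: assms(1))
  qed blast
  also have "\<dots> \<longleftrightarrow> subst h p \<in> adjoin_list (ls @ [l])" by (simp add: adjoin_list_snoc adjoin_def)
  finally show ?case .
qed

text \<open>For any labelling, the initial segment with \<open>i\<close> elements of the zero
  function is a down-set.\<close>

lemma exists_rank:
  assumes "i \<in> {1..card (ext_irreducibles :: 'l::{finite, distrib_lattice} set)}"
  shows "\<exists>a :: 'l. card (irr_below a) = i"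
proof -
  obtain lab N where "labelling (lab :: 'l \<Rightarrow> int) N" using exists_height_labelling by blast
  then interpret labelling lab N .
  have 0: "order_reversing (0 :: 'l \<Rightarrow>\<^sub>0 nat)" by (simp add: order_reversing_def)
  have "i \<le> card (ext_irreducibles :: 'l set)" using assms by simp
  then obtain A where A: "initial_segment 0 A" "card A = i" using initial_segment_exists by blast
  moreover from this have "A \<noteq> {}" using assms by auto
  ultimately show ?thesis using initial_segment_irr_below[OF 0, of A] by metis
qed

text \<open>The rank forms together with the variables that are not the chosen representatives of their ranks
  form a basis of the linear forms.\<close>

lemma exists_linear_forms:
  "\<exists>ms :: ('l::{finite, distrib_lattice}, 'k::field) mpoly list.
    let fs = map rank_form [1..<Suc (card (ext_irreducibles :: 'l set))] @ ms in
      length fs = card (UNIV :: 'l set) \<and> (\<forall>l\<in>set fs. homogeneous 1 l) \<and> adjoin_list fs = max_ideal \<and>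
      (\<forall>xs l ys q. fs = xs @ l # ys \<longrightarrow> l * q \<in> adjoin_list xs \<longrightarrow> q \<in> adjoin_list xs)"
proof -
  let ?n = "card (ext_irreducibles :: 'l set)"
  define r :: "'l \<Rightarrow> nat" where "r a = card (irr_below a)" for a
  define c where "c i = (SOME a. r a = i)" for i
  have rc: "r (c i) = i" if "i \<in> {1..?n}" for i
    using someI_ex[of "\<lambda>a. r a = i"] exists_rank[OF that] by (auto simp: c_def r_def)
  have r_range: "r a \<in> {1..?n}" for a
  proof -
    have "irr_below a \<subseteq> ext_irreducibles" by (auto simp: irr_below_def)
    moreover have "irr_below a \<noteq> {}" using least_in_irr_below[of a] by blast
    ultimately show ?thesis unfolding r_def by (auto simp: Suc_le_eq card_gt_0_iff intro: card_mono)
  qed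
  \<comment> \<open>\<open>c i\<close> is the chosen representative of rank index \<open>i\<close>.
    \<open>g\<close> adds to it the other variables of that index and \<open>h\<close> subtracts
    them again; all other variables are fixed, so the two substitutions are inverse to each
    other.\<close>
  define g :: "'l \<Rightarrow> ('l, 'k) mpoly" where "g a = (if a = c (r a) then rank_form (r a) else Var a)" for a
  define h :: "'l \<Rightarrow> ('l, 'k) mpoly" where "h a = (if a = c (r a) then Var a - (rank_form (r a) - Var a) else Var a)" for a
  have rank_split: "subst f (rank_form i) = f (c i) + (rank_form i - Var (c i))"
    if i: "i \<in> {1..?n}" and f: "\<And>a. a \<noteq> c (r a) \<Longrightarrow> f a = Var a" for f :: "'l \<Rightarrow> ('l, 'k) mpoly" and i
  proof -
    have ci: "c i \<in> {a. r a = i}" using rc[OF i] by simp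
    have "subst f (rank_form i) = (\<Sum>a\<in>{a. r a = i}. f a)"
      by (simp add: rank_form_def subst_sum subst_Var r_def)
    also have "\<dots> = f (c i) + (\<Sum>a\<in>{a. r a = i} - {c i}. f a)" using ci by (intro sum.remove) auto
    also have "(\<Sum>a\<in>{a. r a = i} - {c i}. f a) = (\<Sum>a\<in>{a. r a = i} - {c i}. Var a)"
      using f by (intro sum.cong) auto
    also have "\<dots> = rank_form i - Var (c i)"
      using ci sum.remove[of "{a. r a = i}" "c i" "Var :: 'l \<Rightarrow> ('l, 'k) mpoly"] by (simp add: rank_form_def r_def)
    finally show ?thesis .
  qed
  have hg: "subst h (g a) = Var a" for a
  proof (cases "a = c (r a)")
    case True
    have "subst h (rank_form (r a)) = h a + (rank_form (r a) - Var a)"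
      using rank_split[OF r_range, of h a] True by (simp add: h_def)
    then show ?thesis using True by (simp add: g_def h_def)
  qed (simp add: g_def h_def subst_Var)
  have gh: "subst g (h a) = Var a" for a
  proof (cases "a = c (r a)")
    case True
    have "subst g (rank_form (r a)) = g a + (rank_form (r a) - Var a)"
      using rank_split[OF r_range, of g a] True by (simp add: g_def)
    moreover have h_eq: "h a = Var a - (rank_form (r a) - Var a)" and g_eq: "g a = rank_form (r a)"
      using True by (simp_all add: h_def g_def)
    ultimately show ?thesis unfolding h_eq subst_diff subst_Var by simp
  qed (simp add: g_def h_def subst_Var)
  have inv: "subst h (subst g p) = p" "subst g (subst h p) = p" for p
    using subst_subst_id[of h g p] subst_subst_id[of g h p] hg gh by auto
  obtain bs where bs: "set bs = {a. a \<noteq> c (r a)}" "distinct bs" using finite_distinct_list[of "{a. a \<noteq> c (r a)}"] by auto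
  \<comment> \<open>Representatives come first and in order of rank, so that \<open>g\<close> maps
    this list of all variables to the rank forms followed by the other variables.\<close>
  define as where "as = map c [1..<Suc ?n] @ bs"
  have "inj_on c {1..?n}" using rc by (metis inj_onI)
  then have dist: "distinct as"
    using bs rc by (auto simp: as_def distinct_map atLeastLessThanSuc_atLeastAtMost simp del: upt_Suc)
  have "a \<in> set as" for a
  proof (cases "a = c (r a)")
    case True
    then have "a \<in> c ` {1..?n}" using r_range by blast
    then show ?thesis by (auto simp: as_def atLeastLessThanSuc_atLeastAtMost simp del: upt_Suc)
  qed (simp add: as_def bs)
  then have set_as: "set as = UNIV" by auto
  have g_c: "g (c i) = rank_form i" if "i \<in> {1..?n}" for i using rc[OF that] by (simp add: g_def)
  have g_as: "map g as = map rank_form [1..<Suc ?n] @ map Var bs"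
    using g_c bs(1) by (auto simp: as_def g_def atLeastLessThanSuc_atLeastAtMost simp del: upt_Suc)
  have g_subst: "map g xs = map (subst g) (map Var xs)" for xs by (simp add: subst_Var)
  have mem: "p \<in> adjoin_list (map g xs) \<longleftrightarrow> subst h p \<in> var_ideal (set xs)" for p xs
    unfolding g_subst adjoin_list_Var[symmetric] by (rule mem_adjoin_list_subst[OF inv])
  have hom: "homogeneous 1 (g a)" for a by (simp add: g_def homogeneous_rank_form homogeneous_Var)
  have "homogeneous 1 (h a)" for a
    unfolding h_def by (simp only: homogeneous_diff homogeneous_rank_form homogeneous_Var simp_thms split: if_split)
  then have "lookup (h a) 0 = 0" for a by (rule lookup_zero_homogeneous) simp
  then have h0: "lookup (subst h p) 0 = lookup p 0" for p by (rule lookup_subst_0)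
  have var_UNIV: "q \<in> var_ideal UNIV \<longleftrightarrow> lookup q 0 = 0" for q :: "('l, 'k) mpoly"
  proof -
    have "(\<exists>a. 0 < lookup m a) \<longleftrightarrow> m \<noteq> 0" for m :: "'l \<Rightarrow>\<^sub>0 nat" by (metis gr0I lookup_zero not_less0 poly_mapping_eqI)
    then show ?thesis by (auto simp: var_ideal_def in_keys_iff)
  qed
  have max: "adjoin_list (map g as) = max_ideal"
    by (rule Set.set_eqI) (simp only: mem set_as var_UNIV h0 max_ideal_def mem_Collect_eq)
  have len: "length (map g as) = card (UNIV :: 'l set)" using distinct_card[OF dist] set_as by simp
  have nzd: "q \<in> adjoin_list xs" if eq: "map g as = xs @ l # ys" and q: "l * q \<in> adjoin_list xs" for xs l ys q
  proof -
    obtain us vs where us: "as = us @ vs" "map g us = xs" "map g vs = l # ys" using eq by (metis map_eq_append_conv)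
    then obtain b vs' where b: "vs = b # vs'" "g b = l" by auto
    have "b \<notin> set us" using dist us(1) b(1) by simp
    moreover have "Var b * subst h q \<in> var_ideal (set us)"
      using q mem[of "l * q" us] us(2) hg[of b] b(2) by (simp add: subst_mult)
    ultimately have "subst h q \<in> var_ideal (set us)" using var_ideal_nzd by blast
    then show ?thesis using mem[of q us] us(2) by simp
  qed
  have "\<forall>l\<in>set (map g as). homogeneous 1 l" using hom by simp
  then show ?thesis
    unfolding Let_def by (intro exI[of _ "map Var bs"], fold g_as) (intro conjI max len, assumption, blast intro: nzd)
qed

section \<open>The regularity of the Hibi ideal\<close>

text \<open>\<open>t\<close> is the number of linear forms left after the parameters; each of them
  moves the top class up by one homological degree.\<close>

theorem tor_hibi:
  fixes d D g
  assumes "graded_free_resolution UNIV (hibi_ideal :: ('l::{finite, distrib_lattice}, 'k::field) mpoly set) d D g"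
  defines "t \<equiv> card (UNIV :: 'l set) - card (ext_irreducibles :: 'l set)"
  shows "\<not> tor_cycles d D i j \<subseteq> tor_boundaries d D i j \<Longrightarrow> 0 \<le> j - int i \<and> j - int i \<le> top_degree TYPE('l)"
    and "\<not> tor_cycles d D t (int t + top_degree TYPE('l)) \<subseteq> tor_boundaries d D t (int t + top_degree TYPE('l))"
proof -
  interpret cyclic_resolution hibi_ideal d D g
    using assms(1) ideal_set_hibi graded_set_hibi by unfold_locales
  let ?n = "card (ext_irreducibles :: 'l set)"
  let ?ls = "map rank_form [1..<Suc ?n] :: ('l, 'k) mpoly list"
  obtain ms where len: "length (?ls @ ms) = card (UNIV :: 'l set)"
    and hom: "\<And>l. l \<in> set (?ls @ ms) \<Longrightarrow> homogeneous 1 l" and max: "adjoin_list (?ls @ ms) = max_ideal"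
    and nzd: "\<And>xs l ys q. ?ls @ ms = xs @ l # ys \<Longrightarrow> l * q \<in> adjoin_list xs \<Longrightarrow> q \<in> adjoin_list xs"
    using exists_linear_forms[where 'l = 'l and 'k = 'k] unfolding Let_def by metis
  have t: "t = length ms" using len by (simp add: t_def del: upt_Suc)
  have reg: "p \<in> ideal_sum hibi_ideal (adjoin_list xs)"
    if eq: "?ls = xs @ l # ys" and p: "l * p \<in> ideal_sum hibi_ideal (adjoin_list xs)" for xs l ys p
  proof -
    let ?m = "length xs"
    have m: "?m < ?n" using arg_cong[OF eq, of length] by (simp del: upt_Suc)
    have "xs = take ?m ?ls" "l = ?ls ! ?m" using eq by simp_all
    then have "xs = map rank_form [1..<Suc ?m]" "l = rank_form (Suc ?m)"
      using m by (simp_all add: take_map del: upt_Suc)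
    then show ?thesis using rank_forms(1)[OF m, of p] p by metis
  qed
  obtain p0 :: "('l, 'k) mpoly" where p0: "homogeneous (top_degree TYPE('l)) p0" "p0 \<notin> ideal_sum hibi_ideal (adjoin_list ?ls)"
    using rank_forms(3) by blast
  note tor = tor_cyclic[OF hom nzd reg max rank_forms(4) rank_forms(2) p0, folded t]
  show "\<not> tor_cycles d D i j \<subseteq> tor_boundaries d D i j \<Longrightarrow> 0 \<le> j - int i \<and> j - int i \<le> top_degree TYPE('l)"
    by (rule tor(1))
  show "\<not> tor_cycles d D t (int t + top_degree TYPE('l)) \<subseteq> tor_boundaries d D t (int t + top_degree TYPE('l))"
    by (rule tor(2))
qed

lemma hibi_subset_max_ideal: "hibi_ideal \<subseteq> max_ideal"
proof
  fix p :: "('a, 'b) mpoly" assume "p \<in> hibi_ideal"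
  then show "p \<in> max_ideal"
    unfolding hibi_ideal_def
  proof (induction rule: ideal_generated_induct)
    case (step a b y)
    have "lookup (Var x * Var z :: ('a, 'b) mpoly) 0 = 0" for x z
      by (simp add: lookup_mult_0 lookup_zero_homogeneous[OF homogeneous_Var])
    then have "lookup b 0 = 0" using step by (auto simp: lookup_minus)
    then show ?case using step by (simp add: max_ideal_def lookup_add lookup_mult_0)
  qed (simp add: max_ideal_def)
qed

text \<open>A resolution of an ideal becomes one of the residue class ring by appending the ring itself.\<close>

lemma shift_resolution:
  fixes I :: "('l::finite, 'k::field) mpoly set"
  assumes res: "graded_free_resolution I {0} d D g" and I: "ideal_set I" "I \<subseteq> max_ideal"
  defines "d' \<equiv> case_nat [0] d" and "D' \<equiv> case_nat (mat 1 (length (d 0)) (\<lambda>(r, c). g $ c)) D"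
  shows "graded_free_resolution UNIV I d' D' (vec 1 (\<lambda>_. 1))"
    and "tor_cycles d' D' (Suc i) j = tor_cycles d D i j"
    and "tor_boundaries d' D' (Suc i) j = tor_boundaries d D i j"
proof -
  have g: "g \<in> carrier_vec (length (d 0))" "\<And>k. k < length (d 0) \<Longrightarrow> g $ k \<in> I \<and> homogeneous (d 0 ! k) (g $ k)"
    and D: "\<And>i. D i \<in> carrier_mat (length (d i)) (length (d (Suc i)))"
      "\<And>i r c. r < length (d i) \<Longrightarrow> c < length (d (Suc i)) \<Longrightarrow> homogeneous (d (Suc i) ! c - d i ! r) (D i $$ (r, c))"
    and surj: "\<And>f. f \<in> I \<Longrightarrow> \<exists>v\<in>carrier_vec (length (d 0)). f - g \<bullet> v \<in> {0}"
    and ker0: "{v \<in> carrier_vec (length (d 0)). g \<bullet> v \<in> {0}} = (\<lambda>w. D 0 *\<^sub>v w) ` carrier_vec (length (d 1))"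
    and ker: "\<And>i. {v \<in> carrier_vec (length (d (Suc i))). D i *\<^sub>v v = 0\<^sub>v (length (d i))}
       = (\<lambda>w. D (Suc i) *\<^sub>v w) ` carrier_vec (length (d (Suc (Suc i))))"
    using res unfolding graded_free_resolution_def by simp_all
  let ?G = "mat 1 (length (d 0)) (\<lambda>(r, c). g $ c)"
  have row: "row ?G 0 = g" using g(1) by (intro eq_vecI) auto
  have G: "?G *\<^sub>v v = vec 1 (\<lambda>_. g \<bullet> v)" for v
    using row by (intro eq_vecI) (auto simp: index_mult_mat_vec)
  have gI: "g \<bullet> v \<in> I" if "v \<in> carrier_vec (length (d 0))" for v
    using that g(2) unfolding scalar_prod_def by (intro ideal_set_sum ideal_set_mult2 I) auto
  have one: "vec 1 (\<lambda>_. 1) \<bullet> v = v $ 0" if "v \<in> carrier_vec 1" for v :: "('l, 'k) mpoly vec"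
    using that by (simp add: scalar_prod_def)
  show "graded_free_resolution UNIV I d' D' (vec 1 (\<lambda>_. 1))"
    unfolding graded_free_resolution_def
  proof (intro conjI allI impI ballI)
    show "vec 1 (\<lambda>_. 1) \<in> carrier_vec (length (d' 0))" by (simp add: d'_def)
    show "homogeneous (d' 0 ! k) (vec 1 (\<lambda>_. 1) $ k)" if "k < length (d' 0)" for k using that by (simp add: d'_def)
    show "D' i \<in> carrier_mat (length (d' i)) (length (d' (Suc i)))" for i
      using D(1) by (cases i) (simp_all add: d'_def D'_def)
    show "homogeneous (d' (Suc i) ! c - d' i ! r) (D' i $$ (r, c))"
      if "r < length (d' i)" "c < length (d' (Suc i))" for i r c
      using that D(2) g(2) by (cases i) (simp_all add: d'_def D'_def)
    show "\<exists>v\<in>carrier_vec (length (d' 0)). f - vec 1 (\<lambda>_. 1) \<bullet> v \<in> I" for f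
    proof
      have "vec 1 (\<lambda>_. 1) \<bullet> vec 1 (\<lambda>_. f) = f" by (simp add: scalar_prod_def)
      then show "f - vec 1 (\<lambda>_. 1) \<bullet> vec 1 (\<lambda>_. f) \<in> I" using ideal_set_zero[OF I(1)] by (simp only: diff_self)
      show "vec 1 (\<lambda>_. f) \<in> carrier_vec (length (d' 0))" by (simp add: d'_def)
    qed
    show "{v \<in> carrier_vec (length (d' 0)). vec 1 (\<lambda>_. 1) \<bullet> v \<in> I} = (\<lambda>w. D' 0 *\<^sub>v w) ` carrier_vec (length (d' 1))"
    proof (intro Set.set_eqI iffI)
      fix v assume "v \<in> {v \<in> carrier_vec (length (d' 0)). vec 1 (\<lambda>_. 1) \<bullet> v \<in> I}"
      then have v: "v \<in> carrier_vec 1" "v $ 0 \<in> I" using one by (auto simp: d'_def)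
      then obtain w where w: "w \<in> carrier_vec (length (d 0))" "v $ 0 = g \<bullet> w" using surj by fastforce
      then have "v = ?G *\<^sub>v w" unfolding G using v by (intro eq_vecI) auto
      then show "v \<in> (\<lambda>w. D' 0 *\<^sub>v w) ` carrier_vec (length (d' 1))" using w(1) by (auto simp: d'_def D'_def)
    next
      fix v assume "v \<in> (\<lambda>w. D' 0 *\<^sub>v w) ` carrier_vec (length (d' 1))"
      then obtain w where "w \<in> carrier_vec (length (d' 1))" "v = D' 0 *\<^sub>v w" by blast
      then have w: "w \<in> carrier_vec (length (d 0))" "v = vec 1 (\<lambda>_. g \<bullet> w)"
        using G[of w] by (simp_all add: d'_def D'_def)
      then show "v \<in> {v \<in> carrier_vec (length (d' 0)). vec 1 (\<lambda>_. 1) \<bullet> v \<in> I}"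
        using gI[OF w(1)] one[of v] by (simp add: d'_def)
    qed
    show "{v \<in> carrier_vec (length (d' (Suc i))). D' i *\<^sub>v v = 0\<^sub>v (length (d' i))}
       = (\<lambda>w. D' (Suc i) *\<^sub>v w) ` carrier_vec (length (d' (Suc (Suc i))))" for i
    proof (cases i)
      case 0
      have "?G *\<^sub>v v = 0\<^sub>v 1 \<longleftrightarrow> g \<bullet> v = 0" for v unfolding G by (auto simp: vec_eq_iff)
      then show ?thesis using ker0 0 by (simp add: d'_def D'_def)
    next
      case (Suc h)
      then show ?thesis using ker[of h] by (simp add: d'_def D'_def)
    qed
  qed simp
  show "tor_boundaries d' D' (Suc i) j = tor_boundaries d D i j"
    by (simp add: tor_boundaries_def d'_def D'_def)
  show "tor_cycles d' D' (Suc i) j = tor_cycles d D i j"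
  proof (cases i)
    case 0
    \<comment> \<open>The entries of \<open>g\<close> lie in the maximal ideal, so the new
      differential becomes zero over K and imposes no condition on cycles.\<close>
    have "tensor_K ?G *\<^sub>v v = 0\<^sub>v 1" if "v \<in> carrier_vec (length (d 0))" for v :: "'k vec"
    proof (rule eq_vecI)
      fix k assume "k < dim_vec (0\<^sub>v 1 :: 'k vec)"
      moreover have "lookup (g $ c) 0 = 0" if "c < length (d 0)" for c
        using g(2)[OF that] I(2) by (auto simp: max_ideal_def)
      ultimately show "(tensor_K ?G *\<^sub>v v) $ k = 0\<^sub>v 1 $ k"
        using that by (auto simp: tensor_K_def index_mult_mat_vec scalar_prod_def intro!: sum.neutral)
    qed (simp add: tensor_K_def)
    then show ?thesis using 0 by (auto simp: tor_cycles_def d'_def D'_def graded_part_def)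
  next
    case (Suc h)
    then show ?thesis by (simp add: tor_cycles_def d'_def D'_def)
  qed
qed

text \<open>The lower bound \<open>a\<close> makes the set of differences finite, as
  \<open>Max\<close> requires.\<close>

lemma Max_degrees_eqI:
  assumes "\<And>i j. T i j \<Longrightarrow> a \<le> j - int i \<and> j - int i \<le> s" "T i0 (int i0 + s)"
  shows "Max {j - int i |i j. T i j} = s"
proof (rule Max_eqI)
  have sub: "{j - int i |i j. T i j} \<subseteq> {a..s}"
  proof
    fix x assume "x \<in> {j - int i |i j. T i j}"
    then obtain i j where "x = j - int i" "T i j" by blast
    then show "x \<in> {a..s}" using assms(1)[of i j] by simp
  qed
  then show "finite {j - int i |i j. T i j}" by (rule finite_subset) simp
  show "x \<le> s" if "x \<in> {j - int i |i j. T i j}" for x using subsetD[OF sub that] by simp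
  have "s = (int i0 + s) - int i0" by simp
  then show "s \<in> {j - int i |i j. T i j}" using assms(2) by blast
qed

text \<open>If every element were join prime, primality of \<open>sup a b\<close> would make
  \<open>a\<close> and \<open>b\<close> comparable, and a chain has no Hibi relations.\<close>

lemma card_ext_irreducibles_less:
  assumes "hibi_ideal \<noteq> ({0} :: ('l::{finite, distrib_lattice}, 'k::field) mpoly set)"
  shows "card (ext_irreducibles :: 'l set) < card (UNIV :: 'l set)"
proof (rule ccontr)
  assume "\<not> card (ext_irreducibles :: 'l set) < card (UNIV :: 'l set)"
  then have "card (ext_irreducibles :: 'l set) = card (UNIV :: 'l set)"
    using card_mono[of "UNIV :: 'l set" ext_irreducibles] by simp
  then have all: "ext_irreducibles = (UNIV :: 'l set)" by (intro card_subset_eq) auto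
  have "a \<le> b \<or> b \<le> a" for a b :: 'l
    using ext_irreducible_prime[of "sup a b" a b] all by auto
  then have empty: "{Var a * Var b - Var (inf a b) * Var (sup a b) | a b :: 'l. \<not> a \<le> b \<and> \<not> b \<le> a} = ({} :: ('l, 'k) mpoly set)"
    by blast
  have "hibi_ideal = (ideal_generated {} :: ('l, 'k) mpoly set)" unfolding hibi_ideal_def empty ..
  moreover have "p = 0" if "p \<in> ideal_generated {}" for p :: "('l, 'k) mpoly"
    using that by (induction rule: ideal_generated_induct) auto
  ultimately show False using assms ideal_set_zero[OF ideal_set_hibi] by blast
qed

theorem theorem1p1:
  shows "reg_ideal (hibi_ideal :: ('l::{finite, distrib_lattice}, 'k::field) mpoly set)
    = int (card (join_irreducibles :: 'l set)) - poset_rank (join_irreducibles :: 'l set)"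
proof -
  let ?I = "hibi_ideal :: ('l, 'k) mpoly set"
  let ?s = "top_degree TYPE('l)"
  let ?t = "card (UNIV :: 'l set) - card (ext_irreducibles :: 'l set)"
  have "reg_ideal ?I = ?s + 1"
  proof (cases "?I = {0}")
    case True
    \<comment> \<open>With the Hibi ideal zero, a resolution of the unit ideal is one of the residue
      class ring.\<close>
    have "ideal_set (UNIV :: ('l, 'k) mpoly set)" "graded_set (UNIV :: ('l, 'k) mpoly set)"
      by (simp_all add: ideal_set_def graded_set_def)
    then obtain d D g where "graded_free_resolution (UNIV :: ('l, 'k) mpoly set) {0} d D g"
      using exists_resolution by blast
    then have "tor_nonzero UNIV ?I ?t (int ?t + ?s)"
      using tor_hibi(2) True unfolding tor_nonzero_def by metis
    moreover have "0 \<le> j - int i \<and> j - int i \<le> ?s" if "tor_nonzero UNIV ?I i j" for i j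
      using that tor_hibi(1) unfolding tor_nonzero_def by blast
    ultimately have "reg UNIV ?I = ?s" unfolding reg_def by (intro Max_degrees_eqI)
    then show ?thesis using True by (simp add: reg_ideal_def)
  next
    case False
    obtain d D g where res: "graded_free_resolution ?I {0} d D g"
      using exists_resolution[OF ideal_set_hibi graded_set_hibi] by blast
    \<comment> \<open>The top class of the residue class ring sits in positive homological degree,
      hence comes from the resolution of the ideal, one step lower in homological degree but with
      the same \<open>j\<close>.\<close>
    have t: "Suc (?t - 1) = ?t" using card_ext_irreducibles_less[OF False] by simp
    note shift = shift_resolution[OF _ ideal_set_hibi hibi_subset_max_ideal]
    have "\<not> tor_cycles d D (?t - 1) (int ?t + ?s) \<subseteq> tor_boundaries d D (?t - 1) (int ?t + ?s)"
      using tor_hibi(2)[OF shift(1)[OF res]] shift(2,3)[OF res, of "?t - 1"] unfolding t by metis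
    then have "tor_nonzero ?I {0} (?t - 1) (int ?t + ?s)" using res unfolding tor_nonzero_def by blast
    moreover have "int ?t + ?s = int (?t - 1) + (?s + 1)" using t by linarith
    ultimately have "tor_nonzero ?I {0} (?t - 1) (int (?t - 1) + (?s + 1))" by metis
    \<comment> \<open>Homological degree \<open>i\<close> for the ideal is \<open>Suc i\<close> for
      the residue class ring, which shifts both bounds by one.\<close>
    moreover have "1 \<le> j - int i \<and> j - int i \<le> ?s + 1" if nz: "tor_nonzero ?I {0} i j" for i j
    proof -
      obtain d D g where res: "graded_free_resolution ?I {0} d D g"
        and "\<not> tor_cycles d D i j \<subseteq> tor_boundaries d D i j" using nz unfolding tor_nonzero_def by blast
      then have "0 \<le> j - int (Suc i) \<and> j - int (Suc i) \<le> ?s"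
        using tor_hibi(1)[OF shift(1)[OF res], of "Suc i" j] shift(2,3)[OF res, of i j] by metis
      then show ?thesis by simp
    qed
    ultimately have "reg ?I {0} = ?s + 1" unfolding reg_def by (intro Max_degrees_eqI)
    then show ?thesis using False by (simp add: reg_ideal_def)
  qed
  then show ?thesis by (simp add: top_degree_def)
qed

end
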